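(* Let $\mathbf{k}$ be a field, $A$ a unital $\mathbf{k}$-algebra, and let $(P,\mu_P)$ be a shifted projective bimodule resolution of $A$ with weakly counital $A_\infty$-coalgebra structure $\delta$ (with $\delta_1=d_P$ and weak counit $\mu_P$). Let $\alpha$ be an $A_\infty$-coderivation on $P$ of degree $n$. Then $(-1)^n\alpha_1$ is a homotopy lifting for $(\alpha_0,\delta_2)$.
   Context: Conventions. $A^e=A\otimes_{\mathbf{k}}A^{op}$; $A$-bimodules are identified with $A^e$-modules, and $A$ is regarded as a complex concentrated in degree $0$. Complexes have differentials of degree $1$. All maps between graded bimodules are $A^e$-linear. The Koszul sign rule is used: $(f\otimes_A g)(x\otimes_A y)=(-1)^{|g||x|}f(x)\otimes_A g(y)$. For a homogeneous map $f:X\to Y$ of complexes of bimodules, $\partial(f)=d_Yf-(-1)^{|f|}fd_X$; $f\sim g$ means $f-g=\partial(h)$ for some $h$. $1$ denotes identity maps and $C^{\otimes_A 0}=A$. An $A_\infty$-coalgebra is a graded $A$-bimodule $C$ with maps $\delta_n:C\to C^{\otimes_A n}$, $n\ge 1$, of degree $1$ (put $\delta_0=0$) such that $\sum_{r+s+t=N}(1^{\otimes_A r}\otimes_A\delta_s\otimes_A 1^{\otimes_A t})\delta_{N-s+1}=0$ for all $N\ge 0$. It is weakly counital, with weak counit $\mu$, if $\mu:C\to A$ is a bimodule map of degree $-1$ with $(\mu\otimes_A\mu)\delta_2=\mu$ and $\mu^{\otimes_A n}\delta_n=0$ for all $n>2$. If $P'$ is a projective $A$-bimodule resolution of $A$ (in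 degrees $\le 0$), the associated shifted projective bimodule resolution is the complex $P$ with $P_{i}=P'_{i-1}$ and differential $d_P$, together with the bimodule chain map $\mu_P:P\to A$ of degree $-1$ given by the augmentation, which is a quasi-isomorphism up to the shift. An $A_\infty$-coderivation of degree $l$ on $C$ is a sequence $\alpha=(\alpha_n)_{n\ge0}$ of maps $\alpha_n:C\to C^{\otimes_A n}$ of degree $l$ such that for all $N\ge0$ \[ \sum_{r+s+t=N}(1^{\otimes_A r}\otimes_A\delta_s\otimes_A1^{\otimes_A t})\alpha_{N-s+1}=(-1)^l\sum_{r+s+t=N}(1^{\otimes_A r}\otimes_A\alpha_s\otimes_A1^{\otimes_A t})\delta_{N-s+1}. \] Homotopy lifting: for a chain map $f:P\to A$, a map $\phi_f:P\to P$ is a homotopy lifting of the pair $(f,\delta_2)$ if $\partial(\phi_f)=(f\otimes_A1+1\otimes_Af)\delta_2$ and $\mu_P\phi_f+f\phi\sim0$ for some $\phi:P\to P$ of degree $-1$ such that $\partial(\phi)=(\mu_P\otimes_A1+1\otimes_A\mu_P)\delta_2$. *)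

theory Defs
  imports
    Complex_Main
    "HOL-Library.Poly_Mapping"
    "HOL-Library.Set_Algebras"
    "HOL-Computational_Algebra.Group_Closure"
begin

text \<open>
  A unital ring is a type of sort \<open>{ring, monoid_mult}\<close>, which, unlike \<open>ring_1\<close>, admits the
  zero ring. The map \<open>s\<close> is the scalar multiplication of the ground field.
\<close>

definition unital_algebra ::
    "('k::field \<Rightarrow> 'a::{ring,monoid_mult} \<Rightarrow> 'a) \<Rightarrow> bool" where
  "unital_algebra s \<longleftrightarrow>
     vector_space s \<and> (\<forall>c x y. s c x * y = s c (x * y) \<and> x * s c y = s c (x * y))"


section \<open>Graded bimodules and their maps\<close>

record ('a, 'm) bimodule =
  lact :: "'a \<Rightarrow> 'm \<Rightarrow> 'm"
  ract :: "'m \<Rightarrow> 'a \<Rightarrow> 'm"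

record ('a, 'm) gbimodule = "('a, 'm) bimodule" +
  component :: "int \<Rightarrow> 'm set"

text \<open>
  The type \<open>'p\<close> is the direct sum of the homogeneous components \<open>component M i\<close>. The ground field
  acts in the same way from both sides, so that these are modules over \<open>A \<otimes>\<^sub>k A\<^sup>o\<^sup>p\<close>.
\<close>

definition graded_bimodule ::
    "('k::field \<Rightarrow> 'a::{ring,monoid_mult} \<Rightarrow> 'a) \<Rightarrow> ('a, 'p::ab_group_add) gbimodule \<Rightarrow> bool" where
  "graded_bimodule s M \<longleftrightarrow>
     (\<forall>a x y. lact M a (x + y) = lact M a x + lact M a y) \<and>
     (\<forall>a b x. lact M (a + b) x = lact M a x + lact M b x) \<and>
     (\<forall>a b x. lact M (a * b) x = lact M a (lact M b x)) \<and>
     (\<forall>x. lact M 1 x = x) \<and>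
     (\<forall>x y a. ract M (x + y) a = ract M x a + ract M y a) \<and>
     (\<forall>x a b. ract M x (a + b) = ract M x a + ract M x b) \<and>
     (\<forall>x a b. ract M x (a * b) = ract M (ract M x a) b) \<and>
     (\<forall>x. ract M x 1 = x) \<and>
     (\<forall>a x b. ract M (lact M a x) b = lact M a (ract M x b)) \<and>
     (\<forall>c x. lact M (s c 1) x = ract M x (s c 1)) \<and>
     (\<forall>i. 0 \<in> component M i) \<and>
     (\<forall>i. \<forall>x\<in>component M i. \<forall>y\<in>component M i. x - y \<in> component M i) \<and>
     (\<forall>i a. \<forall>x\<in>component M i. lact M a x \<in> component M i \<and> ract M x a \<in> component M i) \<and>
     (\<forall>x. \<exists>!c. finite {i. c i \<noteq> 0} \<and> (\<forall>i. c i \<in> component M i) \<and> x = (\<Sum>i | c i \<noteq> 0. c i))"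

definition bimodule_hom ::
    "'m::plus set \<Rightarrow> ('a, 'm, 'x) bimodule_scheme \<Rightarrow> ('a, 'n::plus, 'y) bimodule_scheme \<Rightarrow>
     ('m \<Rightarrow> 'n) \<Rightarrow> bool" where
  "bimodule_hom S M N f \<longleftrightarrow>
     (\<forall>x\<in>S. \<forall>y\<in>S. f (x + y) = f x + f y) \<and>
     (\<forall>x\<in>S. \<forall>a. f (lact M a x) = lact N a (f x) \<and> f (ract M x a) = ract N (f x) a)"

definition graded_map ::
    "int \<Rightarrow> ('a, 'm::plus) gbimodule \<Rightarrow> ('a, 'n::plus) gbimodule \<Rightarrow> ('m \<Rightarrow> 'n) \<Rightarrow> bool" where
  "graded_map l M N f \<longleftrightarrow>
     bimodule_hom UNIV M N f \<and> (\<forall>i. f ` component M i \<subseteq> component N (i + l))"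

definition regular_bimodule :: "('a::{ring,monoid_mult}, 'a) gbimodule" where
  "regular_bimodule = \<lparr>lact = (*), ract = (*), component = (\<lambda>i. if i = 0 then UNIV else {0})\<rparr>"

definition signed :: "int \<Rightarrow> 'g::ab_group_add \<Rightarrow> 'g" where
  "signed m x = (if even m then x else - x)"

definition hom_diff ::
    "('m \<Rightarrow> 'm) \<Rightarrow> ('n \<Rightarrow> 'n::ab_group_add) \<Rightarrow> int \<Rightarrow> ('m \<Rightarrow> 'n) \<Rightarrow> 'm \<Rightarrow> 'n" where
  "hom_diff dM dN l f = (\<lambda>x. dN (f x) - signed l (f (dM x)))"

text \<open>Homotopy of maps of degree \<open>l\<close>.\<close>

definition homotopic ::
    "('a, 'm::plus) gbimodule \<Rightarrow> ('m \<Rightarrow> 'm) \<Rightarrow> ('a, 'n::ab_group_add) gbimodule \<Rightarrow> ('n \<Rightarrow> 'n) \<Rightarrow>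
     int \<Rightarrow> ('m \<Rightarrow> 'n) \<Rightarrow> ('m \<Rightarrow> 'n) \<Rightarrow> bool" where
  "homotopic M dM N dN l f g \<longleftrightarrow>
     (\<exists>h. graded_map (l - 1) M N h \<and> (\<lambda>x. f x - g x) = hom_diff dM dN (l - 1) h)"


section \<open>Projective bimodules and resolutions\<close>

text \<open>
  The free bimodule \<open>A \<otimes>\<^sub>k k\<^sup>(\<^sup>X\<^sup>) \<otimes>\<^sub>k A\<close>, that is, the free module over \<open>A \<otimes>\<^sub>k A\<^sup>o\<^sup>p\<close> on \<open>X\<close>:
  its elements are cosets in the free abelian group on triples \<open>(a, x, b)\<close>.
\<close>

definition free_bimodule_relators ::
    "('k::field \<Rightarrow> 'a::{ring,monoid_mult} \<Rightarrow> 'a) \<Rightarrow> ('a \<times> 'x \<times> 'a \<Rightarrow>\<^sub>0 int) set" where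
  "free_bimodule_relators s =
     {frag_of (a + a', x, b) - frag_of (a, x, b) - frag_of (a', x, b) | a a' x b. True} \<union>
     {frag_of (a, x, b + b') - frag_of (a, x, b) - frag_of (a, x, b') | a x b b'. True} \<union>
     {frag_of (s c a, x, b) - frag_of (a, x, s c b) | c a x b. True}"

definition free_bimodule ::
    "('k::field \<Rightarrow> 'a::{ring,monoid_mult} \<Rightarrow> 'a) \<Rightarrow> ('a, ('a \<times> 'x \<times> 'a \<Rightarrow>\<^sub>0 int) set) bimodule" where
  "free_bimodule s =
     \<lparr>lact = (\<lambda>c U. frag_extend (\<lambda>(a, x, b). frag_of (c * a, x, b)) ` U
                     + group_closure (free_bimodule_relators s)),
      ract = (\<lambda>U c. frag_extend (\<lambda>(a, x, b). frag_of (a, x, b * c)) ` U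
                     + group_closure (free_bimodule_relators s))\<rparr>"

definition free_bimodule_carrier ::
    "('k::field \<Rightarrow> 'a::{ring,monoid_mult} \<Rightarrow> 'a) \<Rightarrow> 'x set \<Rightarrow> ('a \<times> 'x \<times> 'a \<Rightarrow>\<^sub>0 int) set set" where
  "free_bimodule_carrier s X =
     {u +o group_closure (free_bimodule_relators s) | u.
        Poly_Mapping.keys u \<subseteq> UNIV \<times> X \<times> UNIV}"

text \<open>
  Direct summands of free bimodules. Bases inside \<open>'p\<close> suffice: a projective bimodule is a summand
  of the free bimodule on any set of its generators.
\<close>

definition projective_bimodule ::
    "('k::field \<Rightarrow> 'a::{ring,monoid_mult} \<Rightarrow> 'a) \<Rightarrow> ('a, 'p::ab_group_add) gbimodule \<Rightarrow> 'p set \<Rightarrow> bool"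
  where
  "projective_bimodule s M S \<longleftrightarrow>
     (\<exists>(X :: 'p set) i q.
        bimodule_hom S M (free_bimodule s) i \<and> i ` S \<subseteq> free_bimodule_carrier s X \<and>
        bimodule_hom (free_bimodule_carrier s X) (free_bimodule s) M q \<and>
        q ` free_bimodule_carrier s X \<subseteq> S \<and>
        (\<forall>x\<in>S. q (i x) = x))"

definition projective_resolution ::
    "('k::field \<Rightarrow> 'a::{ring,monoid_mult} \<Rightarrow> 'a) \<Rightarrow> ('a, 'p::ab_group_add) gbimodule \<Rightarrow>
     ('p \<Rightarrow> 'p) \<Rightarrow> ('p \<Rightarrow> 'a) \<Rightarrow> bool" where
  "projective_resolution s M d \<epsilon> \<longleftrightarrow>
     graded_bimodule s M \<and>
     (\<forall>i>0. component M i = {0}) \<and>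
     (\<forall>i. projective_bimodule s M (component M i)) \<and>
     graded_map 1 M M d \<and> (\<forall>x. d (d x) = 0) \<and>
     graded_map 0 M regular_bimodule \<epsilon> \<and> (\<forall>x. \<epsilon> (d x) = 0) \<and>
     (\<forall>i<0. \<forall>x\<in>component M i. d x = 0 \<longrightarrow> x \<in> d ` component M (i - 1)) \<and>
     (\<forall>x\<in>component M 0. \<epsilon> x = 0 \<longrightarrow> x \<in> d ` component M (-1)) \<and>
     \<epsilon> ` component M 0 = UNIV"

definition shift :: "('a, 'p) gbimodule \<Rightarrow> ('a, 'p) gbimodule" where
  "shift M = M\<lparr>component := (\<lambda>i. component M (i - 1))\<rparr>"

definition shifted_projective_resolution ::
    "('k::field \<Rightarrow> 'a::{ring,monoid_mult} \<Rightarrow> 'a) \<Rightarrow> ('a, 'p::ab_group_add) gbimodule \<Rightarrow>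
     ('p \<Rightarrow> 'p) \<Rightarrow> ('p \<Rightarrow> 'a) \<Rightarrow> bool" where
  "shifted_projective_resolution s P d \<mu> \<longleftrightarrow>
     (\<exists>P'. projective_resolution s P' d \<mu> \<and> P = shift P')"


section \<open>Tensor powers over the algebra\<close>

text \<open>
  All tensor powers of \<open>M\<close> over \<open>A\<close> live in the tensor ring of \<open>M\<close>, the quotient of the free ring on
  letters \<open>Inl a\<close> (\<open>a\<close> in \<open>A\<close>) and \<open>Inr x\<close> (\<open>x\<close> in \<open>M\<close>) by the ideal below. A word with \<open>n\<close> letters
  from \<open>M\<close> represents an element of the \<open>n\<close>-th tensor power, the zeroth one being \<open>A\<close>; letters from
  \<open>A\<close> implement the identifications of \<open>A \<otimes>\<^sub>A M\<close> and \<open>M \<otimes>\<^sub>A A\<close> with \<open>M\<close>, and multiplication is the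
  tensor product over \<open>A\<close>.
\<close>

instantiation list :: (type) monoid_add
begin

definition zero_list :: "'a list" where "zero_list = []"

definition plus_list :: "'a list \<Rightarrow> 'a list \<Rightarrow> 'a list" where "plus_list = (@)"

instance by standard (simp_all add: zero_list_def plus_list_def)

end

type_synonym ('a, 'm) words = "('a + 'm) list \<Rightarrow>\<^sub>0 int"

definition tensor_relators ::
    "('a::{ring,monoid_mult}, 'm::ab_group_add) gbimodule \<Rightarrow> ('a, 'm) words set" where
  "tensor_relators M =
     {frag_of [Inl (a + b)] - frag_of [Inl a] - frag_of [Inl b] | a b. True} \<union>
     {frag_of [Inl a, Inl b] - frag_of [Inl (a * b)] | a b. True} \<union>
     {frag_of [Inl 1] - frag_of []} \<union>
     {frag_of [Inr (x + y)] - frag_of [Inr x] - frag_of [Inr y] | x y. True} \<union>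
     {frag_of [Inl a, Inr x] - frag_of [Inr (lact M a x)] | a x. True} \<union>
     {frag_of [Inr x, Inl a] - frag_of [Inr (ract M x a)] | x a. True}"

definition tensor_ideal ::
    "('a::{ring,monoid_mult}, 'm::ab_group_add) gbimodule \<Rightarrow> ('a, 'm) words set" where
  "tensor_ideal M = group_closure {u * r * v | u r v. r \<in> tensor_relators M}"

text \<open>
  Elements of tensor powers are cosets of the ideal, and the zero element is the ideal itself. The
  sum of cosets is their elementwise sum \<open>+\<close>, so finite nonempty sums are given by \<open>sum\<close>; the product
  and the sign need separate definitions (\<open>-\<close> on sets is the complement).
\<close>

definition tensor_class ::
    "('a::{ring,monoid_mult}, 'm::ab_group_add) gbimodule \<Rightarrow> ('a, 'm) words \<Rightarrow> ('a, 'm) words set" where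
  "tensor_class M u = u +o tensor_ideal M"

definition tensor_mult ::
    "('a::{ring,monoid_mult}, 'm::ab_group_add) gbimodule \<Rightarrow>
     ('a, 'm) words set \<Rightarrow> ('a, 'm) words set \<Rightarrow> ('a, 'm) words set" where
  "tensor_mult M U V = U * V + tensor_ideal M"

definition tensor_list ::
    "('a::{ring,monoid_mult}, 'm::ab_group_add) gbimodule \<Rightarrow>
     ('a, 'm) words set list \<Rightarrow> ('a, 'm) words set" where
  "tensor_list M Us = foldr (tensor_mult M) Us (tensor_class M 1)"

definition tensor_signed :: "int \<Rightarrow> ('a, 'm) words set \<Rightarrow> ('a, 'm) words set" where
  "tensor_signed m U = (if even m then U else uminus ` U)"

text \<open>The identifications of \<open>A\<close> and \<open>M\<close> with the zeroth and first tensor power; both are injective.\<close>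

definition tensor_of_alg ::
    "('a::{ring,monoid_mult}, 'm::ab_group_add) gbimodule \<Rightarrow> 'a \<Rightarrow> ('a, 'm) words set" where
  "tensor_of_alg M a = tensor_class M (frag_of [Inl a])"

definition tensor_of_mod ::
    "('a::{ring,monoid_mult}, 'm::ab_group_add) gbimodule \<Rightarrow> 'm \<Rightarrow> ('a, 'm) words set" where
  "tensor_of_mod M x = tensor_class M (frag_of [Inr x])"

definition tensor_carrier ::
    "('a::{ring,monoid_mult}, 'm::ab_group_add) gbimodule \<Rightarrow> nat \<Rightarrow> ('a, 'm) words set set" where
  "tensor_carrier M n = tensor_class M ` group_closure
     {frag_of (Inl a # map Inr xs) | a xs. length xs = n}"

definition tensor_power ::
    "('a::{ring,monoid_mult}, 'm::ab_group_add) gbimodule \<Rightarrow> nat \<Rightarrow>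
     ('a, ('a, 'm) words set) gbimodule" where
  "tensor_power M n =
     \<lparr>lact = (\<lambda>a U. tensor_mult M (tensor_of_alg M a) U),
      ract = (\<lambda>U a. tensor_mult M U (tensor_of_alg M a)),
      component = (\<lambda>i. tensor_class M ` group_closure
        {frag_of (Inl a # map Inr xs) | a xs js.
           length xs = n \<and> list_all2 (\<lambda>x j. x \<in> component M j) xs js \<and> sum_list js = i})\<rparr>"

text \<open>
  Iterating the Koszul sign rule, \<open>f\<^sub>1 \<otimes> \<dots> \<otimes> f\<^sub>n\<close> maps \<open>x\<^sub>1 \<otimes> \<dots> \<otimes> x\<^sub>n\<close> to
  \<open>f\<^sub>1 x\<^sub>1 \<otimes> \<dots> \<otimes> f\<^sub>n x\<^sub>n\<close> with sign exponent the sum of all \<open>|f\<^sub>j| |x\<^sub>i|\<close> for \<open>i < j\<close>.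
\<close>

fun koszul_exponent :: "int list \<Rightarrow> int list \<Rightarrow> int" where
  "koszul_exponent (l # ls) (j # js) = sum_list ls * j + koszul_exponent ls js"
| "koszul_exponent _ _ = 0"

text \<open>
  The map \<open>f\<^sub>1 \<otimes> \<dots> \<otimes> f\<^sub>n\<close> on the \<open>n\<close>-th tensor power, for \<open>n \<ge> 1\<close> and bimodule maps \<open>f\<^sub>i\<close> from \<open>M\<close> to
  tensor powers of \<open>M\<close>; each map is listed with its degree. It is the unique additive map with the
  given values on tensors of homogeneous elements.
\<close>

definition tensor_map ::
    "('a::{ring,monoid_mult}, 'm::ab_group_add) gbimodule \<Rightarrow>
     (('m \<Rightarrow> ('a, 'm) words set) \<times> int) list \<Rightarrow> ('a, 'm) words set \<Rightarrow> ('a, 'm) words set" where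
  "tensor_map M fs = (THE h.
     (\<forall>U. U \<notin> tensor_carrier M (length fs) \<longrightarrow> h U = undefined) \<and>
     (\<forall>U\<in>tensor_carrier M (length fs). h U \<in> range (tensor_class M)) \<and>
     (\<forall>U\<in>tensor_carrier M (length fs). \<forall>V\<in>tensor_carrier M (length fs). h (U + V) = h U + h V) \<and>
     (\<forall>xs js. length xs = length fs \<and> list_all2 (\<lambda>x j. x \<in> component M j) xs js \<longrightarrow>
        h (tensor_list M (map (tensor_of_mod M) xs)) =
        tensor_signed (koszul_exponent (map snd fs) js)
          (tensor_list M (map2 (\<lambda>f x. fst f x) fs xs))))"

text \<open>\<open>1\<^sup>\<otimes>\<^sup>r \<otimes> f \<otimes> 1\<^sup>\<otimes>\<^sup>t\<close> for \<open>f\<close> of degree \<open>l\<close>.\<close>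

definition tensor_insert ::
    "('a::{ring,monoid_mult}, 'm::ab_group_add) gbimodule \<Rightarrow>
     nat \<Rightarrow> int \<Rightarrow> ('m \<Rightarrow> ('a, 'm) words set) \<Rightarrow> nat \<Rightarrow> ('a, 'm) words set \<Rightarrow> ('a, 'm) words set" where
  "tensor_insert M r l f t =
     tensor_map M (replicate r (tensor_of_mod M, 0) @ (f, l) # replicate t (tensor_of_mod M, 0))"


section \<open>\<open>A\<^sub>\<infinity>\<close>-coalgebras, coderivations and homotopy liftings\<close>

definition A_infinity_coalgebra ::
    "('k::field \<Rightarrow> 'a::{ring,monoid_mult} \<Rightarrow> 'a) \<Rightarrow> ('a, 'm::ab_group_add) gbimodule \<Rightarrow>
     (nat \<Rightarrow> 'm \<Rightarrow> ('a, 'm) words set) \<Rightarrow> bool" where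
  "A_infinity_coalgebra scl M \<delta> \<longleftrightarrow>
     graded_bimodule scl M \<and>
     (\<forall>x. \<delta> 0 x = tensor_class M 0) \<and>
     (\<forall>n\<ge>1. graded_map 1 M (tensor_power M n) (\<delta> n)) \<and>
     (\<forall>N x. (\<Sum>(r, s, t)\<in>{(r, s, t). r + s + t = N}.
                tensor_insert M r 1 (\<delta> s) t (\<delta> (N - s + 1) x)) = tensor_class M 0)"

definition weak_counit ::
    "('a::{ring,monoid_mult}, 'm::ab_group_add) gbimodule \<Rightarrow>
     (nat \<Rightarrow> 'm \<Rightarrow> ('a, 'm) words set) \<Rightarrow> ('m \<Rightarrow> 'a) \<Rightarrow> bool" where
  "weak_counit M \<delta> \<mu> \<longleftrightarrow>
     graded_map (-1) M regular_bimodule \<mu> \<and>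
     (\<forall>x. tensor_map M (replicate 2 (tensor_of_alg M \<circ> \<mu>, -1)) (\<delta> 2 x) = tensor_of_alg M (\<mu> x)) \<and>
     (\<forall>n>2. \<forall>x. tensor_map M (replicate n (tensor_of_alg M \<circ> \<mu>, -1)) (\<delta> n x) = tensor_class M 0)"

definition A_infinity_coderivation ::
    "('a::{ring,monoid_mult}, 'm::ab_group_add) gbimodule \<Rightarrow>
     (nat \<Rightarrow> 'm \<Rightarrow> ('a, 'm) words set) \<Rightarrow> int \<Rightarrow> (nat \<Rightarrow> 'm \<Rightarrow> ('a, 'm) words set) \<Rightarrow> bool" where
  "A_infinity_coderivation M \<delta> l \<alpha> \<longleftrightarrow>
     (\<forall>n. graded_map l M (tensor_power M n) (\<alpha> n)) \<and>
     (\<forall>N x. (\<Sum>(r, s, t)\<in>{(r, s, t). r + s + t = N}.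
                tensor_insert M r 1 (\<delta> s) t (\<alpha> (N - s + 1) x)) =
            tensor_signed l
              (\<Sum>(r, s, t)\<in>{(r, s, t). r + s + t = N}.
                tensor_insert M r l (\<alpha> s) t (\<delta> (N - s + 1) x)))"

text \<open>The maps \<open>(f \<otimes> 1 + 1 \<otimes> f) \<delta>\<^sub>2\<close> for \<open>f\<close> of degree \<open>l\<close> with values in \<open>A\<close>.\<close>

definition tensor_commutator ::
    "('a::{ring,monoid_mult}, 'm::ab_group_add) gbimodule \<Rightarrow> ('m \<Rightarrow> ('a, 'm) words set) \<Rightarrow>
     int \<Rightarrow> ('m \<Rightarrow> 'a) \<Rightarrow> 'm \<Rightarrow> ('a, 'm) words set" where
  "tensor_commutator M \<delta>2 l f x =
     tensor_map M [(tensor_of_alg M \<circ> f, l), (tensor_of_mod M, 0)] (\<delta>2 x) +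
     tensor_map M [(tensor_of_mod M, 0), (tensor_of_alg M \<circ> f, l)] (\<delta>2 x)"

text \<open>
  \<open>\<phi>f\<close> is a homotopy lifting of \<open>(f, \<delta>2)\<close> for a chain map \<open>f\<close> of degree \<open>l\<close> from \<open>P\<close> to \<open>A\<close>. As \<open>\<delta>2\<close>
  has degree \<open>1\<close>, the degree of \<open>\<phi>f\<close> is also \<open>l\<close>.
\<close>

definition homotopy_lifting ::
    "('a::{ring,monoid_mult}, 'm::ab_group_add) gbimodule \<Rightarrow> ('m \<Rightarrow> 'm) \<Rightarrow> ('m \<Rightarrow> 'a) \<Rightarrow>
     ('m \<Rightarrow> ('a, 'm) words set) \<Rightarrow> int \<Rightarrow> ('m \<Rightarrow> 'a) \<Rightarrow> ('m \<Rightarrow> 'm) \<Rightarrow> bool" where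
  "homotopy_lifting P d \<mu> \<delta>2 l f \<phi>f \<longleftrightarrow>
     graded_map l P regular_bimodule f \<and> hom_diff d (\<lambda>_. 0) l f = (\<lambda>_. 0) \<and>
     graded_map l P P \<phi>f \<and>
     (\<forall>x. tensor_of_mod P (hom_diff d d l \<phi>f x) = tensor_commutator P \<delta>2 l f x) \<and>
     (\<exists>\<phi>. graded_map (-1) P P \<phi> \<and>
        (\<forall>x. tensor_of_mod P (hom_diff d d (-1) \<phi> x) = tensor_commutator P \<delta>2 (-1) \<mu> x) \<and>
        homotopic P d regular_bimodule (\<lambda>_. 0) (l - 1) (\<lambda>x. \<mu> (\<phi>f x) + f (\<phi> x)) (\<lambda>_. 0))"

end

theory Submission
  imports Defs "HOL-Library.Product_Plus"
begin

text \<open>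
  Write \<open>L = (\<mu> \<otimes> 1) \<delta>\<^sub>2\<close> and \<open>R = (1 \<otimes> \<mu>) \<delta>\<^sub>2\<close>. The relations of the coalgebra make both of them chain
  endomorphisms of \<open>P\<close>, and \<open>(\<mu> \<otimes> \<mu>) \<delta>\<^sub>2 = \<mu>\<close> says that \<open>\<mu> R = \<mu>\<close> and \<open>\<mu> L = - \<mu>\<close>. As \<open>P\<close> is a
  resolution, a chain map of degree \<open>0\<close> killed by \<open>\<mu>\<close>, and every chain map of negative degree, is
  null-homotopic (\<open>null_homotopic\<close>). Hence \<open>L + R = \<partial>(\<phi>)\<close> for some \<open>\<phi>\<close>, and \<open>T = R - L - 1\<close> is
  homotopic to the identity.

  The coderivation identities for \<open>N = 0\<close> and \<open>N = 1\<close> say that \<open>\<alpha>\<^sub>0\<close> is a cocycle and that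
  \<open>\<partial>((-1)\<^sup>n \<alpha>\<^sub>1) = (\<alpha>\<^sub>0 \<otimes> 1 + 1 \<otimes> \<alpha>\<^sub>0) \<delta>\<^sub>2\<close>. What remains is that the cocycle
  \<open>g = (-1)\<^sup>n \<mu> \<alpha>\<^sub>1 + \<alpha>\<^sub>0 \<phi>\<close> is a coboundary. It suffices that \<open>g T\<close> is one, since \<open>T\<close> is homotopic to
  the identity. Let \<open>X\<^sub>1\<close>, \<open>X\<^sub>2\<close>, \<open>X\<^sub>3\<close> be the contractions of \<open>\<delta>\<^sub>3\<close>, up to sign, with \<open>\<mu>\<close> in two of the
  three places and \<open>1\<close> in the third, second and first place. Applying \<open>\<mu> \<otimes> \<mu>\<close> to the coderivation
  identity for \<open>N = 2\<close> shows that \<open>(-1)\<^sup>n \<mu> \<alpha>\<^sub>1 T\<close> and \<open>\<alpha>\<^sub>0 (X\<^sub>1 + X\<^sub>2 + X\<^sub>3)\<close> differ by a coboundary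
  (\<open>\<mu>_alpha_1_near_id\<close>), so that \<open>g T\<close> is cohomologous to \<open>\<alpha>\<^sub>0 (\<phi> T + X\<^sub>1 + X\<^sub>2 + X\<^sub>3)\<close>. The
  coassociativity relation for \<open>N = 3\<close> computes \<open>\<partial>(X\<^sub>i)\<close> in terms of \<open>L\<close> and \<open>R\<close>, and the result is
  that \<open>\<phi> T + X\<^sub>1 + X\<^sub>2 + X\<^sub>3\<close> is a chain map of degree \<open>-1\<close>. Hence it is null-homotopic
  (\<open>coassociativity_homotopy\<close>), and its composite with the cocycle \<open>\<alpha>\<^sub>0\<close> is a coboundary.

  All of these computations take place in \<open>A\<close> and \<open>P\<close>. The passage from tensor powers is made by
  contractions: bimodule maps from \<open>P\<close> to \<open>A\<close> or \<open>P\<close> are applied to the letters of a word and the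
  results are multiplied in the square-zero extension \<open>A \<oplus> P\<close>. Koszul signs are absorbed into the
  grading involution of \<open>P\<close>: applying a map of degree \<open>l\<close> to the right of a letter \<open>x\<close> costs the sign
  \<open>(-1)\<^bsup>l |x|\<^esup>\<close>, which is the \<open>l\<close>-th power of the involution applied to \<open>x\<close>. After this substitution a
  tensor product of maps acts letter by letter without signs; so it respects the relations of the
  tensor ring, which gives the existence of the maps \<open>tensor_map\<close>, and it composes with contractions
  letter by letter (\<open>eval_tensor_insert\<close>). Evaluated in this way, the defining relations become
  equations between maps on \<open>P\<close>.
\<close>


section \<open>Additive extension from the free abelian group\<close>

definition int_mult :: "int \<Rightarrow> 'g::ab_group_add \<Rightarrow> 'g" where
  "int_mult k g = (if 0 \<le> k then ((+) g ^^ nat k) 0 else - (((+) g ^^ nat (- k)) 0))"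

lemma int_mult_0 [simp]: "int_mult 0 g = 0"
  by (simp add: int_mult_def)

lemma int_mult_step: "int_mult (k + 1) g = int_mult k g + g"
proof (cases "0 \<le> k")
  case True
  then have "nat (k + 1) = Suc (nat k)"
    by simp
  with True show ?thesis
    by (simp add: int_mult_def)
next
  case False
  then have "nat (- k) = Suc (nat (- (k + 1)))"
    by simp
  with False show ?thesis
    by (auto simp add: int_mult_def)
qed

lemma int_mult_1 [simp]: "int_mult 1 g = g"
  using int_mult_step [of 0 g] by simp

lemma int_mult_add: "int_mult (k + l) g = int_mult k g + int_mult l g"
proof (induction l rule: int_induct [where k = 0])
  case base
  show ?case
    by simp
next
  case (step1 l)
  then show ?case
    using int_mult_step [of "k + l" g] int_mult_step [of l g] by (simp add: add.assoc)
next
  case (step2 l)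
  then show ?case
    using int_mult_step [of "k + l - 1" g] int_mult_step [of "l - 1" g]
    by (simp add: algebra_simps)
qed

definition additive_ext :: "('w \<Rightarrow> 'g::ab_group_add) \<Rightarrow> ('w \<Rightarrow>\<^sub>0 int) \<Rightarrow> 'g" where
  "additive_ext f u = (\<Sum>w\<in>Poly_Mapping.keys u. int_mult (Poly_Mapping.lookup u w) (f w))"

lemma additive_ext_0 [simp]: "additive_ext f 0 = 0"
  by (simp add: additive_ext_def)

lemma additive_ext_of [simp]: "additive_ext f (frag_of w) = f w"
  by (simp add: additive_ext_def)

lemma additive_ext_add: "additive_ext f (u + v) = additive_ext f u + additive_ext f v"
proof -
  let ?K = "Poly_Mapping.keys u \<union> Poly_Mapping.keys v"
  have *: "additive_ext f t = (\<Sum>w\<in>?K. int_mult (Poly_Mapping.lookup t w) (f w))"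
    if "Poly_Mapping.keys t \<subseteq> ?K" for t
    unfolding additive_ext_def using that
    by (intro sum.mono_neutral_left) (auto simp: in_keys_iff)
  show ?thesis
    by (simp add: * Poly_Mapping.keys_add lookup_add int_mult_add sum.distrib)
qed

lemma additive_ext_diff: "additive_ext f (u - v) = additive_ext f u - additive_ext f v"
  using additive_ext_add [of f "u - v" v] by simp

lemma additive_ext_minus: "additive_ext f (- u) = - additive_ext f u"
  using additive_ext_diff [of f 0 u] by simp

lemma frag_ext:
  fixes f g :: "('w \<Rightarrow>\<^sub>0 int) \<Rightarrow> 'g::ab_group_add"
  assumes "\<And>u v. f (u - v) = f u - f v" "\<And>u v. g (u - v) = g u - g v"
    and "\<And>w. f (frag_of w) = g (frag_of w)"
  shows "f u = g u"
proof -
  have "f 0 = 0" "g 0 = 0"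
    using assms(1) [of 0 0] assms(2) [of 0 0] by simp_all
  then show ?thesis
    by (induction u rule: frag_induction [OF subset_UNIV]) (simp_all only: assms)
qed

lemma group_closure_mono: "S \<subseteq> T \<Longrightarrow> group_closure S \<subseteq> group_closure T"
proof
  fix x assume "S \<subseteq> T" "x \<in> group_closure S"
  from this(2,1) show "x \<in> group_closure T"
    by induction (auto intro: group_closure.intros)
qed

lemma group_closure_into:
  assumes "u \<in> group_closure S" and "\<And>x. x \<in> S \<Longrightarrow> f x \<in> J"
    and "0 \<in> J" "\<And>x y. x \<in> J \<Longrightarrow> y \<in> J \<Longrightarrow> x - y \<in> J"
    and "\<And>u v. f (u - v) = f u - (f v :: 'g::ab_group_add)"
  shows "f u \<in> J"
proof -
  have "f 0 = 0"
    using assms(5) [of 0 0] by simp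
  with assms show ?thesis
    by (induction rule: group_closure.induct) auto
qed


section \<open>The tensor ideal\<close>

lemma frag_of_append: "frag_of (v @ w) = frag_of v * frag_of w"
  by (simp add: mult_single plus_list_def)

lemma one_words: "(1 :: ('a, 'm) words) = frag_of []"
  by (simp add: single_one [symmetric] zero_list_def)

context
  fixes M :: "('a::{ring,monoid_mult}, 'm::ab_group_add) gbimodule"
begin

lemma tensor_ideal_0 [simp]: "0 \<in> tensor_ideal M"
  by (simp add: tensor_ideal_def)

lemma tensor_ideal_diff: "u \<in> tensor_ideal M \<Longrightarrow> v \<in> tensor_ideal M \<Longrightarrow> u - v \<in> tensor_ideal M"
  by (simp add: tensor_ideal_def group_closure.diff)

lemma tensor_ideal_add: "u \<in> tensor_ideal M \<Longrightarrow> v \<in> tensor_ideal M \<Longrightarrow> u + v \<in> tensor_ideal M"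
  by (simp add: tensor_ideal_def group_closure_add)

lemma tensor_ideal_minus: "u \<in> tensor_ideal M \<Longrightarrow> - u \<in> tensor_ideal M"
  by (simp add: tensor_ideal_def)

lemma tensor_ideal_relator:
  assumes "r \<in> tensor_relators M"
  shows "r \<in> tensor_ideal M"
proof -
  have "r = 1 * r * 1"
    by simp
  with assms have "r \<in> {u * r * v |u r v. r \<in> tensor_relators M}"
    by blast
  then show ?thesis
    unfolding tensor_ideal_def by (intro group_closure.base) simp
qed

lemma tensor_ideal_mult_left: "u \<in> tensor_ideal M \<Longrightarrow> t * u \<in> tensor_ideal M"
  unfolding tensor_ideal_def
proof (erule group_closure_into)
  fix x assume "x \<in> {u * r * v |u r v. r \<in> tensor_relators M}"
  then obtain u r v where "x = u * r * v" "r \<in> tensor_relators M"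
    by auto
  then have "t * x = (t * u) * r * v"
    by (simp add: mult.assoc)
  with \<open>r \<in> _\<close> show "t * x \<in> group_closure {u * r * v |u r v. r \<in> tensor_relators M}"
    by (auto intro!: group_closure.base)
qed (auto simp: right_diff_distrib group_closure.diff)

lemma tensor_ideal_mult_right: "u \<in> tensor_ideal M \<Longrightarrow> u * t \<in> tensor_ideal M"
  unfolding tensor_ideal_def
proof (erule group_closure_into)
  fix x assume "x \<in> {u * r * v |u r v. r \<in> tensor_relators M}"
  then obtain u r v where "x = u * r * v" "r \<in> tensor_relators M"
    by auto
  then have "x * t = u * r * (v * t)"
    by (simp add: mult.assoc)
  with \<open>r \<in> _\<close> show "x * t \<in> group_closure {u * r * v |u r v. r \<in> tensor_relators M}"
    by (auto intro!: group_closure.base)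
qed (auto simp: left_diff_distrib group_closure.diff)

lemma tensor_class_iff: "u \<in> tensor_class M v \<longleftrightarrow> u - v \<in> tensor_ideal M"
  by (simp add: tensor_class_def set_minus_plus)

lemma tensor_class_eq_iff: "tensor_class M u = tensor_class M v \<longleftrightarrow> u - v \<in> tensor_ideal M"
proof
  assume "tensor_class M u = tensor_class M v"
  moreover have "u \<in> tensor_class M u"
    by (simp add: tensor_class_iff)
  ultimately show "u - v \<in> tensor_ideal M"
    by (simp add: tensor_class_iff)
next
  assume uv: "u - v \<in> tensor_ideal M"
  have "x - u \<in> tensor_ideal M \<longleftrightarrow> x - v \<in> tensor_ideal M" for x
    using tensor_ideal_add [OF _ uv, of "x - u"] tensor_ideal_diff [OF _ uv, of "x - v"] by auto
  then show "tensor_class M u = tensor_class M v"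
    by (auto simp: tensor_class_iff)
qed

lemma tensor_class_add: "tensor_class M u + tensor_class M v = tensor_class M (u + v)"
proof -
  have "tensor_ideal M + tensor_ideal M = tensor_ideal M"
    by (auto simp: set_plus_def intro: tensor_ideal_add) (metis add_0 tensor_ideal_0)
  then show ?thesis
    by (simp add: tensor_class_def set_plus_rearrange)
qed

lemma tensor_class_mult:
  "tensor_mult M (tensor_class M u) (tensor_class M v) = tensor_class M (u * v)"
proof (rule set_eqI)
  fix x
  show "x \<in> tensor_mult M (tensor_class M u) (tensor_class M v) \<longleftrightarrow> x \<in> tensor_class M (u * v)"
  proof
    assume "x \<in> tensor_mult M (tensor_class M u) (tensor_class M v)"
    then obtain a b c where x: "x = a * b + c" and a: "a - u \<in> tensor_ideal M"
      and b: "b - v \<in> tensor_ideal M" and c: "c \<in> tensor_ideal M"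
      by (auto simp: tensor_mult_def set_plus_def set_times_def tensor_class_iff)
    have "x - u * v = (a - u) * b + u * (b - v) + c"
      by (simp add: x algebra_simps)
    with a b c show "x \<in> tensor_class M (u * v)"
      by (simp add: tensor_class_iff tensor_ideal_add tensor_ideal_mult_left tensor_ideal_mult_right)
  next
    assume "x \<in> tensor_class M (u * v)"
    then have "x - u * v \<in> tensor_ideal M"
      by (simp add: tensor_class_iff)
    moreover have "x = u * v + (x - u * v)"
      by simp
    moreover have "u \<in> tensor_class M u" "v \<in> tensor_class M v"
      by (simp_all add: tensor_class_iff)
    ultimately show "x \<in> tensor_mult M (tensor_class M u) (tensor_class M v)"
      unfolding tensor_mult_def by (metis set_plus_intro set_times_intro)
  qed
qed

lemma tensor_signed_class: "tensor_signed k (tensor_class M u) = tensor_class M (signed k u)"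
proof -
  have "x \<in> uminus ` tensor_class M u \<longleftrightarrow> x - - u \<in> tensor_ideal M" for x
  proof -
    have "x \<in> uminus ` tensor_class M u \<longleftrightarrow> - x - u \<in> tensor_ideal M"
      by (auto simp: tensor_class_iff image_iff intro!: bexI [of _ "- x"])
    also have "- x - u = - (x - - u)"
      by simp
    also have "- (x - - u) \<in> tensor_ideal M \<longleftrightarrow> x - - u \<in> tensor_ideal M"
      by (simp only: tensor_ideal_def group_closure_minus_iff)
    finally show ?thesis .
  qed
  then have "uminus ` tensor_class M u = tensor_class M (- u)"
    by (intro set_eqI) (simp only: tensor_class_iff)
  then show ?thesis
    by (simp add: tensor_signed_def signed_def)
qed

lemma sum_tensor_class:
  "finite F \<Longrightarrow> F \<noteq> {} \<Longrightarrow> (\<Sum>i\<in>F. tensor_class M (f i)) = tensor_class M (\<Sum>i\<in>F. f i)"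
  by (induction rule: finite_ne_induct) (simp_all add: tensor_class_add)

end

definition representative ::
    "('a::{ring,monoid_mult}, 'm::ab_group_add) gbimodule \<Rightarrow> ('a, 'm) words set \<Rightarrow> ('a, 'm) words" where
  "representative M U = (SOME u. U = tensor_class M u)"

lemma tensor_class_representative:
  "U \<in> range (tensor_class M) \<Longrightarrow> tensor_class M (representative M U) = U"
  unfolding representative_def by (rule someI2_ex) auto

lemma representative_class: "representative M (tensor_class M u) - u \<in> tensor_ideal M"
  by (simp add: tensor_class_representative flip: tensor_class_eq_iff)


section \<open>Contractions of words\<close>

fun letters :: "('a + 'm) list \<Rightarrow> nat" where
  "letters [] = 0"
| "letters (Inl a # w) = letters w"
| "letters (Inr x # w) = Suc (letters w)"

lemma letters_append [simp]: "letters (v @ w) = letters v + letters w"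
  by (induction v rule: letters.induct) simp_all

text \<open>
  A target in which words are evaluated by multiplying the values of their letters. The
  embedding of \<open>A\<close> need only be a ring homomorphism modulo \<open>J\<close>. This covers the tensor ring, whose elements are words
  modulo the tensor ideal, and the square-zero extension of \<open>A\<close> by the bimodule, where \<open>J\<close> is zero.
\<close>

locale contraction =
  fixes M :: "('a::{ring,monoid_mult}, 'm::ab_group_add) gbimodule"
    and mul :: "'t::ab_group_add \<Rightarrow> 't \<Rightarrow> 't"  (infixl \<open>\<odot>\<close> 70)
    and unit :: 't and emb :: "'a \<Rightarrow> 't" and J :: "'t set"
  assumes distrib_right: "(x + y) \<odot> z = x \<odot> z + y \<odot> z"
    and distrib_left: "x \<odot> (y + z) = x \<odot> y + x \<odot> z"
    and assoc: "x \<odot> y \<odot> z = x \<odot> (y \<odot> z)"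
    and unit_left [simp]: "unit \<odot> x = x"
    and unit_right [simp]: "x \<odot> unit = x"
    and J_0 [simp]: "0 \<in> J"
    and J_diff: "x \<in> J \<Longrightarrow> y \<in> J \<Longrightarrow> x - y \<in> J"
    and J_left: "x \<in> J \<Longrightarrow> y \<odot> x \<in> J"
    and J_right: "x \<in> J \<Longrightarrow> x \<odot> y \<in> J"
    and emb_add: "emb (a + b) - emb a - emb b \<in> J"
    and emb_mult: "emb a \<odot> emb b - emb (a * b) \<in> J"
    and emb_1: "emb 1 - unit \<in> J"
begin

lemma diff_left: "(x - y) \<odot> z = x \<odot> z - y \<odot> z"
  using distrib_right [of "x - y" y z] by simp

lemma diff_right: "x \<odot> (y - z) = x \<odot> y - x \<odot> z"
  using distrib_left [of x "y - z" z] by simp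

lemma zero_left [simp]: "0 \<odot> z = 0"
  using diff_left [of 0 0 z] by simp

lemma zero_right [simp]: "z \<odot> 0 = 0"
  using diff_right [of z 0 0] by simp

lemma minus_left: "(- x) \<odot> z = - (x \<odot> z)"
  using diff_left [of 0 x z] by simp

lemma minus_right: "z \<odot> (- x) = - (z \<odot> x)"
  using diff_right [of z 0 x] by simp

text \<open>The maps that may be applied to a letter: bimodule maps into the target, modulo \<open>J\<close>.\<close>

definition slot :: "('m \<Rightarrow> 't) \<Rightarrow> bool" where
  "slot g \<longleftrightarrow> (\<forall>x y. g (x + y) - g x - g y \<in> J) \<and>
     (\<forall>a x. emb a \<odot> g x - g (lact M a x) \<in> J \<and> g x \<odot> emb a - g (ract M x a) \<in> J)"

text \<open>
  The \<open>i\<close>-th letter from the bimodule is sent through the \<open>i\<close>-th map. Words with a different number of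
  such letters are sent to \<open>0\<close>, so that words of all lengths can be treated at once.
\<close>

primrec word_eval :: "('a + 'm) list \<Rightarrow> ('m \<Rightarrow> 't) list \<Rightarrow> 't" where
  "word_eval [] gs = (if gs = [] then unit else 0)"
| "word_eval (c # w) gs = (case c of
     Inl a \<Rightarrow> emb a \<odot> word_eval w gs
   | Inr x \<Rightarrow> (case gs of [] \<Rightarrow> 0 | g # gs' \<Rightarrow> g x \<odot> word_eval w gs'))"

definition contract :: "('m \<Rightarrow> 't) list \<Rightarrow> ('a, 'm) words \<Rightarrow> 't" where
  "contract gs = additive_ext (\<lambda>w. word_eval w gs)"

lemma contract_of [simp]: "contract gs (frag_of w) = word_eval w gs"
  by (simp add: contract_def)

lemma contract_0 [simp]: "contract gs 0 = 0"
  by (simp add: contract_def)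

lemma contract_diff: "contract gs (u - v) = contract gs u - contract gs v"
  by (simp add: contract_def additive_ext_diff)

lemma contract_add: "contract gs (u + v) = contract gs u + contract gs v"
  by (simp add: contract_def additive_ext_add)

lemma contract_minus: "contract gs (- u) = - contract gs u"
  by (simp add: contract_def additive_ext_minus)

lemma word_eval_wrong_length: "letters w \<noteq> length gs \<Longrightarrow> word_eval w gs = 0"
  by (induction w arbitrary: gs rule: letters.induct) (auto split: list.split)

lemma word_eval_append:
  "word_eval (v @ w) gs =
   word_eval v (take (letters v) gs) \<odot> word_eval w (drop (letters v) gs)"
  by (induction v arbitrary: gs rule: letters.induct) (auto simp: assoc split: list.split)

lemma contract_word_mult:
  "contract gs (frag_of v * u) =
   word_eval v (take (letters v) gs) \<odot> contract (drop (letters v) gs) u"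
  by (rule frag_ext [where u = u])
     (simp_all add: algebra_simps contract_diff diff_right word_eval_append flip: frag_of_append)

lemma contract_mult_word:
  "contract gs (u * frag_of w) = contract (take (length gs - letters w) gs) u
     \<odot> word_eval w (drop (length gs - letters w) gs)"
proof (rule frag_ext [where u = u])
  fix v
  show "contract gs (frag_of v * frag_of w) =
        contract (take (length gs - letters w) gs) (frag_of v)
          \<odot> word_eval w (drop (length gs - letters w) gs)"
  proof (cases "length gs = letters v + letters w")
    case True
    then show ?thesis
      by (simp add: word_eval_append flip: frag_of_append)
  next
    case False
    have "word_eval (v @ w) gs = 0"
      using False by (intro word_eval_wrong_length) auto
    moreover have "word_eval v (take (length gs - letters w) gs) = 0 \<or>
        word_eval w (drop (length gs - letters w) gs) = 0"
    proof (cases "letters w \<le> length gs")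
      case True
      with False show ?thesis
        by (intro disjI1 word_eval_wrong_length) auto
    next
      case False
      then show ?thesis
        by (intro disjI2 word_eval_wrong_length) auto
    qed
    ultimately show ?thesis
      by (auto simp flip: frag_of_append)
  qed
qed (simp_all add: algebra_simps contract_diff diff_left)

lemma contract_relator:
  assumes r: "r \<in> tensor_relators M" and gs: "\<forall>g\<in>set gs. slot g"
  shows "contract gs r \<in> J"
proof -
  have add: "g (x + y) - g x - g y \<in> J" and l: "emb a \<odot> g x - g (lact M a x) \<in> J"
    and r': "g x \<odot> emb a - g (ract M x a) \<in> J" if "slot g" for g x y a
    using that by (auto simp: slot_def)
  from r gs show ?thesis
    unfolding tensor_relators_def
    by (cases gs; cases "tl gs")
       (auto simp: contract_diff contract_add emb_add emb_mult emb_1 add l r' split: list.split)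
qed

text \<open>
  Every relator is homogeneous in the number of letters from the bimodule. In a product \<open>t r v\<close> with
  words \<open>t\<close> and \<open>v\<close>, the factor \<open>r\<close> is therefore met by one fixed sublist of the maps, and it suffices
  to check the relators alone.
\<close>

lemma contract_ideal:
  assumes u: "u \<in> tensor_ideal M" and gs: "\<forall>g\<in>set gs. slot g"
  shows "contract gs u \<in> J"
proof -
  have word: "contract hs (r * frag_of w) \<in> J"
    if "r \<in> tensor_relators M" "\<forall>g\<in>set hs. slot g" for r w hs
    using that by (auto simp: contract_mult_word intro!: J_right contract_relator dest: in_set_takeD)
  have right: "contract hs (r * v) \<in> J"
    if "r \<in> tensor_relators M" "\<forall>g\<in>set hs. slot g" for r v hs
    using subset_UNIV [of "Poly_Mapping.keys v"]
    by (induction v rule: frag_induction)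
       (simp_all add: word that right_diff_distrib contract_diff J_diff)
  have both: "contract gs (t * (r * v)) \<in> J" if "r \<in> tensor_relators M" for t r v
    using subset_UNIV [of "Poly_Mapping.keys t"]
  proof (induction t rule: frag_induction)
    case (one w)
    have "\<forall>g\<in>set (drop (letters w) gs). slot g"
      using gs by (auto dest: in_set_dropD)
    then show ?case
      by (simp add: contract_word_mult J_left right that)
  qed (simp_all add: left_diff_distrib contract_diff J_diff)
  show ?thesis
    using u unfolding tensor_ideal_def
    by (rule group_closure_into) (auto simp: contract_diff J_diff both mult.assoc)
qed

lemma contract_cong_ideal:
  assumes "u - v \<in> tensor_ideal M" and "\<forall>g\<in>set gs. slot g"
  shows "contract gs u - contract gs v \<in> J"
  using contract_ideal [OF assms] by (simp add: contract_diff)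

end

section \<open>Homogeneous parts and the grading involution\<close>

lemma signed_0 [simp]: "signed k 0 = (0 :: 'g::ab_group_add)"
  by (simp add: signed_def)

lemma signed_signed [simp]: "signed k (signed l x) = signed (k + l) x"
  by (simp add: signed_def)

lemma signed_add: "signed k (x + y) = signed k x + signed k y"
  by (simp add: signed_def)

locale graded_bimod =
  fixes s :: "'k::field \<Rightarrow> 'a::{ring,monoid_mult} \<Rightarrow> 'a"
    and M :: "('a, 'm::ab_group_add) gbimodule"
  assumes graded: "graded_bimodule s M"
begin

lemma
  shows lact_add: "lact M a (x + y) = lact M a x + lact M a y"
    and lact_add_scalar: "lact M (a + b) x = lact M a x + lact M b x"
    and lact_mult: "lact M (a * b) x = lact M a (lact M b x)"
    and lact_1 [simp]: "lact M 1 x = x"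
    and ract_add: "ract M (x + y) a = ract M x a + ract M y a"
    and ract_add_scalar: "ract M x (a + b) = ract M x a + ract M x b"
    and ract_mult: "ract M x (a * b) = ract M (ract M x a) b"
    and ract_1 [simp]: "ract M x 1 = x"
    and ract_lact: "ract M (lact M a x) b = lact M a (ract M x b)"
    and central: "lact M (s c 1) x = ract M x (s c 1)"
    and component_0 [simp]: "0 \<in> component M i"
    and component_diff: "x \<in> component M i \<Longrightarrow> y \<in> component M i \<Longrightarrow> x - y \<in> component M i"
    and component_lact: "x \<in> component M i \<Longrightarrow> lact M a x \<in> component M i"
    and component_ract: "x \<in> component M i \<Longrightarrow> ract M x a \<in> component M i"
  using graded unfolding graded_bimodule_def by simp_all

lemma lact_0 [simp]: "lact M a 0 = 0"
  using lact_add [of a 0 0] by simp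

lemma ract_0 [simp]: "ract M 0 a = 0"
  using ract_add [of 0 0 a] by simp

lemma lact_zero_scalar [simp]: "lact M 0 x = 0"
  using lact_add_scalar [of 0 0 x] by simp

lemma ract_zero_scalar [simp]: "ract M x 0 = 0"
  using ract_add_scalar [of x 0 0] by simp

lemma component_minus: "x \<in> component M i \<Longrightarrow> - x \<in> component M i"
  using component_diff [of 0 i x] by simp

lemma component_add: "x \<in> component M i \<Longrightarrow> y \<in> component M i \<Longrightarrow> x + y \<in> component M i"
  using component_diff [of x i "- y"] by (simp add: component_minus)

lemma lact_minus: "lact M a (- x) = - lact M a x"
  using lact_add [of a x "- x"] by (simp add: add_eq_0_iff)

lemma ract_minus: "ract M (- x) a = - ract M x a"
  using ract_add [of x "- x" a] by (simp add: add_eq_0_iff)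

lemma lact_sum: "lact M a (sum f F) = (\<Sum>i\<in>F. lact M a (f i))"
  by (induction F rule: infinite_finite_induct) (simp_all add: lact_add)

lemma ract_sum: "ract M (sum f F) a = (\<Sum>i\<in>F. ract M (f i) a)"
  by (induction F rule: infinite_finite_induct) (simp_all add: ract_add)

definition decomposes :: "'m \<Rightarrow> (int \<Rightarrow> 'm) \<Rightarrow> bool" where
  "decomposes x c \<longleftrightarrow>
     finite {i. c i \<noteq> 0} \<and> (\<forall>i. c i \<in> component M i) \<and> x = (\<Sum>i | c i \<noteq> 0. c i)"

definition part :: "'m \<Rightarrow> int \<Rightarrow> 'm" where
  "part x = (THE c. decomposes x c)"

lemma ex1_decomposes: "\<exists>!c. decomposes x c"
proof -
  have "\<forall>x. \<exists>!c. finite {i. c i \<noteq> 0} \<and> (\<forall>i. c i \<in> component M i) \<and> x = (\<Sum>i | c i \<noteq> 0. c i)"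
    using graded unfolding graded_bimodule_def by (elim conjE)
  then show ?thesis
    unfolding decomposes_def by (rule spec)
qed

lemma decomposes_part: "decomposes x (part x)"
  unfolding part_def by (rule theI' [OF ex1_decomposes])

lemma part_eqI: "decomposes x c \<Longrightarrow> part x = c"
  using ex1_decomposes decomposes_part by blast

lemma finite_part: "finite {i. part x i \<noteq> 0}"
  and part_component [simp]: "part x i \<in> component M i"
  and sum_part: "(\<Sum>i | part x i \<noteq> 0. part x i) = x"
  using decomposes_part [of x] by (simp_all add: decomposes_def)

lemma decomposesI:
  assumes "finite F" "\<And>i. i \<notin> F \<Longrightarrow> c i = 0" "\<And>i. c i \<in> component M i" "x = (\<Sum>i\<in>F. c i)"
  shows "decomposes x c"
proof -
  have "{i. c i \<noteq> 0} \<subseteq> F"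
    using assms(2) by auto
  moreover from this have "(\<Sum>i | c i \<noteq> 0. c i) = (\<Sum>i\<in>F. c i)"
    using assms(1) by (intro sum.mono_neutral_left) auto
  ultimately show ?thesis
    using assms finite_subset by (auto simp: decomposes_def)
qed

lemma sum_part_superset:
  assumes "finite F" "{i. part x i \<noteq> 0} \<subseteq> F"
  shows "(\<Sum>i\<in>F. part x i) = x"
proof -
  have "(\<Sum>i | part x i \<noteq> 0. part x i) = (\<Sum>i\<in>F. part x i)"
    using assms by (intro sum.mono_neutral_left) auto
  then show ?thesis
    by (simp add: sum_part)
qed

lemma part_add: "part (x + y) i = part x i + part y i"
proof -
  let ?F = "{i. part x i \<noteq> 0} \<union> {i. part y i \<noteq> 0}"
  have "part (x + y) = (\<lambda>i. part x i + part y i)"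
    by (intro part_eqI decomposesI [of ?F])
       (auto simp: finite_part component_add sum.distrib sum_part_superset)
  then show ?thesis
    by simp
qed

lemma part_lact: "part (lact M a x) i = lact M a (part x i)"
proof -
  have "part (lact M a x) = (\<lambda>i. lact M a (part x i))"
    by (intro part_eqI decomposesI [of "{i. part x i \<noteq> 0}"])
       (auto simp: finite_part component_lact sum_part simp flip: lact_sum)
  then show ?thesis
    by simp
qed

lemma part_ract: "part (ract M x a) i = ract M (part x i) a"
proof -
  have "part (ract M x a) = (\<lambda>i. ract M (part x i) a)"
    by (intro part_eqI decomposesI [of "{i. part x i \<noteq> 0}"])
       (auto simp: finite_part component_ract sum_part simp flip: ract_sum)
  then show ?thesis
    by simp
qed

lemma part_homogeneous: "x \<in> component M j \<Longrightarrow> part x i = (if i = j then x else 0)"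
proof -
  assume "x \<in> component M j"
  then have "part x = (\<lambda>i. if i = j then x else 0)"
    by (intro part_eqI decomposesI [of "{j}"]) auto
  then show ?thesis
    by simp
qed

lemma additive_ext_components:
  fixes f g :: "'m \<Rightarrow> 'n::ab_group_add"
  assumes "\<And>x y. f (x + y) = f x + f y" "\<And>x y. g (x + y) = g x + g y"
    and "\<And>i x. x \<in> component M i \<Longrightarrow> f x = g x"
  shows "f x = g x"
proof -
  have "f (\<Sum>i\<in>F. part x i) = g (\<Sum>i\<in>F. part x i)" if "finite F" for F
    using that
  proof (induction F)
    case empty
    show ?case
      using assms(3) [of 0 0] by simp
  next
    case (insert j F)
    then show ?case
      using assms(3) [OF part_component] by (simp add: assms(1,2))
  qed
  from this [OF finite_part, of x] show ?thesis
    by (simp add: sum_part)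
qed

text \<open>Maps given on the homogeneous components extend uniquely to their direct sum.\<close>

definition glue :: "(int \<Rightarrow> 'm \<Rightarrow> 'n::ab_group_add) \<Rightarrow> 'm \<Rightarrow> 'n" where
  "glue H x = (\<Sum>i | part x i \<noteq> 0. H i (part x i))"

lemma glue_hom:
  fixes N :: "('a, 'n::ab_group_add) gbimodule"
  assumes H: "\<And>i. bimodule_hom (component M i) M N (H i)"
    and "\<And>a x y. lact N a (x + y) = lact N a x + lact N a y"
    and "\<And>a x y. ract N (x + y) a = ract N x a + ract N y a"
  shows "bimodule_hom UNIV M N (glue H)"
    and "x \<in> component M i \<Longrightarrow> glue H x = H i x"
proof -
  have H_add: "H i (x + y) = H i x + H i y" if "x \<in> component M i" "y \<in> component M i" for i x y
    using H [of i] that by (auto simp: bimodule_hom_def)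
  have H_0: "H i 0 = 0" for i
    using H_add [of 0 i 0] by simp
  have glue_superset: "glue H x = (\<Sum>i\<in>F. H i (part x i))"
    if "finite F" "{i. part x i \<noteq> 0} \<subseteq> F" for F x
    unfolding glue_def using that by (intro sum.mono_neutral_left) (auto simp: H_0)
  have lact_0: "lact N a 0 = 0" for a
    using assms(2) [of a 0 0] by simp
  have ract_0: "ract N 0 a = 0" for a
    using assms(3) [of 0 0 a] by simp
  have lact_N: "lact N a (sum f F) = (\<Sum>i\<in>F. lact N a (f i))" for a f and F :: "int set"
    by (induction F rule: infinite_finite_induct) (simp_all add: assms(2) lact_0)
  have ract_N: "ract N (sum f F) a = (\<Sum>i\<in>F. ract N (f i) a)" for a f and F :: "int set"
    by (induction F rule: infinite_finite_induct) (simp_all add: assms(3) ract_0)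
  have "glue H (x + y) = glue H x + glue H y" for x y
  proof -
    let ?F = "{i. part x i \<noteq> 0} \<union> {i. part y i \<noteq> 0}"
    have "finite ?F"
      by (simp add: finite_part)
    moreover have "{i. part (x + y) i \<noteq> 0} \<subseteq> ?F"
      by (auto simp: part_add)
    ultimately show ?thesis
      by (simp add: glue_superset [of ?F] part_add H_add sum.distrib)
  qed
  moreover have "glue H (lact M a x) = lact N a (glue H x)" for a x
  proof -
    have "{i. part (lact M a x) i \<noteq> 0} \<subseteq> {i. part x i \<noteq> 0}"
      by (auto simp: part_lact)
    moreover have "H i (lact M a (part x i)) = lact N a (H i (part x i))" for i
      using H [of i] part_component [of x i] by (simp add: bimodule_hom_def)
    ultimately show ?thesis
      by (simp add: glue_superset [of "{i. part x i \<noteq> 0}"] finite_part part_lact lact_N)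
  qed
  moreover have "glue H (ract M x a) = ract N (glue H x) a" for a x
  proof -
    have "{i. part (ract M x a) i \<noteq> 0} \<subseteq> {i. part x i \<noteq> 0}"
      by (auto simp: part_ract)
    moreover have "H i (ract M (part x i) a) = ract N (H i (part x i)) a" for i
      using H [of i] part_component [of x i] by (simp add: bimodule_hom_def)
    ultimately show ?thesis
      by (simp add: glue_superset [of "{i. part x i \<noteq> 0}"] finite_part part_ract ract_N)
  qed
  ultimately show "bimodule_hom UNIV M N (glue H)"
    by (simp add: bimodule_hom_def)
  show "glue H x = H i x" if "x \<in> component M i"
    using that by (simp add: glue_superset [of "{i}"] part_homogeneous subset_iff)
qed

text \<open>
  The \<open>k\<close>-th power of the grading involution: it carries the Koszul sign that a homogeneous element
  acquires when maps of total degree \<open>k\<close> are moved past it.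
\<close>

definition inv_pow :: "int \<Rightarrow> 'm \<Rightarrow> 'm" where
  "inv_pow k = glue (\<lambda>i. signed (k * i))"

lemma inv_pow_hom: "bimodule_hom UNIV M M (inv_pow k)"
  and inv_pow_homogeneous: "x \<in> component M i \<Longrightarrow> inv_pow k x = signed (k * i) x"
proof -
  have "bimodule_hom (component M i) M M (signed (k * i))" for i
    by (auto simp: bimodule_hom_def signed_def lact_minus ract_minus)
  then show "bimodule_hom UNIV M M (inv_pow k)"
    and "x \<in> component M i \<Longrightarrow> inv_pow k x = signed (k * i) x"
    unfolding inv_pow_def by (simp_all add: glue_hom [where N = M] lact_add ract_add)
qed

lemma inv_pow_add: "inv_pow k (x + y) = inv_pow k x + inv_pow k y"
  and inv_pow_lact: "inv_pow k (lact M a x) = lact M a (inv_pow k x)"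
  and inv_pow_ract: "inv_pow k (ract M x a) = ract M (inv_pow k x) a"
  using inv_pow_hom [of k] by (auto simp: bimodule_hom_def)

lemma inv_pow_inv_pow: "inv_pow k (inv_pow l x) = inv_pow (k + l) x"
proof (rule additive_ext_components [where f = "\<lambda>x. inv_pow k (inv_pow l x)" and g = "inv_pow (k + l)"])
  fix i x assume "x \<in> component M i"
  moreover from this have "signed (l * i) x \<in> component M i"
    by (simp add: signed_def component_minus)
  ultimately show "inv_pow k (inv_pow l x) = inv_pow (k + l) x"
    by (simp add: inv_pow_homogeneous algebra_simps)
qed (simp_all add: inv_pow_add)

lemma inv_pow_even: "even k \<Longrightarrow> inv_pow k x = x"
  by (rule additive_ext_components) (simp_all add: inv_pow_add inv_pow_homogeneous signed_def)

lemma inv_pow_cong: "even (k - l) \<Longrightarrow> inv_pow k x = inv_pow l x"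
  using inv_pow_inv_pow [of "k - l" l x] by (simp add: inv_pow_even)

lemma inv_pow_graded: "graded_map l M M f \<Longrightarrow> f (inv_pow k x) = signed (k * l) (inv_pow k (f x))"
proof (rule additive_ext_components [where f = "\<lambda>x. f (inv_pow k x)"
      and g = "\<lambda>x. signed (k * l) (inv_pow k (f x))"])
  assume f: "graded_map l M M f"
  then show "f (inv_pow k (x + y)) = f (inv_pow k x) + f (inv_pow k y)" for x y
    by (simp add: inv_pow_add graded_map_def bimodule_hom_def)
  from f show "signed (k * l) (inv_pow k (f (x + y))) =
      signed (k * l) (inv_pow k (f x)) + signed (k * l) (inv_pow k (f y))" for x y
    by (simp add: inv_pow_add graded_map_def bimodule_hom_def signed_add)
  fix i x assume x: "x \<in> component M i"
  have add: "f (x + y) = f x + f y" for x y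
    using f by (simp add: graded_map_def bimodule_hom_def)
  have "f 0 = 0"
    using add [of 0 0] by simp
  then have "f (- x) = - f x" for x
    using add [of x "- x"] by (simp add: add_eq_0_iff2)
  then have sgn: "f (signed j x) = signed j (f x)" for j x
    by (simp add: signed_def)
  have "f x \<in> component M (i + l)"
    using f x by (auto simp: graded_map_def)
  with x show "f (inv_pow k x) = signed (k * l) (inv_pow k (f x))"
    by (simp add: inv_pow_homogeneous sgn) (auto simp: signed_def)
qed

end


section \<open>Tensor powers as spans of words\<close>

context graded_bimod
begin

inductive homog :: "('a + 'm) list \<Rightarrow> int \<Rightarrow> bool" where
  homog_Nil: "homog [] 0"
| homog_Inl: "homog w i \<Longrightarrow> homog (Inl a # w) i"
| homog_Inr: "x \<in> component M j \<Longrightarrow> homog w i \<Longrightarrow> homog (Inr x # w) (j + i)"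

definition homog_span :: "nat \<Rightarrow> int \<Rightarrow> ('a, 'm) words set" where
  "homog_span n i = group_closure {frag_of w | w. letters w = n \<and> homog w i}"

text \<open>
  The ideal is included so that representatives of elements of the \<open>n\<close>-th tensor power lie in the span,
  whichever representatives are chosen.
\<close>

definition word_span :: "nat \<Rightarrow> ('a, 'm) words set" where
  "word_span n = group_closure ({frag_of w | w. letters w = n} \<union> tensor_ideal M)"

lemma word_span_diff: "u \<in> word_span n \<Longrightarrow> v \<in> word_span n \<Longrightarrow> u - v \<in> word_span n"
  by (simp add: word_span_def group_closure.diff)

lemma word_span_0 [simp]: "0 \<in> word_span n"
  by (simp add: word_span_def)

lemma word_span_add: "u \<in> word_span n \<Longrightarrow> v \<in> word_span n \<Longrightarrow> u + v \<in> word_span n"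
  by (simp add: word_span_def group_closure_add)

lemma word_span_word: "letters w = n \<Longrightarrow> frag_of w \<in> word_span n"
  unfolding word_span_def by (rule group_closure.base) auto

lemma word_span_ideal: "u \<in> tensor_ideal M \<Longrightarrow> u \<in> word_span n"
  unfolding word_span_def by (rule group_closure.base) simp

lemma word_span_cong: "u - v \<in> tensor_ideal M \<Longrightarrow> v \<in> word_span n \<Longrightarrow> u \<in> word_span n"
  using word_span_add [OF word_span_ideal, of "u - v" v] by simp

lemma word_span_mult: "u \<in> word_span m \<Longrightarrow> v \<in> word_span n \<Longrightarrow> u * v \<in> word_span (m + n)"
proof -
  assume u: "u \<in> word_span m" and v: "v \<in> word_span n"
  have w: "frag_of w * v \<in> word_span (m + n)" if "letters w = m" for w
    using v [unfolded word_span_def]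
    by (rule group_closure_into)
       (auto simp: right_diff_distrib word_span_diff that intro: word_span_word word_span_ideal
          tensor_ideal_mult_left simp flip: frag_of_append intro!: word_span_word)
  then have w': "frag_of w * v \<in> word_span (letters w + n)" if "letters w = m" for w
    using that by simp
  show ?thesis
    using u [unfolded word_span_def]
    by (rule group_closure_into)
       (auto simp: left_diff_distrib word_span_diff w' intro: word_span_ideal tensor_ideal_mult_right)
qed

lemma letters_map_Inr [simp]: "letters (map Inr xs) = length xs"
  by (induction xs) simp_all

lemma tensor_carrier_word_span: "U \<in> tensor_carrier M n \<Longrightarrow> \<exists>u\<in>word_span n. U = tensor_class M u"
proof -
  assume "U \<in> tensor_carrier M n"
  then obtain u where u: "u \<in> group_closure {frag_of (Inl a # map Inr xs) | a xs. length xs = n}"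
    and U: "U = tensor_class M u"
    by (auto simp: tensor_carrier_def)
  have "u \<in> word_span n"
    using u by (rule group_closure_into [where f = "\<lambda>u. u"]) (auto simp: word_span_diff intro: word_span_word)
  with U show ?thesis
    by auto
qed

lemma representative_word_span: "U \<in> tensor_carrier M n \<Longrightarrow> representative M U \<in> word_span n"
proof -
  assume "U \<in> tensor_carrier M n"
  then obtain u where u: "u \<in> word_span n" "U = tensor_class M u"
    using tensor_carrier_word_span by blast
  show ?thesis
    unfolding u(2) by (rule word_span_cong [OF representative_class u(1)])
qed

lemma tensor_carrier_range: "U \<in> tensor_carrier M n \<Longrightarrow> U \<in> range (tensor_class M)"
  by (auto simp: tensor_carrier_def)

lemma tensor_carrier_add:
  "U \<in> tensor_carrier M n \<Longrightarrow> V \<in> tensor_carrier M n \<Longrightarrow> U + V \<in> tensor_carrier M n"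
  unfolding tensor_carrier_def
  by (elim imageE, simp only: tensor_class_add) (intro imageI group_closure_add)

lemma homog_map_Inr:
  "list_all2 (\<lambda>x j. x \<in> component M j) xs js \<Longrightarrow> homog (map Inr xs) (sum_list js)"
  by (induction rule: list_all2_induct) (auto intro: homog.intros)

lemma tensor_power_component:
  assumes "U \<in> component (tensor_power M n) i"
  obtains u where "u \<in> homog_span n i" "U = tensor_class M u"
proof -
  have "{frag_of (Inl a # map Inr xs) | a xs js.
           length xs = n \<and> list_all2 (\<lambda>x j. x \<in> component M j) xs js \<and> sum_list js = i}
        \<subseteq> {frag_of w | w. letters w = n \<and> homog w i}"
    by (fastforce intro: homog_Inl homog_map_Inr)
  from group_closure_mono [OF this] assms that show thesis
    by (auto simp: tensor_power_def homog_span_def)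
qed

lemma tensor_power_component_carrier: "component (tensor_power M n) i \<subseteq> tensor_carrier M n"
  unfolding tensor_power_def tensor_carrier_def
  by (simp, intro image_mono group_closure_mono) auto

lemma graded_map_carrier:
  assumes f: "graded_map l M (tensor_power M n) f"
  shows "f x \<in> tensor_carrier M n"
proof -
  have comp: "f y \<in> tensor_carrier M n" if "y \<in> component M i" for i y
    using f that tensor_power_component_carrier by (fastforce simp: graded_map_def)
  have "f (\<Sum>i\<in>F. part x i) \<in> tensor_carrier M n" if "finite F" for F
    using that
  proof (induction F)
    case empty
    show ?case
      using comp [of 0 0] by simp
  next
    case (insert j F)
    then show ?case
      using f by (simp add: graded_map_def bimodule_hom_def comp [OF part_component] tensor_carrier_add)
  qed
  from this [OF finite_part, of x] show ?thesis
    by (simp add: sum_part)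
qed

text \<open>
  The tensors of homogeneous elements, on which \<open>tensor_map\<close> is prescribed. For \<open>n \<noteq> 0\<close> they generate
  the \<open>n\<close>-th tensor power, because the leading letter from \<open>A\<close> can be absorbed and all other letters
  can be decomposed; this gives the uniqueness of \<open>tensor_map\<close>.
\<close>

definition pure_span :: "nat \<Rightarrow> ('a, 'm) words set" where
  "pure_span n = group_closure {frag_of (map Inr xs) | xs js.
     length xs = n \<and> list_all2 (\<lambda>x j. x \<in> component M j) xs js}"

lemma pure_span_zero: "0 \<in> pure_span n"
  by (simp add: pure_span_def)

lemma pure_span_diff: "u \<in> pure_span n \<Longrightarrow> v \<in> pure_span n \<Longrightarrow> u - v \<in> pure_span n"
  by (simp add: pure_span_def group_closure.diff)

lemma pure_span_mult: "u \<in> pure_span m \<Longrightarrow> v \<in> pure_span n \<Longrightarrow> u * v \<in> pure_span (m + n)"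
proof -
  assume u: "u \<in> pure_span m" and v: "v \<in> pure_span n"
  have w: "(frag_of (map Inr xs) :: ('a, 'm) words) * v \<in> pure_span (m + n)"
    if "length xs = m" "list_all2 (\<lambda>x j. x \<in> component M j) xs js" for xs :: "'m list" and js
    using v [unfolded pure_span_def]
  proof (rule group_closure_into)
    fix x :: "('a, 'm) words"
    assume "x \<in> {frag_of (map Inr xs) | xs js.
      length xs = n \<and> list_all2 (\<lambda>x j. x \<in> component M j) xs js}"
    then obtain ys ks where ys: "x = frag_of (map Inr ys)" "length ys = n"
        "list_all2 (\<lambda>x j. x \<in> component M j) ys ks"
      by auto
    have "(frag_of (map Inr xs) :: ('a, 'm) words) * x = frag_of (map Inr (xs @ ys))"
      by (simp add: ys frag_of_append)
    moreover have "list_all2 (\<lambda>x j. x \<in> component M j) (xs @ ys) (js @ ks)"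
      using that ys by (simp add: list_all2_appendI)
    ultimately show "(frag_of (map Inr xs) :: ('a, 'm) words) * x \<in> pure_span (m + n)"
      unfolding pure_span_def using that ys
      by (intro group_closure.base insertI2 CollectI exI [of _ "xs @ ys"] exI [of _ "js @ ks"]) simp
  qed (auto simp: right_diff_distrib pure_span_def group_closure.diff)
  show ?thesis
    using u [unfolded pure_span_def]
    by (rule group_closure_into)
       (use w in \<open>auto simp: left_diff_distrib pure_span_zero pure_span_diff\<close>)
qed

lemma relator_add: "frag_of [Inr (x + y)] - frag_of [Inr x] - frag_of [Inr y] \<in> tensor_ideal M"
  by (intro tensor_ideal_relator) (auto simp: tensor_relators_def)

lemma letter_zero: "frag_of [Inr 0] \<in> tensor_ideal M"
  using tensor_ideal_minus [OF relator_add [of 0 0]] by simp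

lemma letter_pure_span: "\<exists>v\<in>pure_span 1. frag_of [Inr x] - v \<in> tensor_ideal M"
proof -
  have "\<exists>v\<in>pure_span 1. frag_of [Inr (\<Sum>i\<in>F. part x i)] - v \<in> tensor_ideal M" if "finite F" for F
    using that
  proof (induction F)
    case empty
    show ?case
      by (intro bexI [of _ 0]) (simp_all add: letter_zero pure_span_def)
  next
    case (insert j F)
    then obtain v where v: "v \<in> pure_span 1"
      "frag_of [Inr (\<Sum>i\<in>F. part x i)] - v \<in> tensor_ideal M"
      by auto
    have "frag_of [Inr (part x j)] \<in> pure_span 1"
      unfolding pure_span_def
      by (intro group_closure.base insertI2 CollectI exI [of _ "[part x j]"] exI [of _ "[j]"]) simp
    then have "frag_of [Inr (part x j)] + v \<in> pure_span 1"
      using v by (simp add: pure_span_def group_closure_add)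
    moreover have "frag_of [Inr (part x j + (\<Sum>i\<in>F. part x i))] - (frag_of [Inr (part x j)] + v)
        \<in> tensor_ideal M"
      using tensor_ideal_add [OF relator_add [of "part x j" "\<Sum>i\<in>F. part x i"] v(2)]
      by (simp add: diff_diff_eq)
    ultimately show ?case
      using insert by auto
  qed
  from this [OF finite_part, of x] show ?thesis
    by (simp add: sum_part)
qed

lemma letters_pure_span: "\<exists>v\<in>pure_span (length xs). frag_of (map Inr xs) - v \<in> tensor_ideal M"
proof (induction xs)
  case Nil
  show ?case
    by (intro bexI [of _ "frag_of []"])
       (auto simp: pure_span_def intro!: group_closure.base insertI2 exI [of _ "[]"])
next
  case (Cons x xs)
  then obtain v where v: "v \<in> pure_span (length xs)" "frag_of (map Inr xs) - v \<in> tensor_ideal M"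
    by auto
  obtain t where t: "t \<in> pure_span 1" "frag_of [Inr x] - t \<in> tensor_ideal M"
    using letter_pure_span by blast
  have "frag_of (map Inr (x # xs)) - t * v
      = (frag_of [Inr x] - t) * frag_of (map Inr xs) + t * (frag_of (map Inr xs) - v)"
    by (simp add: algebra_simps flip: frag_of_append)
  also have "\<dots> \<in> tensor_ideal M"
    using t v by (simp add: tensor_ideal_add tensor_ideal_mult_left tensor_ideal_mult_right)
  finally show ?case
    using pure_span_mult [OF t(1) v(1)] by auto
qed

lemma carrier_pure_span:
  assumes "U \<in> tensor_carrier M n" "n \<noteq> 0"
  obtains v where "v \<in> pure_span n" "U = tensor_class M v"
proof -
  obtain u where u: "u \<in> group_closure {frag_of (Inl a # map Inr xs) | a xs. length xs = n}"
    and U: "U = tensor_class M u"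
    using assms by (auto simp: tensor_carrier_def)
  from u have "\<exists>v\<in>pure_span n. u - v \<in> tensor_ideal M"
  proof induction
    case (base u)
    then consider "u = 0" | a xs where "u = frag_of (Inl a # map Inr xs)" "length xs = n"
      by auto
    then show ?case
    proof cases
      case 1
      then show ?thesis
        by (intro bexI [of _ 0]) (simp_all add: pure_span_def)
    next
      case 2
      then obtain x ys where xs: "xs = x # ys"
        using assms(2) by (cases xs) auto
      have "frag_of [Inl a, Inr x] - frag_of [Inr (lact M a x)] \<in> tensor_ideal M"
        by (intro tensor_ideal_relator) (auto simp: tensor_relators_def)
      then have "(frag_of [Inl a, Inr x] - frag_of [Inr (lact M a x)]) * frag_of (map Inr ys)
          \<in> tensor_ideal M"
        by (rule tensor_ideal_mult_right)
      then have *: "u - frag_of (map Inr (lact M a x # ys)) \<in> tensor_ideal M"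
        by (simp add: 2 xs algebra_simps flip: frag_of_append)
      obtain v where "v \<in> pure_span n"
          "frag_of (map Inr (lact M a x # ys)) - v \<in> tensor_ideal M"
        using letters_pure_span [of "lact M a x # ys"] 2 xs by auto
      with tensor_ideal_add [OF *] show ?thesis
        by force
    qed
  next
    case (diff u u')
    then obtain v v' where v: "v \<in> pure_span n" "v' \<in> pure_span n"
      "u - v \<in> tensor_ideal M" "u' - v' \<in> tensor_ideal M"
      by blast
    have "(u - u') - (v - v') = (u - v) - (u' - v')"
      by (simp add: algebra_simps)
    then have "(u - u') - (v - v') \<in> tensor_ideal M"
      using tensor_ideal_diff [OF v(3,4)] by (simp only:)
    then show ?case
      using pure_span_diff [OF v(1,2)] by blast
  qed
  with U that show thesis
    by (auto simp: tensor_class_eq_iff)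
qed

lemma pure_span_carrier: "v \<in> pure_span n \<Longrightarrow> tensor_class M v \<in> tensor_carrier M n"
proof -
  assume "v \<in> pure_span n"
  then have "v \<in> group_closure {frag_of (map Inr xs) | xs js.
     length xs = n \<and> list_all2 (\<lambda>x j. x \<in> component M j) xs js}"
    by (simp add: pure_span_def)
  then have "frag_of [Inl 1] * v \<in> group_closure {frag_of (Inl a # map Inr xs) | a xs. length xs = n}"
    by (rule group_closure_into)
       (auto simp: right_diff_distrib group_closure.diff simp flip: frag_of_append
         intro!: group_closure.base insertI2 exI [of _ 1])
  moreover have "(frag_of [Inl 1] - frag_of []) * v \<in> tensor_ideal M"
    by (intro tensor_ideal_mult_right tensor_ideal_relator) (auto simp: tensor_relators_def)
  then have "tensor_class M (frag_of [Inl 1] * v) = tensor_class M v"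
    by (simp add: tensor_class_eq_iff left_diff_distrib flip: one_words)
  ultimately show ?thesis
    unfolding tensor_carrier_def by blast
qed

end

section \<open>Evaluation of tensor maps\<close>

context graded_bimod
begin

lemma relator_alg_add: "frag_of [Inl (a + b)] - frag_of [Inl a] - frag_of [Inl b] \<in> tensor_ideal M"
  and relator_alg_mult: "frag_of [Inl a, Inl b] - frag_of [Inl (a * b)] \<in> tensor_ideal M"
  and relator_alg_one: "frag_of [Inl 1] - frag_of [] \<in> tensor_ideal M"
  and relator_lact: "frag_of [Inl a, Inr x] - frag_of [Inr (lact M a x)] \<in> tensor_ideal M"
  and relator_ract: "frag_of [Inr x, Inl a] - frag_of [Inr (ract M x a)] \<in> tensor_ideal M"
  unfolding tensor_relators_def by (rule tensor_ideal_relator, unfold tensor_relators_def, blast)+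

lemma tensor_class_eqI: "v - u \<in> tensor_ideal M \<Longrightarrow> tensor_class M u = tensor_class M v"
  by (metis tensor_class_eq_iff)

text \<open>Contractions with values in the tensor ring: words modulo the tensor ideal.\<close>

sublocale W: contraction M "(*)" "1 :: ('a, 'm) words" "\<lambda>a. frag_of [Inl a]" "tensor_ideal M"
proof
  fix a b
  show "frag_of [Inl (a + b)] - frag_of [Inl a] - frag_of [Inl b] \<in> tensor_ideal M"
    by (rule relator_alg_add)
  show "frag_of [Inl 1] - 1 \<in> tensor_ideal M"
    using relator_alg_one by (simp add: one_words)
  show "frag_of [Inl a] * frag_of [Inl b] - frag_of [Inl (a * b)] \<in> tensor_ideal M"
    using relator_alg_mult by (simp flip: frag_of_append)
qed (auto simp: algebra_simps tensor_ideal_mult_left tensor_ideal_mult_right intro: tensor_ideal_diff)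

lemmas [simp del] = W.unit_left W.unit_right

text \<open>
  The square-zero extension \<open>A \<oplus> M\<close>. It is the quotient of the tensor ring by all tensors with at
  least two factors from \<open>M\<close>, and thus detects the zeroth and the first tensor power.
\<close>

definition square_zero_mult :: "'a \<times> 'm \<Rightarrow> 'a \<times> 'm \<Rightarrow> 'a \<times> 'm" where
  "square_zero_mult p q =
     (fst p * fst q, lact M (fst p) (snd q) + ract M (snd p) (fst q))"

sublocale C: contraction M square_zero_mult "(1, 0)" "\<lambda>a. (a, 0)" "{0}"
  by standard
    (auto simp: square_zero_mult_def prod_eq_iff algebra_simps lact_add lact_add_scalar lact_mult
      ract_add ract_add_scalar ract_mult ract_lact)

definition bimodule_valued :: "('m \<Rightarrow> ('a, 'm) words set) \<Rightarrow> bool" where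
  "bimodule_valued f \<longleftrightarrow> (\<forall>x. f x \<in> range (tensor_class M)) \<and> (\<forall>x y. f (x + y) = f x + f y) \<and>
     (\<forall>a x. f (lact M a x) = tensor_mult M (tensor_of_alg M a) (f x) \<and>
            f (ract M x a) = tensor_mult M (f x) (tensor_of_alg M a))"

lemma bimodule_valued_graded_map:
  "graded_map l M (tensor_power M n) f \<Longrightarrow> bimodule_valued f"
  using graded_map_carrier [of l n f] tensor_carrier_range
  by (auto simp: bimodule_valued_def graded_map_def bimodule_hom_def tensor_power_def)

lemma bimodule_valued_tensor_of_mod: "bimodule_valued (tensor_of_mod M)"
proof -
  have "tensor_class M (frag_of [Inr (lact M a x)]) = tensor_class M (frag_of [Inl a, Inr x])"
    "tensor_class M (frag_of [Inr (ract M x a)]) = tensor_class M (frag_of [Inr x, Inl a])" for a x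
    by (rule tensor_class_eqI, rule relator_lact relator_ract)+
  moreover have "tensor_class M (frag_of [Inr (x + y)]) =
      tensor_class M (frag_of [Inr x] + frag_of [Inr y])" for x y
    using relator_add [of x y] by (simp add: tensor_class_eq_iff diff_diff_eq)
  ultimately show ?thesis
    by (simp add: bimodule_valued_def tensor_of_mod_def tensor_of_alg_def tensor_class_add
        tensor_class_mult flip: frag_of_append)
qed

lemma bimodule_valued_tensor_of_alg:
  assumes "graded_map l M regular_bimodule f"
  shows "bimodule_valued (tensor_of_alg M \<circ> f)"
proof -
  have "tensor_class M (frag_of [Inl (a * b)]) = tensor_class M (frag_of [Inl a, Inl b])" for a b
    by (rule tensor_class_eqI, rule relator_alg_mult)
  moreover have "tensor_class M (frag_of [Inl (a + b)]) =
      tensor_class M (frag_of [Inl a] + frag_of [Inl b])" for a b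
    using relator_alg_add [of a b] by (simp add: tensor_class_eq_iff diff_diff_eq)
  moreover have "f (x + y) = f x + f y" "f (lact M a x) = a * f x" "f (ract M x a) = f x * a" for x y a
    using assms by (auto simp: graded_map_def bimodule_hom_def regular_bimodule_def)
  ultimately show ?thesis
    by (simp add: bimodule_valued_def tensor_of_alg_def tensor_class_add
        tensor_class_mult flip: frag_of_append)
qed

lemma bimodule_valued_inv_pow: "bimodule_valued f \<Longrightarrow> bimodule_valued (\<lambda>x. f (inv_pow k x))"
  by (simp add: bimodule_valued_def inv_pow_add inv_pow_lact inv_pow_ract)

lemma slot_representative:
  assumes "bimodule_valued f"
  shows "W.slot (\<lambda>x. representative M (f x))"
proof -
  have cl: "tensor_class M (representative M (f x)) = f x" for x
    using assms by (intro tensor_class_representative) (simp add: bimodule_valued_def)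
  have "tensor_class M (representative M (f (x + y)) - representative M (f x)) =
      tensor_class M (representative M (f y))" for x y
  proof -
    have "tensor_class M (representative M (f (x + y))) =
      tensor_class M (representative M (f x) + representative M (f y))"
      using assms by (simp add: cl flip: tensor_class_add) (simp add: bimodule_valued_def)
    then show ?thesis
      by (simp add: tensor_class_eq_iff diff_diff_eq)
  qed
  moreover have "tensor_class M (frag_of [Inl a] * representative M (f x)) =
      tensor_class M (representative M (f (lact M a x)))"
    "tensor_class M (representative M (f x) * frag_of [Inl a]) =
      tensor_class M (representative M (f (ract M x a)))" for a x
    by (simp_all add: cl flip: tensor_class_mult)
       (use assms in \<open>simp_all add: bimodule_valued_def tensor_of_alg_def\<close>)
  ultimately show ?thesis
    by (simp add: W.slot_def tensor_class_eq_iff)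
qed

text \<open>
  In \<open>f\<^sub>1 \<otimes> \<dots> \<otimes> f\<^sub>r\<close> the maps to the right of \<open>f\<^sub>i\<close> have to pass the \<open>i\<close>-th letter. Their total degree is
  the power of the involution that is applied to this letter.
\<close>

fun twist :: "(('m \<Rightarrow> ('a, 'm) words set) \<times> int) list \<Rightarrow> ('m \<Rightarrow> ('a, 'm) words set) list" where
  "twist [] = []"
| "twist ((f, l) # fs) = (\<lambda>x. f (inv_pow (sum_list (map snd fs)) x)) # twist fs"

lemma length_twist [simp]: "length (twist fs) = length fs"
  by (induction fs rule: twist.induct) simp_all

abbreviation reps :: "('m \<Rightarrow> ('a, 'm) words set) list \<Rightarrow> ('m \<Rightarrow> ('a, 'm) words) list" where
  "reps hs \<equiv> map (\<lambda>h x. representative M (h x)) hs"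

lemma slot_twist:
  "\<forall>f\<in>fst ` set fs. bimodule_valued f \<Longrightarrow> \<forall>h\<in>set (twist fs). bimodule_valued h"
  by (induction fs rule: twist.induct) (auto intro: bimodule_valued_inv_pow)

lemma bimodule_valued_signed:
  assumes "bimodule_valued f"
  shows "f (signed k x) = tensor_signed k (f x)"
proof -
  obtain u where u: "f x = tensor_class M u"
    using assms unfolding bimodule_valued_def by blast
  obtain v where v: "f (- x) = tensor_class M v"
    using assms unfolding bimodule_valued_def by blast
  obtain z where z: "f 0 = tensor_class M z"
    using assms unfolding bimodule_valued_def by blast
  have "f (0 + 0) = f 0 + f 0" "f (x + - x) = f x + f (- x)"
    using assms unfolding bimodule_valued_def by blast+
  then have "z - (z + z) \<in> tensor_ideal M" "z - (u + v) \<in> tensor_ideal M"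
    by (simp_all only: add_0 right_minus u v z tensor_class_add tensor_class_eq_iff)
  then have "- (z - (z + z)) - (z - (u + v)) \<in> tensor_ideal M"
    by (rule tensor_ideal_diff [OF tensor_ideal_minus])
  then have "v - - u \<in> tensor_ideal M"
    by (simp add: algebra_simps)
  then have "f (- x) = tensor_class M (- u)"
    by (simp only: v tensor_class_eq_iff)
  then show ?thesis
    by (simp add: u tensor_signed_class) (simp add: signed_def u)
qed

lemma word_eval_twist:
  assumes "length xs = length fs" "list_all2 (\<lambda>x j. x \<in> component M j) xs js"
    and "\<forall>f\<in>fst ` set fs. bimodule_valued f"
  shows "tensor_class M (W.word_eval (map Inr xs) (reps (twist fs))) =
    tensor_signed (koszul_exponent (map snd fs) js) (tensor_list M (map2 (\<lambda>f x. fst f x) fs xs))"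
  using assms
proof (induction xs fs arbitrary: js rule: list_induct2)
  case Nil
  then show ?case
    by (simp add: tensor_list_def tensor_signed_def)
next
  case (Cons x xs f fs)
  obtain g l where f: "f = (g, l)"
    by fastforce
  obtain j ks where js: "js = j # ks" "x \<in> component M j"
      "list_all2 (\<lambda>x j. x \<in> component M j) xs ks"
    using Cons.prems by (auto simp: list_all2_Cons1)
  let ?k = "sum_list (map snd fs) * j"
  have g: "bimodule_valued g"
    using Cons.prems f by simp
  have "tensor_class M (representative M (g (inv_pow (sum_list (map snd fs)) x)))
      = g (inv_pow (sum_list (map snd fs)) x)"
    using g by (intro tensor_class_representative) (simp add: bimodule_valued_def)
  also have "\<dots> = tensor_signed ?k (g x)"
    using js by (simp add: inv_pow_homogeneous bimodule_valued_signed [OF g])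
  finally have 1: "tensor_class M (representative M (g (inv_pow (sum_list (map snd fs)) x))) =
    tensor_signed ?k (g x)" .
  have IH: "tensor_class M (W.word_eval (map Inr xs) (reps (twist fs))) =
    tensor_signed (koszul_exponent (map snd fs) ks) (tensor_list M (map2 (\<lambda>f x. fst f x) fs xs))"
    using Cons js by simp
  obtain u where u: "g x = tensor_class M u"
    using g unfolding bimodule_valued_def by blast
  have rng: "tensor_list M (map2 (\<lambda>f x. fst f x) fs xs) \<in> range (tensor_class M)"
  proof -
    have "tensor_list M Us \<in> range (tensor_class M)" if "set Us \<subseteq> range (tensor_class M)" for Us
      using that by (induction Us) (auto simp: tensor_list_def tensor_class_mult)
    moreover have "set (map2 (\<lambda>f x. fst f x) fs xs) \<subseteq> range (tensor_class M)"
      using Cons.prems(2) by (auto simp: bimodule_valued_def dest!: set_zip_leftD)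
    ultimately show ?thesis .
  qed
  then obtain v where v: "tensor_list M (map2 (\<lambda>f x. fst f x) fs xs) = tensor_class M v"
    by auto
  have "signed ?k u * signed k v = signed (?k + k) (u * v)" for k
    by (simp add: signed_def)
  then show ?case
    by (simp add: f js tensor_class_mult [symmetric] 1 IH)
       (simp add: tensor_list_def [of M "_ # _"] tensor_list_def [symmetric] u v tensor_signed_class tensor_class_mult)
qed

text \<open>
  The contraction with the twisted maps kills the tensor ideal, so it is a well-defined additive map on
  the tensor power, and it has the prescribed values by \<open>word_eval_twist\<close>. Uniqueness holds because
  the tensors of homogeneous elements generate the tensor power.
\<close>

lemma tensor_map_eq:
  assumes "fs \<noteq> []" and fs: "\<forall>f\<in>fst ` set fs. bimodule_valued f"
    and U: "U \<in> tensor_carrier M (length fs)"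
  shows "tensor_map M fs U =
    tensor_class M (W.contract (reps (twist fs)) (representative M U))"
proof -
  let ?T = "tensor_carrier M (length fs)"
  let ?ev = "W.contract (reps (twist fs))"
  define h0 where "h0 U = (if U \<in> ?T then tensor_class M (?ev (representative M U)) else undefined)" for U
  define good where "good h \<longleftrightarrow>
     (\<forall>U. U \<notin> ?T \<longrightarrow> h U = undefined) \<and>
     (\<forall>U\<in>?T. h U \<in> range (tensor_class M)) \<and>
     (\<forall>U\<in>?T. \<forall>V\<in>?T. h (U + V) = h U + h V) \<and>
     (\<forall>xs js. length xs = length fs \<and> list_all2 (\<lambda>x j. x \<in> component M j) xs js \<longrightarrow>
        h (tensor_list M (map (tensor_of_mod M) xs)) =
        tensor_signed (koszul_exponent (map snd fs) js)
          (tensor_list M (map2 (\<lambda>f x. fst f x) fs xs)))" for h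
  have slots: "\<forall>g\<in>set (reps (twist fs)). W.slot g"
    using slot_twist [OF fs] slot_representative by auto
  have ev_cong: "tensor_class M (?ev u) = tensor_class M (?ev v)"
    if "tensor_class M u = tensor_class M v" for u v
    using W.contract_cong_ideal [OF _ slots, of u v] that by (simp add: tensor_class_eq_iff)
  have h0: "h0 (tensor_class M u) = tensor_class M (?ev u)" if "tensor_class M u \<in> ?T" for u
    using that tensor_carrier_range
    by (simp add: h0_def) (rule ev_cong, simp add: tensor_class_representative)
  have words: "tensor_list M (map (tensor_of_mod M) xs) = tensor_class M (frag_of (map Inr xs))" for xs
    by (induction xs) (simp_all add: tensor_list_def one_words tensor_of_mod_def tensor_class_mult
        flip: frag_of_append)
  have pure_word: "frag_of (map Inr xs) \<in> pure_span (length fs)"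
    if "length xs = length fs" "list_all2 (\<lambda>x j. x \<in> component M j) xs js" for xs js
    unfolding pure_span_def using that by (intro group_closure.base insertI2) auto
  have "good h0"
    unfolding good_def
  proof (intro conjI allI impI ballI)
    fix U V assume UV: "U \<in> ?T" "V \<in> ?T"
    then obtain u v where uv: "U = tensor_class M u" "V = tensor_class M v"
      using tensor_carrier_range by blast
    show "h0 (U + V) = h0 U + h0 V"
      using tensor_carrier_add [OF UV] UV
      by (simp add: uv h0 tensor_class_add W.contract_add)
  next
    fix xs js assume xs: "length xs = length fs \<and> list_all2 (\<lambda>x j. x \<in> component M j) xs js"
    then show "h0 (tensor_list M (map (tensor_of_mod M) xs)) =
        tensor_signed (koszul_exponent (map snd fs) js)
          (tensor_list M (map2 (\<lambda>f x. fst f x) fs xs))"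
      using pure_word [THEN pure_span_carrier] word_eval_twist [of xs fs js] fs
      by (auto simp: words h0)
  qed (auto simp: h0_def)
  moreover have "h = h0" if h: "good h" for h
  proof
    fix U
    show "h U = h0 U"
    proof (cases "U \<in> ?T")
      case True
      then obtain v where v: "v \<in> pure_span (length fs)" and U: "U = tensor_class M v"
        using carrier_pure_span assms(1) by blast
      from v have "v \<in> pure_span (length fs) \<and> h (tensor_class M v) = h0 (tensor_class M v)"
        unfolding pure_span_def
      proof induction
        case (base v)
        then consider "v = 0" | xs js where "v = frag_of (map Inr xs)" "length xs = length fs"
            "list_all2 (\<lambda>x j. x \<in> component M j) xs js"
          by auto
        then show ?case
        proof cases
          case 1
          have T: "tensor_class M 0 \<in> ?T"
            using pure_span_carrier [of 0] by (simp add: pure_span_zero)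
          have "tensor_class M 0 + tensor_class M 0 = tensor_class M 0"
            by (simp add: tensor_class_add)
          then have "h (tensor_class M 0) + h (tensor_class M 0) = h (tensor_class M 0)"
            using h T unfolding good_def by metis
          moreover obtain z where z: "h (tensor_class M 0) = tensor_class M z"
            using h T unfolding good_def by blast
          ultimately have "h (tensor_class M 0) = tensor_class M 0"
            by (simp add: tensor_class_add tensor_class_eq_iff)
          with 1 T show ?thesis
            by (simp add: h0)
        next
          case 2
          then have "h (tensor_class M v) = h0 (tensor_class M v)"
            using h \<open>good h0\<close> unfolding good_def by (metis words)
          with 2 pure_word show ?thesis
            by (auto simp: pure_span_def)
        qed
      next
        case (diff u v)
        then have uv: "u \<in> pure_span (length fs)" "v \<in> pure_span (length fs)"
          by (simp_all add: pure_span_def)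
        note T = this [THEN pure_span_carrier] pure_span_diff [OF this, THEN pure_span_carrier]
        have sum: "tensor_class M u = tensor_class M (u - v) + tensor_class M v"
          by (simp add: tensor_class_add)
        obtain z where z: "h (tensor_class M (u - v)) = tensor_class M z"
          using h T unfolding good_def by blast
        have "h (tensor_class M u) = h (tensor_class M (u - v)) + h (tensor_class M v)"
          using h T unfolding good_def sum by blast
        then have "tensor_class M (?ev u) = tensor_class M (z + ?ev v)"
          using diff T by (simp add: z h0 tensor_class_add)
        then have "h (tensor_class M (u - v)) = h0 (tensor_class M (u - v))"
          using T tensor_ideal_minus [of "?ev u - (z + ?ev v)"]
          by (simp add: z h0 tensor_class_eq_iff W.contract_diff algebra_simps)
        with pure_span_diff [OF uv] show ?case
          by (simp add: pure_span_def)
      qed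
      with U show ?thesis
        by simp
    next
      case False
      with h show ?thesis
        by (simp add: good_def h0_def)
    qed
  qed
  ultimately have "(THE h. good h) = h0"
    by (rule the_equality)
  then have "tensor_map M fs = h0"
    by (simp add: tensor_map_def good_def)
  with U show ?thesis
    by (simp add: h0_def)
qed

end

section \<open>Contracting tensor maps\<close>

context graded_bimod
begin

lemma C_slot_iff:
  "C.slot g \<longleftrightarrow> (\<forall>x y. g (x + y) = g x + g y) \<and>
     (\<forall>a x. g (lact M a x) = square_zero_mult (a, 0) (g x) \<and>
            g (ract M x a) = square_zero_mult (g x) (a, 0))"
  by (auto simp: C.slot_def diff_diff_eq)

lemma C_contract_ideal:
  "u \<in> tensor_ideal M \<Longrightarrow> \<forall>g\<in>set gs. C.slot g \<Longrightarrow> C.contract gs u = 0"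
  using C.contract_ideal [of u gs] by simp

lemma C_contract_span_mult:
  assumes u: "u \<in> word_span (length gs)" and gs: "\<forall>g\<in>set gs \<union> set hs. C.slot g"
  shows "C.contract (gs @ hs) (u * v) = square_zero_mult (C.contract gs u) (C.contract hs v)"
proof -
  have "C.contract (gs @ hs) (u * v) - square_zero_mult (C.contract gs u) (C.contract hs v) \<in> {0}"
    using u [unfolded word_span_def]
  proof (rule group_closure_into)
    fix x assume "x \<in> {frag_of w |w. letters w = length gs} \<union> tensor_ideal M"
    then show "C.contract (gs @ hs) (x * v) - square_zero_mult (C.contract gs x) (C.contract hs v) \<in> {0}"
    proof
      assume "x \<in> {frag_of w |w. letters w = length gs}"
      then show ?thesis
        by (auto simp: C.contract_word_mult)
    next
      assume "x \<in> tensor_ideal M"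
      with gs show ?thesis
        by (simp add: C_contract_ideal tensor_ideal_mult_right)
    qed
  qed (simp_all add: left_diff_distrib C.contract_diff C.diff_left)
  then show ?thesis
    by simp
qed

text \<open>
  Each map \<open>f\<close> of the inner contraction produces as many letters as its partner list \<open>gs\<close> has maps,
  so the outer contraction splits into blocks, one for each \<open>f\<close>.
\<close>

lemma C_contract_word_eval:
  assumes "\<forall>(f, gs)\<in>set bl. (\<forall>x. f x \<in> word_span (length gs)) \<and> (\<forall>g\<in>set gs. C.slot g)"
  shows "C.contract (concat (map snd bl)) (W.word_eval w (map fst bl)) =
    C.word_eval w (map (\<lambda>(f, gs) x. C.contract gs (f x)) bl)"
  using assms
proof (induction w arbitrary: bl rule: letters.induct)
  case 1
  have "C.contract [] 1 = (1, 0)"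
    by (simp add: one_words)
  then show ?case
    by auto
next
  case (2 a w)
  then show ?case
    by (simp add: C.contract_word_mult)
next
  case (3 x w)
  show ?case
  proof (cases bl)
    case (Cons b bl')
    obtain f gs where b: "b = (f, gs)"
      by fastforce
    have f: "f x \<in> word_span (length gs)" and gs: "\<forall>g\<in>set gs. C.slot g"
      and bl': "\<forall>(f, gs)\<in>set bl'. (\<forall>x. f x \<in> word_span (length gs)) \<and> (\<forall>g\<in>set gs. C.slot g)"
      using 3 Cons b by auto
    then have "\<forall>g\<in>set gs \<union> set (concat (map snd bl')). C.slot g"
      by auto
    from C_contract_span_mult [OF f this] show ?thesis
      by (simp add: Cons b "3.IH" [OF bl'])
  qed simp
qed

lemma C_contract_W_contract:
  assumes "\<forall>(f, gs)\<in>set bl. (\<forall>x. f x \<in> word_span (length gs)) \<and> (\<forall>g\<in>set gs. C.slot g)"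
  shows "C.contract (concat (map snd bl)) (W.contract (map fst bl) u) =
    C.contract (map (\<lambda>(f, gs) x. C.contract gs (f x)) bl) u"
  by (rule frag_ext [where u = u])
     (simp_all add: W.contract_diff C.contract_diff C_contract_word_eval [OF assms])

definition eval :: "('m \<Rightarrow> 'a \<times> 'm) list \<Rightarrow> ('a, 'm) words set \<Rightarrow> 'a \<times> 'm" where
  "eval gs U = C.contract gs (representative M U)"

lemma eval_class: "\<forall>g\<in>set gs. C.slot g \<Longrightarrow> eval gs (tensor_class M u) = C.contract gs u"
  using C.contract_cong_ideal [OF representative_class, of gs u] by (simp add: eval_def)

definition contractible :: "('m \<Rightarrow> ('a, 'm) words set) \<Rightarrow> ('m \<Rightarrow> 'a \<times> 'm) list \<Rightarrow> bool" where
  "contractible f gs \<longleftrightarrow>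
     bimodule_valued f \<and> (\<forall>x. f x \<in> tensor_carrier M (length gs)) \<and> (\<forall>g\<in>set gs. C.slot g)"

lemma contractible_twist:
  "list_all2 (\<lambda>f. contractible (fst f)) fs gss \<Longrightarrow> list_all2 contractible (twist fs) gss"
proof (induction rule: list_all2_induct)
  case (Cons f fs gs gss)
  then show ?case
    by (cases f) (auto simp: contractible_def intro: bimodule_valued_inv_pow)
qed simp

lemma eval_tensor_map:
  assumes "fs \<noteq> []" and fs: "list_all2 (\<lambda>f. contractible (fst f)) fs gss"
    and U: "U \<in> tensor_carrier M (length fs)"
  shows "eval (concat gss) (tensor_map M fs U) =
    eval (map (\<lambda>(f, gs) x. eval gs (f x)) (zip (twist fs) gss)) U"
proof -
  have len: "length gss = length fs"
    using fs by (simp add: list_all2_lengthD)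
  have bl: "\<forall>(f, gs)\<in>set (zip (reps hs) gss).
      (\<forall>x. f x \<in> word_span (length gs)) \<and> (\<forall>g\<in>set gs. C.slot g)"
    if "list_all2 contractible hs gss" for hs
    using that
    by (induction rule: list_all2_induct) (auto simp: contractible_def representative_word_span)
  note * = bl [OF contractible_twist [OF fs]]
  have gs: "\<forall>g\<in>set (concat gss). C.slot g"
    using fs by (induction rule: list_all2_induct) (auto simp: contractible_def)
  have bv: "\<forall>f\<in>fst ` set fs. bimodule_valued f"
    using fs by (induction rule: list_all2_induct) (auto simp: contractible_def)
  have "eval (concat gss) (tensor_map M fs U) =
      C.contract (concat gss) (W.contract (reps (twist fs)) (representative M U))"
    by (simp add: tensor_map_eq [OF assms(1) bv U] eval_class [OF gs])
  also have "\<dots> = C.contract (map (\<lambda>(f, gs) x. C.contract gs (f x)) (zip (reps (twist fs)) gss))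
      (representative M U)"
    using C_contract_W_contract [OF *, of "representative M U"] len by simp
  also have "map (\<lambda>(f, gs) x. C.contract gs (f x)) (zip (reps (twist fs)) gss) =
      map (\<lambda>(f, gs) x. eval gs (f x)) (zip (twist fs) gss)"
    by (simp add: zip_map1 eval_def split_beta comp_def)
  finally show ?thesis
    by (simp add: eval_def)
qed

lemma tensor_of_mod_carrier: "tensor_of_mod M x \<in> tensor_carrier M 1"
proof -
  have "tensor_of_mod M x = tensor_class M (frag_of (Inl 1 # map Inr [x]))"
    unfolding tensor_of_mod_def using relator_lact [of 1 x] by (intro tensor_class_eqI) simp
  then show ?thesis
    unfolding tensor_carrier_def
    by (auto intro!: image_eqI group_closure.base insertI2 exI [of _ 1] exI [of _ "[x]"])
qed

lemma tensor_of_alg_carrier: "tensor_of_alg M a \<in> tensor_carrier M 0"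
  unfolding tensor_carrier_def tensor_of_alg_def by (auto intro!: imageI group_closure.base)

lemma eval_tensor_of_mod: "C.slot g \<Longrightarrow> eval [g] (tensor_of_mod M x) = g x"
  by (simp add: tensor_of_mod_def eval_class)

lemma eval_tensor_of_alg: "eval [] (tensor_of_alg M a) = (a, 0)"
  by (simp add: tensor_of_alg_def eval_class)

lemma twist_append:
  "twist (fs @ gs) = map (\<lambda>f x. f (inv_pow (sum_list (map snd gs)) x)) (twist fs) @ twist gs"
  by (induction fs rule: twist.induct) (auto simp: inv_pow_inv_pow algebra_simps)

lemma twist_replicate: "twist (replicate r (f, 0)) = replicate r f"
  by (induction r) (simp_all add: inv_pow_even sum_list_replicate)

text \<open>
  The identities to the left of \<open>f\<close> are passed by \<open>f\<close>, of degree \<open>l\<close>, and pick up the \<open>l\<close>-th power of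
  the involution; the maps in \<open>gs2\<close> merge with \<open>f\<close> into a single map on one letter.
\<close>

lemma eval_tensor_insert:
  assumes f: "bimodule_valued f" "\<And>x. f x \<in> tensor_carrier M (length gs2)"
    and gs: "\<forall>g\<in>set (gs1 @ gs2 @ gs3). C.slot g"
    and U: "U \<in> tensor_carrier M (length gs1 + 1 + length gs3)"
  shows "eval (gs1 @ gs2 @ gs3) (tensor_insert M (length gs1) l f (length gs3) U) =
    eval (map (\<lambda>g x. g (inv_pow l x)) gs1 @ (\<lambda>x. eval gs2 (f x)) # gs3) U"
proof -
  let ?fs = "replicate (length gs1) (tensor_of_mod M, 0) @ (f, l) #
    replicate (length gs3) (tensor_of_mod M, 0)"
  let ?gss = "map (\<lambda>g. [g]) gs1 @ gs2 # map (\<lambda>g. [g]) gs3"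
  have cc: "concat (map (\<lambda>g. [g]) hs) = hs" for hs :: "('m \<Rightarrow> 'a \<times> 'm) list"
    by (induction hs) simp_all
  have z: "map (\<lambda>(f, gs) x. eval gs (f x)) (zip (replicate (length hs) (\<lambda>x. tensor_of_mod M (F x)))
      (map (\<lambda>g. [g]) hs)) = map (\<lambda>g x. g (F x)) hs"
    if "\<forall>g\<in>set hs. C.slot g" for hs F
    using that by (induction hs) (simp_all add: eval_tensor_of_mod)
  have mods: "list_all2 (\<lambda>f. contractible (fst f)) (replicate (length hs) (tensor_of_mod M, 0))
      (map (\<lambda>g. [g]) hs)" if "\<forall>g\<in>set hs. C.slot g" for hs
    using that
    by (induction hs) (simp_all add: contractible_def bimodule_valued_tensor_of_mod
        tensor_of_mod_carrier [simplified])
  have "eval (concat ?gss) (tensor_map M ?fs U) =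
      eval (map (\<lambda>(f, gs) x. eval gs (f x)) (zip (twist ?fs) ?gss)) U"
    using f gs U mods [of gs1] mods [of gs3]
    by (intro eval_tensor_map) (auto simp: contractible_def intro!: list_all2_appendI)
  also have "zip (twist ?fs) ?gss =
      zip (replicate (length gs1) (\<lambda>x. tensor_of_mod M (inv_pow l x))) (map (\<lambda>g. [g]) gs1) @
      (f, gs2) # zip (replicate (length gs3) (tensor_of_mod M)) (map (\<lambda>g. [g]) gs3)"
    by (simp add: twist_append twist_replicate sum_list_replicate inv_pow_even)
  finally show ?thesis
    using gs z [of gs1 "inv_pow l"] z [of gs3 "\<lambda>x. x"]
    by (simp add: tensor_insert_def cc)
qed


section \<open>Rules for contractions\<close>

lemma eval_add:
  assumes "\<forall>g\<in>set gs. C.slot g" "U \<in> range (tensor_class M)" "V \<in> range (tensor_class M)"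
  shows "eval gs (U + V) = eval gs U + eval gs V"
  using assms by (auto simp: tensor_class_add eval_class C.contract_add)

lemma eval_signed:
  assumes "\<forall>g\<in>set gs. C.slot g" "U \<in> range (tensor_class M)"
  shows "eval gs (tensor_signed k U) = signed k (eval gs U)"
  using assms by (auto simp: tensor_signed_class eval_class signed_def C.contract_minus)

lemma eval_zero: "\<forall>g\<in>set gs. C.slot g \<Longrightarrow> eval gs (tensor_class M 0) = 0"
  by (simp add: eval_class)

lemma eval_slot_zero: "eval (gs1 @ (\<lambda>_. 0) # gs2) U = 0"
proof -
  have w: "C.word_eval w (gs1 @ (\<lambda>_. 0) # gs2) = 0" for w
  proof (induction w arbitrary: gs1 rule: letters.induct)
    case (3 x w)
    then show ?case
      by (cases gs1) simp_all
  qed simp_all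
  show ?thesis
    unfolding eval_def by (rule frag_ext [where u = "representative M U" and g = "\<lambda>_. 0"])
      (simp_all add: C.contract_diff w)
qed

lemma eval_slot_minus: "eval (gs1 @ (\<lambda>x. - g x) # gs2) U = - eval (gs1 @ g # gs2) U"
proof -
  have w: "C.word_eval w (gs1 @ (\<lambda>x. - g x) # gs2) = - C.word_eval w (gs1 @ g # gs2)" for w
  proof (induction w arbitrary: gs1 rule: letters.induct)
    case (3 x w)
    then show ?case
      by (cases gs1) (simp_all add: C.minus_left C.minus_right)
  qed (simp_all add: C.minus_right)
  show ?thesis
    unfolding eval_def
    by (rule frag_ext [where u = "representative M U" and g = "\<lambda>u. - C.contract (gs1 @ g # gs2) u"])
      (simp_all add: C.contract_diff w)
qed

text \<open>
  If all other maps take values in \<open>A\<close>, then the value of \<open>g\<close> is only multiplied by elements of \<open>A\<close>, and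
  these multiplications commute with a bimodule map \<open>h\<close>.
\<close>

lemma eval_post:
  assumes "\<And>a p. h (square_zero_mult (a, 0) p) = square_zero_mult (a, 0) (h p)"
    and "\<And>a p. h (square_zero_mult p (a, 0)) = square_zero_mult (h p) (a, 0)"
    and "\<And>p q. h (p - q) = h p - h q"
    and "\<forall>g\<in>set (gs1 @ gs2). \<forall>x. snd (g x) = 0"
  shows "eval (gs1 @ (\<lambda>x. h (g x)) # gs2) U = h (eval (gs1 @ g # gs2) U)"
proof -
  have h0: "h 0 = 0"
    using assms(3) [of 0 0] by simp
  have alg: "snd (C.word_eval w gs) = 0" if "\<forall>g\<in>set gs. \<forall>x. snd (g x) = 0" for w gs
    using that by (induction w arbitrary: gs rule: letters.induct)
      (auto split: list.split simp: square_zero_mult_def)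
  have w: "C.word_eval w (gs1 @ (\<lambda>x. h (g x)) # gs2) = h (C.word_eval w (gs1 @ g # gs2))" for w
    using assms(4)
  proof (induction w arbitrary: gs1 rule: letters.induct)
    case (3 x w)
    show ?case
    proof (cases gs1)
      case Nil
      obtain a where "C.word_eval w gs2 = (a, 0)"
        using alg [of gs2 w] 3 by (cases "C.word_eval w gs2") auto
      with Nil show ?thesis
        by (simp add: assms)
    next
      case (Cons g' gs')
      obtain a where "g' x = (a, 0)"
        using 3 Cons by (cases "g' x") (auto dest: spec [of _ x])
      with Cons 3 show ?thesis
        by (simp add: assms)
    qed
  qed (simp_all add: h0 assms)
  show ?thesis
    unfolding eval_def
    by (rule frag_ext [where u = "representative M U" and g = "\<lambda>u. h (C.contract (gs1 @ g # gs2) u)"])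
      (simp_all add: C.contract_diff w assms)
qed

text \<open>The square-zero extension is graded, with \<open>A\<close> in degree \<open>0\<close>.\<close>

definition degree_part :: "int \<Rightarrow> ('a \<times> 'm) set" where
  "degree_part i = {p. (i \<noteq> 0 \<longrightarrow> fst p = 0) \<and> snd p \<in> component M i}"

lemma degree_part_mult:
  "p \<in> degree_part i \<Longrightarrow> q \<in> degree_part j \<Longrightarrow> square_zero_mult p q \<in> degree_part (i + j)"
  by (cases "i = 0"; cases "j = 0")
     (auto simp: degree_part_def square_zero_mult_def component_lact component_ract component_add)

lemma degree_part_diff: "p \<in> degree_part i \<Longrightarrow> q \<in> degree_part i \<Longrightarrow> p - q \<in> degree_part i"
  by (auto simp: degree_part_def component_diff)

lemma degree_part_0 [simp]: "0 \<in> degree_part i"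
  by (simp add: degree_part_def)

definition homogeneous_slot :: "('m \<Rightarrow> 'a \<times> 'm) \<Rightarrow> int \<Rightarrow> bool" where
  "homogeneous_slot g l \<longleftrightarrow> C.slot g \<and> (\<forall>i. \<forall>x\<in>component M i. g x \<in> degree_part (i + l))"

lemma eval_degree:
  assumes gs: "list_all2 homogeneous_slot gs ls" and U: "U \<in> component (tensor_power M n) i"
  shows "eval gs U \<in> degree_part (i + sum_list ls)"
proof -
  have slots: "\<forall>g\<in>set gs. C.slot g"
    using gs by (induction rule: list_all2_induct) (auto simp: homogeneous_slot_def)
  obtain u where u: "u \<in> homog_span n i" "U = tensor_class M u"
    using U by (rule tensor_power_component)
  have w: "C.word_eval w gs \<in> degree_part (i + sum_list ls)" if "homog w i" for w i
    using that gs
  proof (induction arbitrary: gs ls)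
    case (homog_Inl w i a)
    have "(a, 0) \<in> degree_part 0"
      by (simp add: degree_part_def)
    from degree_part_mult [OF this homog_Inl.IH [OF homog_Inl.prems]] show ?case
      by simp
  next
    case (homog_Inr x j w i)
    show ?case
    proof (cases gs)
      case (Cons g gs')
      then obtain l ls' where ls: "ls = l # ls'" "homogeneous_slot g l" "list_all2 homogeneous_slot gs' ls'"
        using homog_Inr.prems by (auto simp: list_all2_Cons1)
      have "g x \<in> degree_part (j + l)"
        using ls homog_Inr.hyps by (simp add: homogeneous_slot_def)
      from degree_part_mult [OF this homog_Inr.IH [OF ls(3)]] show ?thesis
        by (simp add: Cons ls algebra_simps)
    qed simp
  qed (auto simp: degree_part_def)
  show ?thesis
    unfolding u(2) eval_class [OF slots]
    using u(1) [unfolded homog_span_def]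
    by (rule group_closure_into) (auto simp: C.contract_diff degree_part_diff w)
qed

lemma slot_eval:
  assumes f: "bimodule_valued f" and gs: "\<forall>g\<in>set gs. C.slot g"
  shows "C.slot (\<lambda>x. eval gs (f x))"
proof -
  have rng: "f x \<in> range (tensor_class M)" for x
    using f by (simp add: bimodule_valued_def)
  have l: "eval gs (tensor_mult M (tensor_of_alg M a) U) = square_zero_mult (a, 0) (eval gs U)"
    if "U \<in> range (tensor_class M)" for a U
    using that gs by (auto simp: tensor_of_alg_def tensor_class_mult eval_class C.contract_word_mult)
  have r: "eval gs (tensor_mult M U (tensor_of_alg M a)) = square_zero_mult (eval gs U) (a, 0)"
    if "U \<in> range (tensor_class M)" for a U
    using that gs by (auto simp: tensor_of_alg_def tensor_class_mult eval_class C.contract_mult_word)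
  show ?thesis
    using f rng by (simp add: C_slot_iff bimodule_valued_def l r eval_add [OF gs])
qed

lemma tensor_of_mod_eval:
  assumes "U \<in> tensor_carrier M 1"
  shows "tensor_of_mod M (snd (eval [Pair 0] U)) = U"
proof -
  have slot: "C.slot (Pair 0)"
    by (simp add: C_slot_iff square_zero_mult_def)
  obtain v where v: "v \<in> pure_span 1" and U: "U = tensor_class M v"
    using carrier_pure_span [OF assms] by auto
  have "\<exists>x. U = tensor_of_mod M x"
    unfolding U using v [unfolded pure_span_def]
  proof induction
    case (base v)
    then consider "v = 0" | x where "v = frag_of [Inr x]"
      by (auto simp: length_Suc_conv)
    then show ?case
    proof cases
      case 1
      then show ?thesis
        using letter_zero by (intro exI [of _ 0]) (simp add: tensor_of_mod_def tensor_class_eqI)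
    next
      case 2
      then show ?thesis
        by (auto simp: tensor_of_mod_def)
    qed
  next
    case (diff u v)
    then obtain x y where xy: "tensor_class M u = tensor_of_mod M x" "tensor_class M v = tensor_of_mod M y"
      by auto
    have "tensor_of_mod M (x - y + y) = tensor_of_mod M (x - y) + tensor_of_mod M y"
      using bimodule_valued_tensor_of_mod unfolding bimodule_valued_def by blast
    then have "tensor_class M u = tensor_of_mod M (x - y) + tensor_class M v"
      by (simp only: xy diff_add_cancel)
    then have "tensor_class M (u - v) = tensor_of_mod M (x - y)"
      by (simp add: tensor_of_mod_def tensor_class_add tensor_class_eq_iff algebra_simps)
    then show ?case
      by blast
  qed
  with slot show ?thesis
    by (auto simp: eval_tensor_of_mod)
qed

lemma tensor_of_alg_eval:
  assumes "U \<in> tensor_carrier M 0"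
  shows "tensor_of_alg M (fst (eval [] U)) = U"
proof -
  obtain u where u: "u \<in> group_closure {frag_of (Inl a # map Inr xs) | a xs. length xs = 0}"
    and U: "U = tensor_class M u"
    using assms by (auto simp: tensor_carrier_def)
  have "\<exists>a. U = tensor_of_alg M a"
    unfolding U using u
  proof induction
    case (base v)
    then consider "v = 0" | a where "v = frag_of [Inl a]"
      by auto
    then show ?case
    proof cases
      case 1
      then show ?thesis
        using tensor_ideal_minus [OF relator_alg_add [of 0 0]]
        by (intro exI [of _ 0]) (simp add: tensor_of_alg_def tensor_class_eqI)
    next
      case 2
      then show ?thesis
        by (auto simp: tensor_of_alg_def)
    qed
  next
    case (diff u v)
    then obtain a b where ab: "tensor_class M u = tensor_of_alg M a" "tensor_class M v = tensor_of_alg M b"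
      by auto
    have "tensor_of_alg M (a - b + b) = tensor_of_alg M (a - b) + tensor_of_alg M b"
      using relator_alg_add [of "a - b" b]
      by (simp add: tensor_of_alg_def tensor_class_add tensor_class_eq_iff diff_diff_eq)
    then have "tensor_class M u = tensor_of_alg M (a - b) + tensor_class M v"
      by (simp only: ab diff_add_cancel)
    then have "tensor_class M (u - v) = tensor_of_alg M (a - b)"
      by (simp add: tensor_of_alg_def tensor_class_add tensor_class_eq_iff algebra_simps)
    then show ?case
      by blast
  qed
  then show ?thesis
    by (auto simp: eval_tensor_of_alg)
qed

lemma inj_tensor_of_mod: "inj (tensor_of_mod M)"
proof -
  have "C.slot (Pair 0)"
    by (simp add: C_slot_iff square_zero_mult_def)
  then show ?thesis
    by (intro injI) (metis eval_tensor_of_mod snd_conv)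
qed

lemma inj_tensor_of_alg: "inj (tensor_of_alg M)"
  by (intro injI) (metis eval_tensor_of_alg fst_conv)

end

section \<open>Lifting along projective bimodules\<close>

lemma coset_member: "u \<in> u +o group_closure R"
  by (metis add.right_neutral set_plus_intro2 zero_in_group_closure)

context
  fixes s :: "'k::field \<Rightarrow> 'a::{ring,monoid_mult} \<Rightarrow> 'a"
begin

abbreviation free_lact :: "'a \<Rightarrow> ('a \<times> 'x \<times> 'a \<Rightarrow>\<^sub>0 int) \<Rightarrow> ('a \<times> 'x \<times> 'a \<Rightarrow>\<^sub>0 int)" where
  "free_lact c \<equiv> frag_extend (\<lambda>(a, x, b). frag_of (c * a, x, b))"

abbreviation free_ract :: "('a \<times> 'x \<times> 'a \<Rightarrow>\<^sub>0 int) \<Rightarrow> 'a \<Rightarrow> ('a \<times> 'x \<times> 'a \<Rightarrow>\<^sub>0 int)" where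
  "free_ract u c \<equiv> frag_extend (\<lambda>(a, x, b). frag_of (a, x, b * c)) u"

text \<open>
  An additive map that respects the relations acts on cosets through any representative. This describes
  the two actions on the free bimodule.
\<close>

lemma coset_image:
  assumes "\<And>u v. f (u - v) = f u - f v"
    and "\<And>r. r \<in> R \<Longrightarrow> f r \<in> group_closure R"
  shows "f ` (u +o group_closure R) + group_closure R = f u +o (group_closure R :: 'g::ab_group_add set)"
proof (intro set_eqI iffI)
  have clos: "f r \<in> group_closure R" if "r \<in> group_closure R" for r
    using that by (rule group_closure_into) (auto simp: assms group_closure.diff)
  have "f 0 = 0"
    using assms(1) [of 0 0] by simp
  then have "f (- r) = - f r" for r
    using assms(1) [of 0 r] by simp
  then have add: "f (u + v) = f u + f v" for u v
    using assms(1) [of u "- v"] by simp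
  fix x
  {
    assume "x \<in> f ` (u +o group_closure R) + group_closure R"
    then obtain r r' where "x = f (u + r) + r'" "r \<in> group_closure R" "r' \<in> group_closure R"
      by (auto simp: set_plus_def elt_set_plus_def)
    then have "x = f u + (f r + r')" "f r + r' \<in> group_closure R"
      by (simp_all add: add add.assoc clos group_closure_add)
    then show "x \<in> f u +o group_closure R"
      by (auto simp: elt_set_plus_def)
  }
  {
    assume "x \<in> f u +o group_closure R"
    then obtain r where "x = f u + r" "r \<in> group_closure R"
      by (auto simp: elt_set_plus_def)
    then show "x \<in> f ` (u +o group_closure R) + group_closure R"
      using coset_member by (auto intro!: set_plus_intro imageI)
  }
qed

lemma free_lact_coset:
  assumes "unital_algebra s"
  shows "lact (free_bimodule s) c (u +o group_closure (free_bimodule_relators s)) =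
    free_lact c u +o group_closure (free_bimodule_relators s)"
proof -
  have sc: "s k (c * a) = c * s k a" for k a
    using assms by (simp add: unital_algebra_def)
  have "free_lact c r \<in> free_bimodule_relators s" if "r \<in> free_bimodule_relators s" for r
    using that unfolding free_bimodule_relators_def
    by (elim UnE; clarsimp simp: frag_extend_diff distrib_left simp flip: sc; blast)
  then show ?thesis
    unfolding free_bimodule_def
    by (simp, intro coset_image) (auto simp: frag_extend_diff intro!: group_closure.base)
qed

lemma free_ract_coset:
  assumes "unital_algebra s"
  shows "ract (free_bimodule s) (u +o group_closure (free_bimodule_relators s)) c =
    free_ract u c +o group_closure (free_bimodule_relators s)"
proof -
  have sc: "s k (a * c) = s k a * c" for k a
    using assms by (simp add: unital_algebra_def)
  have "free_ract r c \<in> free_bimodule_relators s" if "r \<in> free_bimodule_relators s" for r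
    using that unfolding free_bimodule_relators_def
    by (elim UnE; clarsimp simp: frag_extend_diff distrib_right simp flip: sc; blast)
  then show ?thesis
    unfolding free_bimodule_def
    by (simp, intro coset_image) (auto simp: frag_extend_diff intro!: group_closure.base)
qed

end

context graded_bimod
begin

definition free_ext :: "('x \<Rightarrow> 'm) \<Rightarrow> ('a \<times> 'x \<times> 'a \<Rightarrow>\<^sub>0 int) \<Rightarrow> 'm" where
  "free_ext y = additive_ext (\<lambda>(a, x, b). ract M (lact M a (y x)) b)"

lemma free_ext_diff: "free_ext y (u - v) = free_ext y u - free_ext y v"
  by (simp add: free_ext_def additive_ext_diff)

lemma free_ext_of: "free_ext y (frag_of (a, x, b)) = ract M (lact M a (y x)) b"
  by (simp add: free_ext_def)

lemma free_ext_add: "free_ext y (u + v) = free_ext y u + free_ext y v"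
  by (simp add: free_ext_def additive_ext_add)

lemma lact_diff: "lact M a (x - y) = lact M a x - lact M a y"
  using lact_add [of a "x - y" y] by simp

lemma ract_diff: "ract M (x - y) a = ract M x a - ract M y a"
  using ract_add [of "x - y" y a] by simp

lemma free_ext_lact: "free_ext y (free_lact c u) = lact M c (free_ext y u)"
  by (rule frag_ext [where u = u])
     (auto simp: frag_extend_diff free_ext_diff lact_diff free_ext_of lact_mult ract_lact)

lemma free_ext_ract: "free_ext y (free_ract u c) = ract M (free_ext y u) c"
  by (rule frag_ext [where u = u])
     (auto simp: frag_extend_diff free_ext_diff ract_diff free_ext_of ract_mult)

text \<open>
  The relation \<open>s c a \<otimes> x \<otimes> b = a \<otimes> x \<otimes> s c b\<close> is respected because \<open>s c 1\<close> acts in the same way from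
  both sides.
\<close>

lemma free_ext_relators:
  assumes ua: "unital_algebra s" and "r \<in> group_closure (free_bimodule_relators s)"
  shows "free_ext y r = 0"
proof -
  have "ract M (lact M (s c a) z) b = ract M (lact M a z) (s c b)" for c a b z
  proof -
    have sa: "s c a = a * s c 1" and sb: "s c b = s c 1 * b"
      using ua by (simp_all add: unital_algebra_def)
    show ?thesis
      by (simp only: sa sb lact_mult ract_mult central ract_lact)
  qed
  then have "free_ext y r \<in> {0}" if "r \<in> free_bimodule_relators s" for r
    using that unfolding free_bimodule_relators_def
    by (auto simp: free_ext_diff free_ext_of lact_add_scalar ract_add_scalar ract_add)
  from group_closure_into [where f = "free_ext y", OF assms(2) this] show ?thesis
    by (simp add: free_ext_diff)
qed

lemma free_ext_component:
  assumes "\<And>x. y x \<in> component M j"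
  shows "free_ext y u \<in> component M j"
proof (induction u rule: frag_induction [OF subset_UNIV])
  case 1
  show ?case
    by (simp add: free_ext_def)
next
  case (2 t)
  then show ?case
    by (cases t) (simp add: free_ext_of assms component_lact component_ract)
next
  case (3 u v)
  then show ?case
    by (simp add: free_ext_diff component_diff)
qed

text \<open>
  The component is a retract, via \<open>\<iota>\<close> and \<open>q\<close>, of a free bimodule. Preimages \<open>y x\<close> of the values of
  \<open>g q\<close> on the basis define a map from the free bimodule, and its composite with \<open>\<iota>\<close> lifts \<open>g\<close>.
\<close>

lemma projective_lift:
  assumes ua: "unital_algebra s"
    and proj: "projective_bimodule s M (component M i)"
    and g: "bimodule_hom (component M i) M M g"
    and d: "bimodule_hom UNIV M M d"
    and img: "\<And>x. x \<in> component M i \<Longrightarrow> g x \<in> d ` component M j"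
  obtains h where "bimodule_hom (component M i) M M h" "h ` component M i \<subseteq> component M j"
    "\<And>x. x \<in> component M i \<Longrightarrow> d (h x) = g x"
proof -
  let ?S = "component M i"
  let ?R = "group_closure (free_bimodule_relators s) :: ('a \<times> 'm \<times> 'a \<Rightarrow>\<^sub>0 int) set"
  let ?F = "free_bimodule s :: ('a, ('a \<times> 'm \<times> 'a \<Rightarrow>\<^sub>0 int) set) bimodule"
  obtain X :: "'m set" and \<iota> q
    where *: "bimodule_hom ?S M ?F \<iota> \<and> \<iota> ` ?S \<subseteq> free_bimodule_carrier s X \<and>
        bimodule_hom (free_bimodule_carrier s X) ?F M q \<and>
        q ` free_bimodule_carrier s X \<subseteq> ?S \<and> (\<forall>x\<in>?S. q (\<iota> x) = x)"
    using proj unfolding projective_bimodule_def by (elim exE)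
  then have \<iota>: "bimodule_hom ?S M ?F \<iota>" "\<iota> ` ?S \<subseteq> free_bimodule_carrier s X"
    and q: "bimodule_hom (free_bimodule_carrier s X) ?F M q" "q ` free_bimodule_carrier s X \<subseteq> ?S"
    and q\<iota>: "\<And>x. x \<in> ?S \<Longrightarrow> q (\<iota> x) = x"
    by (elim conjE, assumption | blast)+
  define cl where "cl u = u +o ?R" for u
  have cl_carrier: "cl u \<in> free_bimodule_carrier s X" if "Poly_Mapping.keys u \<subseteq> UNIV \<times> X \<times> UNIV" for u
    using that by (auto simp: free_bimodule_carrier_def cl_def)
  have q_S: "q U \<in> ?S" if "U \<in> free_bimodule_carrier s X" for U
    using q that by blast
  have "\<exists>y. y \<in> component M j \<and> (x \<in> X \<longrightarrow> d y = g (q (cl (frag_of (1, x, 1)))))" for x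
  proof (cases "x \<in> X")
    case True
    then show ?thesis
      using img [OF q_S [OF cl_carrier, of "frag_of (1, x, 1)"]] by auto
  qed (auto intro: component_0)
  then obtain y where y: "\<And>x. y x \<in> component M j"
      "\<And>x. x \<in> X \<Longrightarrow> d (y x) = g (q (cl (frag_of (1, x, 1))))"
    by metis
  let ?H = "free_ext y"
  have H_cong: "?H u = ?H v" if uv: "u \<in> U" "v \<in> U" and U: "U \<in> free_bimodule_carrier s X" for u v U
  proof -
    obtain t where "U = t +o ?R"
      using U by (auto simp: free_bimodule_carrier_def)
    then obtain r r' where "r \<in> ?R" "r' \<in> ?R" "u = t + r" "v = t + r'"
      using uv by (auto simp: elt_set_plus_def)
    then show ?thesis
      by (simp add: free_ext_add free_ext_relators [OF ua])
  qed
  define h where "h x = ?H (SOME u. u \<in> \<iota> x)" for x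
  have h: "h x = ?H u" if "u \<in> \<iota> x" "x \<in> ?S" for x u
    unfolding h_def using \<iota>(2) that by (intro H_cong [of _ "\<iota> x"] someI [of "\<lambda>u. u \<in> \<iota> x"]) auto
  have obt: "\<exists>u. \<iota> x = cl u \<and> Poly_Mapping.keys u \<subseteq> UNIV \<times> X \<times> UNIV" if "x \<in> ?S" for x
    using that \<iota>(2) by (auto simp: free_bimodule_carrier_def cl_def image_subset_iff)
  have mem: "u \<in> cl u" for u
    unfolding cl_def by (rule coset_member)
  have "bimodule_hom ?S M M h"
    unfolding bimodule_hom_def
  proof (intro conjI ballI allI)
    fix x z assume xz: "x \<in> ?S" "z \<in> ?S"
    obtain u v where u: "\<iota> x = cl u" and v: "\<iota> z = cl v"
      using obt xz by metis
    have "u + v \<in> \<iota> (x + z)"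
      using \<iota>(1) xz mem [of u] mem [of v] by (auto simp: bimodule_hom_def u v intro!: set_plus_intro)
    then show "h (x + z) = h x + h z"
      using xz mem [of u] mem [of v] component_add [OF xz]
      by (simp add: h [of "u + v"] h [of u x] h [of v z] u v free_ext_add)
  next
    fix x a assume x: "x \<in> ?S"
    obtain u where u: "\<iota> x = cl u"
      using obt x by metis
    have "\<iota> (lact M a x) = cl (free_lact a u)" "\<iota> (ract M x a) = cl (free_ract u a)"
      using \<iota>(1) x
      by (simp_all add: bimodule_hom_def u cl_def free_lact_coset [OF ua] free_ract_coset [OF ua])
    then show "h (lact M a x) = lact M a (h x)" "h (ract M x a) = ract M (h x) a"
      using x mem component_lact [OF x] component_ract [OF x]
      by (simp_all add: h [of "free_lact a u"] h [of "free_ract u a"] h [of u x] u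
          free_ext_lact free_ext_ract)
  qed
  moreover have "h ` ?S \<subseteq> component M j"
    using y(1) by (auto simp: h_def intro: free_ext_component)
  moreover have "d (h x) = g x" if x: "x \<in> ?S" for x
  proof -
    have g_add: "g (x + z) = g x + g z" if "x \<in> ?S" "z \<in> ?S" for x z
      using g that by (simp add: bimodule_hom_def)
    have d_diff: "d (x - z) = d x - d z" for x z
    proof -
      have "d (x - z + z) = d (x - z) + d z"
        using d by (simp only: bimodule_hom_def) blast
      then show ?thesis
        by simp
    qed
    have gq: "g (q (cl (u - v))) = g (q (cl u)) - g (q (cl v))"
      if "cl u \<in> free_bimodule_carrier s X" "cl v \<in> free_bimodule_carrier s X"
        "cl (u - v) \<in> free_bimodule_carrier s X" for u v
    proof -
      have RR: "?R + ?R = ?R"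
        by (auto simp: set_plus_def intro: group_closure_add)
          (metis add_0 zero_in_group_closure)
      have "cl u = cl (u - v) + cl v"
        unfolding cl_def by (simp add: set_plus_rearrange RR)
      then have "q (cl u) = q (cl (u - v)) + q (cl v)"
        using q(1) that by (simp add: bimodule_hom_def)
      then show ?thesis
        using q_S [OF that(2)] q_S [OF that(3)] by (simp add: g_add)
    qed
    have "Poly_Mapping.keys u \<subseteq> UNIV \<times> X \<times> UNIV \<and> d (?H u) = g (q (cl u))"
      if "Poly_Mapping.keys u \<subseteq> UNIV \<times> X \<times> UNIV" for u
      using that
    proof (induction u rule: frag_induction)
      case zero
      have "cl 0 \<in> free_bimodule_carrier s X"
        by (intro cl_carrier) simp
      then show ?case
        using gq [of 0 0] d_diff [of 0 0] by (simp add: free_ext_def)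
    next
      case (one t)
      then obtain a x b where t: "t = (a, x, b)" "x \<in> X"
        by auto
      have car: "cl (frag_of (a, x, b)) \<in> free_bimodule_carrier s X" for a b
        using t by (intro cl_carrier) auto
      have 1: "q (cl (frag_of (a, x, 1))) = lact M a (q (cl (frag_of (1, x, 1))))"
      proof -
        have "lact ?F a (cl (frag_of (1, x, 1))) = cl (frag_of (a, x, 1))"
          by (simp add: cl_def free_lact_coset [OF ua])
        moreover have "q (lact ?F a (cl (frag_of (1, x, 1)))) = lact M a (q (cl (frag_of (1, x, 1))))"
          using q(1) car [of 1 1] unfolding bimodule_hom_def by blast
        ultimately show ?thesis
          by simp
      qed
      have 2: "q (cl (frag_of (a, x, b))) = ract M (q (cl (frag_of (a, x, 1)))) b"
      proof -
        have "ract ?F (cl (frag_of (a, x, 1))) b = cl (frag_of (a, x, b))"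
          by (simp add: cl_def free_ract_coset [OF ua])
        moreover have "q (ract ?F (cl (frag_of (a, x, 1))) b) = ract M (q (cl (frag_of (a, x, 1)))) b"
          using q(1) car [of a 1] unfolding bimodule_hom_def by blast
        ultimately show ?thesis
          by simp
      qed
      have "g (q (cl (frag_of (a, x, b)))) = ract M (lact M a (g (q (cl (frag_of (1, x, 1)))))) b"
        using g q_S [OF car [of 1 1]] by (simp add: 1 2 bimodule_hom_def component_lact)
      also have "\<dots> = d (?H (frag_of (a, x, b)))"
        using d by (simp add: bimodule_hom_def free_ext_of y(2) [OF t(2)])
      finally show ?case
        using t by simp
    next
      case (diff u v)
      then have "Poly_Mapping.keys (u - v) \<subseteq> UNIV \<times> X \<times> UNIV"
        using keys_diff [of u v] by blast
      with diff show ?case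
        by (simp add: gq cl_carrier free_ext_diff d_diff)
    qed
    moreover obtain u where u: "\<iota> x = cl u" "Poly_Mapping.keys u \<subseteq> UNIV \<times> X \<times> UNIV"
      using obt x by blast
    ultimately show ?thesis
      using h [of u x] mem [of u] x q\<iota> [OF x] by simp
  qed
  ultimately show thesis
    by (rule that)
qed

end


section \<open>The comparison lemma\<close>

text \<open>
  A shifted projective resolution in terms of its own grading: the complex lives in degrees \<open>\<le> 1\<close> and
  \<open>\<mu>\<close> is concentrated in degree \<open>1\<close>.
\<close>

locale bimodule_resolution = graded_bimod s M
  for s :: "'k::field \<Rightarrow> 'a::{ring,monoid_mult} \<Rightarrow> 'a" and M :: "('a, 'm::ab_group_add) gbimodule" +
  fixes d :: "'m \<Rightarrow> 'm" and \<mu> :: "'m \<Rightarrow> 'a"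
  assumes algebra: "unital_algebra s"
    and component_above: "i > 1 \<Longrightarrow> component M i = {0}"
    and projective: "projective_bimodule s M (component M i)"
    and d_graded: "graded_map 1 M M d"
    and d_d [simp]: "d (d x) = 0"
    and \<mu>_graded: "graded_map (- 1) M regular_bimodule \<mu>"
    and \<mu>_d [simp]: "\<mu> (d x) = 0"
    and exact: "i < 1 \<Longrightarrow> x \<in> component M i \<Longrightarrow> d x = 0 \<Longrightarrow> x \<in> d ` component M (i - 1)"
    and exact_top: "x \<in> component M 1 \<Longrightarrow> \<mu> x = 0 \<Longrightarrow> x \<in> d ` component M 0"
begin

lemma d_add: "d (x + y) = d x + d y"
  and d_component: "x \<in> component M i \<Longrightarrow> d x \<in> component M (i + 1)"
  using d_graded by (auto simp: graded_map_def bimodule_hom_def image_subset_iff)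

lemma d_0 [simp]: "d 0 = 0"
  using d_add [of 0 0] by simp

lemma d_diff: "d (x - y) = d x - d y"
  using d_add [of "x - y" y] by simp

lemma d_minus: "d (- x) = - d x"
  using d_diff [of 0 x] by simp

lemma d_signed: "d (signed k x) = signed k (d x)"
  by (simp add: signed_def d_minus)

text \<open>
  The homotopy is built downwards from degree \<open>1\<close>. On degree \<open>1 - k\<close> one lifts \<open>F - (-1)\<^sup>l h d\<close> along
  \<open>d\<close>, where \<open>h\<close> is the part of the homotopy on degree \<open>2 - k\<close>; this map has values in cycles, and
  cycles are boundaries. On degree \<open>1\<close> the map is \<open>F\<close> itself, whose values are boundaries by the
  assumption on \<open>\<mu> F\<close> if \<open>l = 0\<close>, and because they are cycles of degree at most \<open>0\<close> otherwise.
\<close>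

lemma null_homotopic:
  assumes F: "graded_map l M M F" and l: "l \<le> 0"
    and chain: "\<And>x. d (F x) = signed l (F (d x))"
    and top: "\<And>x. l = 0 \<Longrightarrow> \<mu> (F x) = 0"
  obtains h where "graded_map (l - 1) M M h" "\<And>x. F x = d (h x) + signed l (h (d x))"
proof -
  have F_add: "F (x + y) = F x + F y" and F_act: "F (lact M a x) = lact M a (F x)"
      "F (ract M x a) = ract M (F x) a"
    and F_comp: "x \<in> component M i \<Longrightarrow> F x \<in> component M (i + l)" for x y a i
    using F by (auto simp: graded_map_def bimodule_hom_def image_subset_iff)
  have F_0: "F 0 = 0"
    using F_add [of 0 0] by simp
  have d_act: "d (lact M a x) = lact M a (d x)" "d (ract M x a) = ract M (d x) a" for a x
    using d_graded by (auto simp: graded_map_def bimodule_hom_def)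
  have d_hom: "bimodule_hom UNIV M M d"
    using d_graded by (simp add: graded_map_def)
  define S where "S k = component M (1 - int k)" for k
  have d_S: "d x \<in> S k" if "x \<in> S (Suc k)" for x k
    using d_component [of x "- int k"] that by (simp add: S_def)
  define good where "good k h \<longleftrightarrow> bimodule_hom (S k) M M h \<and> h ` S k \<subseteq> component M (l - int k) \<and>
    (\<forall>y\<in>S (Suc k). d (h (d y)) = F (d y)) \<and> (k = 0 \<longrightarrow> (\<forall>x\<in>S k. d (h x) = F x))" for k h
  define next_good where "next_good k h h' \<longleftrightarrow>
    (\<forall>y\<in>S (Suc k). d (h' y) = F y - signed l (h (d y)))" for k h h'
  \<comment> \<open>The condition on \<open>d h d\<close> in \<open>good\<close> makes the next map to be lifted a cycle.\<close>
  have "\<exists>f. \<forall>k. good k (f k) \<and> next_good k (f k) (f (Suc k))"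
  proof (rule dependent_nat_choice)
    have hom: "bimodule_hom (component M 1) M M F"
      using F by (simp add: graded_map_def bimodule_hom_def)
    have img: "F x \<in> d ` component M l" if x: "x \<in> component M 1" for x
    proof (cases "l = 0")
      case True
      then show ?thesis
        using exact_top F_comp [OF x] top by simp
    next
      case False
      have "d x = 0"
        using d_component [OF x] component_above [of 2] by simp
      then have "d (F x) = 0"
        by (simp add: chain F_0)
      with False l show ?thesis
        using exact [of "1 + l" "F x"] F_comp [OF x] by simp
    qed
    obtain h where "bimodule_hom (component M 1) M M h" "h ` component M 1 \<subseteq> component M l"
      "\<And>x. x \<in> component M 1 \<Longrightarrow> d (h x) = F x"
      using projective_lift [OF algebra projective hom d_hom img] by blast
    then show "\<exists>h. good 0 h"
      using d_S [of _ 0] by (intro exI [of _ h]) (auto simp: good_def S_def)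
  next
    fix h k assume h: "good k h"
    define g where "g y = F y - signed l (h (d y))" for y
    have h_add: "h (x + y) = h x + h y" if "x \<in> S k" "y \<in> S k" for x y
      using h that by (simp add: good_def bimodule_hom_def)
    have h_act: "h (lact M a x) = lact M a (h x)" "h (ract M x a) = ract M (h x) a"
      and h_comp: "h x \<in> component M (l - int k)" if "x \<in> S k" for x a
      using h that by (auto simp: good_def bimodule_hom_def)
    have h_0: "h 0 = 0"
      using h_add [of 0 0] by (simp add: S_def)
    have hom: "bimodule_hom (component M (- int k)) M M g"
      unfolding bimodule_hom_def
    proof (intro conjI ballI allI)
      fix x y assume "x \<in> component M (- int k)" "y \<in> component M (- int k)"
      then have "d x \<in> S k" "d y \<in> S k"
        using d_S [of _ k] by (simp_all add: S_def)
      then show "g (x + y) = g x + g y"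
        by (simp add: g_def F_add d_add h_add signed_add)
    next
      fix x a assume "x \<in> component M (- int k)"
      then have "d x \<in> S k"
        using d_S [of _ k] by (simp add: S_def)
      then show "g (lact M a x) = lact M a (g x)" "g (ract M x a) = ract M (g x) a"
        by (simp_all add: g_def F_act d_act h_act signed_def lact_add ract_add lact_diff ract_diff
            lact_minus ract_minus)
    qed
    have img: "g y \<in> d ` component M (l - int (Suc k))" if y: "y \<in> component M (- int k)" for y
    proof -
      have "d y \<in> S k" and "d (h (d y)) = F (d y)"
        using y d_S [of y k] h by (simp_all add: S_def good_def)
      note dy = this
      have "d (g y) = 0"
        by (simp add: g_def d_diff d_signed dy chain)
      moreover have "g y \<in> component M (l - int k)"
        using h_comp [OF dy(1)] F_comp [OF y]
        by (auto simp: g_def signed_def component_diff component_add)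
      ultimately show ?thesis
        using exact [of "l - int k" "g y"] l by (simp add: algebra_simps)
    qed
    obtain h' where h': "bimodule_hom (component M (- int k)) M M h'"
      "h' ` component M (- int k) \<subseteq> component M (l - int (Suc k))"
      "\<And>x. x \<in> component M (- int k) \<Longrightarrow> d (h' x) = g x"
      using projective_lift [OF algebra projective hom d_hom img] by blast
    have "d (h' (d z)) = F (d z)" if "z \<in> S (Suc (Suc k))" for z
      using d_S [OF that] h'(3) [of "d z"] by (simp add: S_def g_def h_0)
    with h' show "\<exists>h'. good (Suc k) h' \<and> next_good k h h'"
      by (intro exI [of _ h']) (auto simp: good_def next_good_def S_def g_def)
  qed
  then obtain f where good: "\<And>k. good k (f k)" and chosen: "\<And>k. next_good k (f k) (f (Suc k))"
    by blast
  \<comment> \<open>The \<open>k\<close>-th function of the sequence is the homotopy on degree \<open>1 - k\<close>; all higher degrees vanish.\<close>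
  define H where "H i = (if i \<le> 1 then f (nat (1 - i)) else (\<lambda>_. 0))" for i :: int
  have H_hom: "bimodule_hom (component M i) M M (H i)" for i
    using good [of "nat (1 - i)"] by (auto simp: H_def good_def S_def) (simp add: bimodule_hom_def)
  define h where "h = glue H"
  have h_hom: "bimodule_hom UNIV M M h" and h_eq: "x \<in> component M i \<Longrightarrow> h x = H i x" for x i
    unfolding h_def using H_hom by (simp_all add: glue_hom [where N = M] lact_add ract_add)
  have h_add: "h (x + y) = h x + h y" for x y
    using h_hom by (simp add: bimodule_hom_def)
  have h_0: "h 0 = 0"
    using h_add [of 0 0] by simp
  have "h x \<in> component M (i + (l - 1))" if x: "x \<in> component M i" for i x
  proof (cases "i \<le> 1")
    case True
    then have "f (nat (1 - i)) x \<in> component M (l - (1 - i))"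
      using good [of "nat (1 - i)"] x by (auto simp: good_def S_def)
    with True show ?thesis
      by (simp add: h_eq [OF x] H_def algebra_simps)
  next
    case False
    then show ?thesis
      by (simp add: h_eq [OF x] H_def)
  qed
  with h_hom have "graded_map (l - 1) M M h"
    by (auto simp: graded_map_def)
  moreover have "F x = d (h x) + signed l (h (d x))" for x
  proof (rule additive_ext_components [where f = F and g = "\<lambda>x. d (h x) + signed l (h (d x))"])
    fix i x assume x: "x \<in> component M i"
    consider "i > 1" | "i = 1" | k where "i = - int k"
      using nonpos_int_cases [of i] by fastforce
    then show "F x = d (h x) + signed l (h (d x))"
    proof cases
      case 1
      then have "x = 0"
        using x component_above by blast
      then show ?thesis
        by (simp add: F_0 h_0)
    next
      case 2
      then have "d x = 0"
        using d_component [OF x] component_above [of 2] by simp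
      moreover have "d (h x) = F x"
        using good [of 0] x 2 by (simp add: h_eq [OF x] H_def good_def S_def)
      ultimately show ?thesis
        by (simp add: h_0)
    next
      case 3
      have "h (d x) = f k (d x)"
        using h_eq [OF d_component [OF x]] by (simp add: 3 H_def)
      moreover have "nat (1 + int k) = Suc k"
        by simp
      then have "d (h x) = F x - signed l (f k (d x))"
        using chosen [of k] x by (simp add: h_eq [OF x] 3 H_def next_good_def S_def)
      ultimately show ?thesis
        by simp
    qed
  qed (simp_all add: F_add h_add d_add signed_add)
  ultimately show thesis
    by (rule that)
qed

end

section \<open>Maps that are read off from contractions\<close>

definition additive_actions :: "('a, 'n::ab_group_add) gbimodule \<Rightarrow> bool" where
  "additive_actions N \<longleftrightarrow>
     (\<forall>a x y. lact N a (x - y) = lact N a x - lact N a y \<and> ract N (x - y) a = ract N x a - ract N y a) \<and>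
     (\<forall>i. 0 \<in> component N i \<and> (\<forall>x\<in>component N i. \<forall>y\<in>component N i. x - y \<in> component N i))"

lemma additive_actions_regular: "additive_actions regular_bimodule"
  by (simp add: additive_actions_def regular_bimodule_def algebra_simps)

lemma graded_map_add_eq: "graded_map l M N f \<Longrightarrow> f (x + y) = f x + f y"
  by (simp add: graded_map_def bimodule_hom_def)

lemma graded_map_0_eq: "graded_map l M N f \<Longrightarrow> f 0 = (0 :: 'n::ab_group_add)"
  for M :: "('a, 'm::ab_group_add) gbimodule"
  using graded_map_add_eq [of l M N f 0 0] by simp

lemma graded_map_minus_eq: "graded_map l M N f \<Longrightarrow> f (- x) = - (f x :: 'n::ab_group_add)"
  for M :: "('a, 'm::ab_group_add) gbimodule"
  using graded_map_add_eq [of l M N f x "- x"] graded_map_0_eq [of l M N f]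
  by (simp add: add_eq_0_iff2)

lemma graded_map_diff_eq: "graded_map l M N f \<Longrightarrow> f (x - y) = f x - (f y :: 'n::ab_group_add)"
  for M :: "('a, 'm::ab_group_add) gbimodule"
  using graded_map_add_eq [of l M N f "x - y" y] by simp

lemma graded_map_signed_eq: "graded_map l M N f \<Longrightarrow> f (signed k x) = signed k (f x :: 'n::ab_group_add)"
  for M :: "('a, 'm::ab_group_add) gbimodule"
  by (simp add: signed_def graded_map_minus_eq)

lemma graded_map_diff:
  "additive_actions N \<Longrightarrow> graded_map l M N f \<Longrightarrow> graded_map l M N g \<Longrightarrow>
   graded_map l M N (\<lambda>x. f x - g x)"
  by (auto simp: graded_map_def bimodule_hom_def additive_actions_def image_subset_iff)

lemma graded_map_zero: "additive_actions N \<Longrightarrow> graded_map l M N (\<lambda>_. 0)"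
proof -
  assume N: "additive_actions N"
  then have "lact N a (0 - 0) = lact N a 0 - lact N a 0" "ract N (0 - 0) a = ract N 0 a - ract N 0 a" for a
    unfolding additive_actions_def by blast+
  with N show ?thesis
    by (auto simp: graded_map_def bimodule_hom_def additive_actions_def)
qed

lemma graded_map_minus:
  "additive_actions N \<Longrightarrow> graded_map l M N f \<Longrightarrow> graded_map l M N (\<lambda>x. - f x)"
  using graded_map_diff [OF _ graded_map_zero, of N l M f] by simp

lemma graded_map_add:
  "additive_actions N \<Longrightarrow> graded_map l M N f \<Longrightarrow> graded_map l M N g \<Longrightarrow>
   graded_map l M N (\<lambda>x. f x + g x)"
  using graded_map_diff [OF _ _ graded_map_minus, of N l M f g] by simp

lemma graded_map_signed:
  "additive_actions N \<Longrightarrow> graded_map l M N f \<Longrightarrow> graded_map l M N (\<lambda>x. signed k (f x))"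
  by (cases "even k") (simp_all add: signed_def graded_map_minus)

lemma graded_map_comp:
  "graded_map k M N f \<Longrightarrow> graded_map l N Q g \<Longrightarrow> m = k + l \<Longrightarrow> graded_map m M Q (\<lambda>x. g (f x))"
  by (auto simp: graded_map_def bimodule_hom_def image_subset_iff simp flip: add.assoc)

lemma graded_map_id: "graded_map 0 M M (\<lambda>x. x)"
  by (simp add: graded_map_def bimodule_hom_def)

context graded_bimod
begin

lemma additive_actions_M: "additive_actions M"
  by (simp add: additive_actions_def lact_diff ract_diff component_diff)

lemma inv_pow_graded_map: "graded_map 0 M M (inv_pow k)"
  using inv_pow_hom
  by (auto simp: graded_map_def inv_pow_homogeneous signed_def component_minus)

definition alg_slot :: "('m \<Rightarrow> 'a) \<Rightarrow> 'm \<Rightarrow> 'a \<times> 'm" where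
  "alg_slot f x = (f x, 0)"

definition mod_slot :: "('m \<Rightarrow> 'm) \<Rightarrow> 'm \<Rightarrow> 'a \<times> 'm" where
  "mod_slot f x = (0, f x)"

lemma snd_alg_slot [simp]: "snd (alg_slot f x) = 0"
  by (simp add: alg_slot_def)

lemma homogeneous_alg_slot: "graded_map l M regular_bimodule f \<Longrightarrow> homogeneous_slot (alg_slot f) l"
  by (auto simp: homogeneous_slot_def C_slot_iff alg_slot_def square_zero_mult_def degree_part_def
      graded_map_def bimodule_hom_def regular_bimodule_def image_subset_iff split: if_splits)

lemma homogeneous_mod_slot: "graded_map l M M f \<Longrightarrow> homogeneous_slot (mod_slot f) l"
  by (auto simp: homogeneous_slot_def C_slot_iff mod_slot_def square_zero_mult_def degree_part_def
      graded_map_def bimodule_hom_def image_subset_iff)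

lemma slot_alg_slot: "graded_map l M regular_bimodule f \<Longrightarrow> C.slot (alg_slot f)"
  and slot_mod_slot: "graded_map l M M h \<Longrightarrow> C.slot (mod_slot h)"
  using homogeneous_alg_slot homogeneous_mod_slot by (auto simp: homogeneous_slot_def)

text \<open>
  A map of degree \<open>l\<close> into \<open>A\<close> vanishes outside degree \<open>- l\<close>, so the involution acts by a constant sign.
\<close>

lemma inv_pow_to_algebra:
  assumes "graded_map l M regular_bimodule f"
  shows "f (inv_pow k x) = signed (k * l) (f x)"
proof (rule additive_ext_components [where f = "\<lambda>x. f (inv_pow k x)" and g = "\<lambda>x. signed (k * l) (f x)"])
  fix i x assume x: "x \<in> component M i"
  have "f x = 0" if "i + l \<noteq> 0"
    using assms x that by (auto simp: graded_map_def regular_bimodule_def image_subset_iff split: if_splits)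
  moreover have "signed (k * i) (f x) = signed (k * l) (f x)" if "i + l = 0"
  proof -
    have "i = - l"
      using that by simp
    then show ?thesis
      by (simp add: signed_def)
  qed
  ultimately show "f (inv_pow k x) = signed (k * l) (f x)"
    by (cases "i + l = 0") (simp_all add: inv_pow_homogeneous [OF x] graded_map_signed_eq [OF assms])
qed (simp_all add: inv_pow_add graded_map_add_eq [OF assms] signed_add)

lemma graded_map_snd_eval:
  assumes "list_all2 homogeneous_slot gs ls" "graded_map e M (tensor_power M n) f" "l = e + sum_list ls"
  shows "graded_map l M M (\<lambda>x. snd (eval gs (f x)))"
proof -
  have slots: "\<forall>g\<in>set gs. C.slot g"
    using assms(1) by (induction rule: list_all2_induct) (auto simp: homogeneous_slot_def)
  have "C.slot (\<lambda>x. eval gs (f x))"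
    using slot_eval [OF bimodule_valued_graded_map [OF assms(2)] slots] .
  moreover have "snd (eval gs (f x)) \<in> component M (i + l)" if "x \<in> component M i" for x i
  proof -
    have "f x \<in> component (tensor_power M n) (i + e)"
      using assms(2) that by (auto simp: graded_map_def)
    from eval_degree [OF assms(1) this] show ?thesis
      by (simp add: degree_part_def assms(3) add.assoc)
  qed
  ultimately show ?thesis
    by (auto simp: graded_map_def bimodule_hom_def C_slot_iff square_zero_mult_def)
qed

lemma graded_map_fst_eval:
  assumes "list_all2 homogeneous_slot gs ls" "graded_map e M (tensor_power M n) f" "l = e + sum_list ls"
  shows "graded_map l M regular_bimodule (\<lambda>x. fst (eval gs (f x)))"
proof -
  have slots: "\<forall>g\<in>set gs. C.slot g"
    using assms(1) by (induction rule: list_all2_induct) (auto simp: homogeneous_slot_def)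
  have "C.slot (\<lambda>x. eval gs (f x))"
    using slot_eval [OF bimodule_valued_graded_map [OF assms(2)] slots] .
  moreover have "fst (eval gs (f x)) \<in> component regular_bimodule (i + l)" if "x \<in> component M i" for x i
  proof -
    have "f x \<in> component (tensor_power M n) (i + e)"
      using assms(2) that by (auto simp: graded_map_def)
    from eval_degree [OF assms(1) this] show ?thesis
      by (simp add: degree_part_def assms(3) add.assoc regular_bimodule_def)
  qed
  ultimately show ?thesis
    by (auto simp: graded_map_def bimodule_hom_def C_slot_iff square_zero_mult_def)
       (simp_all add: regular_bimodule_def)
qed

lemma eval_post_mod:
  assumes H: "graded_map l M M H" and "\<forall>g\<in>set (gs1 @ gs2). \<forall>x. snd (g x) = 0"
  shows "eval (gs1 @ mod_slot (\<lambda>x. H (k x)) # gs2) U = (0, H (snd (eval (gs1 @ mod_slot k # gs2) U)))"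
proof -
  have "mod_slot (\<lambda>x. H (k x)) = (\<lambda>x. (\<lambda>p. (0, H (snd p))) (mod_slot k x))"
    by (auto simp: mod_slot_def)
  moreover have "eval (gs1 @ (\<lambda>x. (\<lambda>p. (0, H (snd p))) (mod_slot k x)) # gs2) U
      = (\<lambda>p. (0, H (snd p))) (eval (gs1 @ mod_slot k # gs2) U)"
  proof (rule eval_post)
    show "\<forall>g\<in>set (gs1 @ gs2). \<forall>x. snd (g x) = 0"
      by (rule assms(2))
    show "(\<lambda>p. (0 :: 'a, H (snd p))) (p - q) = (\<lambda>p. (0, H (snd p))) p - (\<lambda>p. (0, H (snd p))) q"
      for p q :: "'a \<times> 'm"
      by (simp add: graded_map_diff_eq [OF H])
  qed (use H in \<open>auto simp: square_zero_mult_def graded_map_def bimodule_hom_def\<close>)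
  ultimately show ?thesis
    by simp
qed

lemma eval_post_alg:
  assumes f: "graded_map l M regular_bimodule f" and "\<forall>g\<in>set (gs1 @ gs2). \<forall>x. snd (g x) = 0"
  shows "eval (gs1 @ alg_slot (\<lambda>x. f (k x)) # gs2) U = (f (snd (eval (gs1 @ mod_slot k # gs2) U)), 0)"
proof -
  have "alg_slot (\<lambda>x. f (k x)) = (\<lambda>x. (\<lambda>p. (f (snd p), 0)) (mod_slot k x))"
    by (auto simp: mod_slot_def alg_slot_def)
  moreover have "eval (gs1 @ (\<lambda>x. (\<lambda>p. (f (snd p), 0)) (mod_slot k x)) # gs2) U
      = (\<lambda>p. (f (snd p), 0)) (eval (gs1 @ mod_slot k # gs2) U)"
  proof (rule eval_post)
    show "\<forall>g\<in>set (gs1 @ gs2). \<forall>x. snd (g x) = 0"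
      by (rule assms(2))
    show "(\<lambda>p. (f (snd p), 0 :: 'm)) (p - q) = (\<lambda>p. (f (snd p), 0)) p - (\<lambda>p. (f (snd p), 0)) q"
      for p q :: "'a \<times> 'm"
      by (simp add: graded_map_diff_eq [OF f])
  qed (use f in \<open>auto simp: square_zero_mult_def graded_map_def bimodule_hom_def regular_bimodule_def\<close>)
  ultimately show ?thesis
    by simp
qed

lemma eval_slot_signed: "eval (gs1 @ (\<lambda>x. signed k (g x)) # gs2) U = signed k (eval (gs1 @ g # gs2) U)"
  by (simp add: signed_def eval_slot_minus)


section \<open>Contracting the defining relations\<close>

lemma tensor_carrier_zero: "tensor_class M 0 \<in> tensor_carrier M n"
  unfolding tensor_carrier_def by (rule imageI) simp

lemma bimodule_valued_zero: "bimodule_valued (\<lambda>_. tensor_class M 0)"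
  by (auto simp: bimodule_valued_def tensor_class_add tensor_of_alg_def tensor_class_mult)

lemma tensor_insert_range:
  assumes "bimodule_valued f" "U \<in> tensor_carrier M (r + 1 + t)"
  shows "tensor_insert M r l f t U \<in> range (tensor_class M)"
  unfolding tensor_insert_def using assms
  by (subst tensor_map_eq) (auto simp: bimodule_valued_tensor_of_mod)

text \<open>
  The contraction with \<open>gs\<close> of the sum over all ways of inserting a component of \<open>\<beta>\<close> after a component
  of \<open>\<gamma>\<close>, in the form given by \<open>eval_tensor_insert\<close>. Both sides of the defining relations of coalgebras
  and coderivations have this shape.
\<close>

definition insertion :: "int \<Rightarrow> (nat \<Rightarrow> 'm \<Rightarrow> ('a, 'm) words set) \<Rightarrow>
    (nat \<Rightarrow> 'm \<Rightarrow> ('a, 'm) words set) \<Rightarrow> ('m \<Rightarrow> 'a \<times> 'm) list \<Rightarrow> 'm \<Rightarrow> 'a \<times> 'm" where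
  "insertion l \<beta> \<gamma> gs x = (\<Sum>r\<le>length gs. \<Sum>k\<le>length gs - r.
     eval (map (\<lambda>g x. g (inv_pow l x)) (take r gs) @
       (\<lambda>y. eval (take k (drop r gs)) (\<beta> k y)) # drop (r + k) gs) (\<gamma> (length gs - k + 1) x))"

lemma eval_insertion:
  assumes \<beta>: "\<And>k. bimodule_valued (\<beta> k)" "\<And>k y. \<beta> k y \<in> tensor_carrier M k"
    and \<gamma>: "\<And>k. \<gamma> (Suc k) x \<in> tensor_carrier M (Suc k)"
    and gs: "\<forall>g\<in>set gs. C.slot g" and N: "N = length gs"
  shows "eval gs (\<Sum>(r, k, t)\<in>{(r, k, t). r + k + t = N}.
      tensor_insert M r l (\<beta> k) t (\<gamma> (N - k + 1) x)) = insertion l \<beta> \<gamma> gs x"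
    and "(\<Sum>(r, k, t)\<in>{(r, k, t). r + k + t = N}.
      tensor_insert M r l (\<beta> k) t (\<gamma> (N - k + 1) x)) \<in> range (tensor_class M)"
proof -
  define T where "T = {(r, k, t). r + k + t = N}"
  define F where "F p = (case p of (r, k, t) \<Rightarrow> tensor_insert M r l (\<beta> k) t (\<gamma> (N - k + 1) x))" for p
  have bij: "T = (\<lambda>(r, k). (r, k, N - r - k)) ` (SIGMA r:{..N}. {..N - r})"
    by (auto simp: T_def image_iff)
  then have fin: "finite T"
    by simp
  have "(0, 0, N) \<in> T"
    by (simp add: T_def)
  then have ne: "T \<noteq> {}"
    by blast
  have carrier: "\<gamma> (N - k + 1) x \<in> tensor_carrier M (r + 1 + t)" if "(r, k, t) \<in> T" for r k t
  proof -
    have "N - k = r + t"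
      using that by (auto simp: T_def)
    then show ?thesis
      using \<gamma> [of "r + t"] by simp
  qed
  have rng: "F p \<in> range (tensor_class M)" if "p \<in> T" for p
  proof -
    obtain r k t where p: "p = (r, k, t)"
      by (cases p)
    show ?thesis
      using tensor_insert_range [OF \<beta>(1) carrier] that unfolding p F_def by simp
  qed
  then obtain u where u: "\<And>p. p \<in> T \<Longrightarrow> F p = tensor_class M (u p)"
    unfolding image_iff by metis
  have sum: "(\<Sum>p\<in>T. F p) = tensor_class M (\<Sum>p\<in>T. u p)"
    using u fin ne by (simp add: sum_tensor_class cong: sum.cong)
  then show "(\<Sum>(r, k, t)\<in>{(r, k, t). r + k + t = N}.
      tensor_insert M r l (\<beta> k) t (\<gamma> (N - k + 1) x)) \<in> range (tensor_class M)"
    unfolding T_def F_def by simp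
  have "C.contract gs (\<Sum>p\<in>S. u p) = (\<Sum>p\<in>S. C.contract gs (u p))" if "finite S" for S
    using that by induction (simp_all add: C.contract_add)
  then have "eval gs (\<Sum>p\<in>T. F p) = (\<Sum>p\<in>T. eval gs (F p))"
    unfolding sum using fin u by (simp add: eval_class [OF gs] cong: sum.cong)
  also have "\<dots> = (\<Sum>(r, k)\<in>(SIGMA r:{..N}. {..N - r}). eval gs (F (r, k, N - r - k)))"
    unfolding bij by (subst sum.reindex) (auto simp: inj_on_def case_prod_unfold)
  also have "\<dots> = (\<Sum>r\<le>N. \<Sum>k\<le>N - r. eval gs (F (r, k, N - r - k)))"
    by (simp add: sum.Sigma)
  also have "\<dots> = insertion l \<beta> \<gamma> gs x"
    unfolding insertion_def N [symmetric]
  proof (intro sum.cong refl)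
    fix r k assume rk: "r \<in> {..N}" "k \<in> {..N - r}"
    let ?g1 = "take r gs" and ?g2 = "take k (drop r gs)" and ?g3 = "drop (r + k) gs"
    have split: "gs = ?g1 @ ?g2 @ ?g3"
      by (metis append_take_drop_id drop_drop add.commute)
    have len: "length ?g1 = r" "length ?g2 = k" "length ?g3 = N - r - k"
      using rk N by auto
    have "(r, k, N - r - k) \<in> T"
      using rk by (auto simp: T_def)
    from carrier [OF this] have U: "\<gamma> (N - k + 1) x \<in> tensor_carrier M (length ?g1 + 1 + length ?g3)"
      by (simp only: len)
    have "\<forall>g\<in>set (?g1 @ ?g2 @ ?g3). C.slot g"
      using gs split by metis
    from eval_tensor_insert [OF \<beta>(1) _ this U, of k l] \<beta>(2) len
    have "eval (?g1 @ ?g2 @ ?g3) (F (r, k, N - r - k)) =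
      eval (map (\<lambda>g x. g (inv_pow l x)) ?g1 @ (\<lambda>y. eval ?g2 (\<beta> k y)) # ?g3) (\<gamma> (N - k + 1) x)"
      by (simp add: F_def)
    with split show "eval gs (F (r, k, N - r - k)) =
      eval (map (\<lambda>g x. g (inv_pow l x)) ?g1 @ (\<lambda>y. eval ?g2 (\<beta> k y)) # ?g3) (\<gamma> (N - k + 1) x)"
      by simp
  qed
  finally show "eval gs (\<Sum>(r, k, t)\<in>{(r, k, t). r + k + t = N}.
      tensor_insert M r l (\<beta> k) t (\<gamma> (N - k + 1) x)) = insertion l \<beta> \<gamma> gs x"
    unfolding T_def F_def .
qed

lemma insertion_0: "insertion l \<beta> \<gamma> [] x = eval [\<lambda>y. eval [] (\<beta> 0 y)] (\<gamma> 1 x)"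
  by (simp add: insertion_def)

lemma insertion_1: "insertion l \<beta> \<gamma> [g] x =
    eval [\<lambda>y. eval [] (\<beta> 0 y), g] (\<gamma> 2 x) + eval [\<lambda>y. eval [g] (\<beta> 1 y)] (\<gamma> 1 x)
    + eval [\<lambda>x. g (inv_pow l x), \<lambda>y. eval [] (\<beta> 0 y)] (\<gamma> 2 x)"
  by (simp add: insertion_def numeral_2_eq_2)

lemma insertion_2: "insertion l \<beta> \<gamma> [g, h] x =
    eval [\<lambda>y. eval [] (\<beta> 0 y), g, h] (\<gamma> 3 x) + eval [\<lambda>y. eval [g] (\<beta> 1 y), h] (\<gamma> 2 x)
    + eval [\<lambda>y. eval [g, h] (\<beta> 2 y)] (\<gamma> 1 x)
    + eval [\<lambda>x. g (inv_pow l x), \<lambda>y. eval [] (\<beta> 0 y), h] (\<gamma> 3 x)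
    + eval [\<lambda>x. g (inv_pow l x), \<lambda>y. eval [h] (\<beta> 1 y)] (\<gamma> 2 x)
    + eval [\<lambda>x. g (inv_pow l x), \<lambda>x. h (inv_pow l x), \<lambda>y. eval [] (\<beta> 0 y)] (\<gamma> 3 x)"
  by (simp add: insertion_def numeral_2_eq_2 numeral_3_eq_3 add.assoc)

text \<open>Three slots only occur for the coalgebra itself, whose component in arity \<open>0\<close> vanishes.\<close>

lemma insertion_3:
  assumes "\<And>y. eval [] (\<beta> 0 y) = 0"
  shows "insertion l \<beta> \<gamma> [g, h, k] x =
    eval [\<lambda>y. eval [g] (\<beta> 1 y), h, k] (\<gamma> 3 x) + eval [\<lambda>y. eval [g, h] (\<beta> 2 y), k] (\<gamma> 2 x)
    + eval [\<lambda>y. eval [g, h, k] (\<beta> 3 y)] (\<gamma> 1 x)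
    + eval [\<lambda>x. g (inv_pow l x), \<lambda>y. eval [h] (\<beta> 1 y), k] (\<gamma> 3 x)
    + eval [\<lambda>x. g (inv_pow l x), \<lambda>y. eval [h, k] (\<beta> 2 y)] (\<gamma> 2 x)
    + eval [\<lambda>x. g (inv_pow l x), \<lambda>x. h (inv_pow l x), \<lambda>y. eval [k] (\<beta> 1 y)] (\<gamma> 3 x)"
  using eval_slot_zero [of "[]"] eval_slot_zero [of "[f]" for f] eval_slot_zero [of "[f, f']" for f f']
     eval_slot_zero [of "[f, f', f'']" for f f' f'']
  by (simp add: insertion_def numeral_2_eq_2 numeral_3_eq_3 add.assoc assms)

lemma word_class:
  "letters w = 0 \<Longrightarrow> \<exists>a. tensor_class M (frag_of w) = tensor_of_alg M a"
  "letters w = 1 \<Longrightarrow> \<exists>x. tensor_class M (frag_of w) = tensor_of_mod M x"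
proof (induction w rule: letters.induct)
  case 1
  {
    case 1
    have "tensor_class M (frag_of []) = tensor_of_alg M 1"
      unfolding tensor_of_alg_def by (rule tensor_class_eqI) (rule relator_alg_one)
    then show ?case
      by blast
  }
  {
    case 2
    then show ?case
      by simp
  }
next
  case (2 a w)
  have *: "tensor_class M (frag_of (Inl a # w)) = tensor_mult M (tensor_of_alg M a) (tensor_class M (frag_of w))"
    by (simp add: tensor_of_alg_def tensor_class_mult flip: frag_of_append)
  {
    case 1
    then obtain b where b: "tensor_class M (frag_of w) = tensor_of_alg M b"
      using 2 by auto
    have "tensor_mult M (tensor_of_alg M a) (tensor_of_alg M b) = tensor_of_alg M (a * b)"
      using relator_alg_mult by (simp add: tensor_of_alg_def tensor_class_mult tensor_class_eq_iff flip: frag_of_append)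
    then show ?case
      by (auto simp: * b)
  }
  {
    case 2
    then obtain x where x: "tensor_class M (frag_of w) = tensor_of_mod M x"
      using "2.IH" by auto
    have "tensor_mult M (tensor_of_alg M a) (tensor_of_mod M x) = tensor_of_mod M (lact M a x)"
      using bimodule_valued_tensor_of_mod by (simp add: bimodule_valued_def)
    then show ?case
      by (auto simp: * x)
  }
next
  case (3 x w)
  {
    case 1
    then show ?case
      by simp
  }
  {
    case 2
    then obtain b where b: "tensor_class M (frag_of w) = tensor_of_alg M b"
      using 3 by auto
    have "tensor_mult M (tensor_of_mod M x) (tensor_of_alg M b) = tensor_of_mod M (ract M x b)"
      using bimodule_valued_tensor_of_mod by (simp add: bimodule_valued_def)
    moreover have "tensor_class M (frag_of (Inr x # w)) = tensor_mult M (tensor_of_mod M x) (tensor_class M (frag_of w))"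
      by (simp add: tensor_of_mod_def tensor_class_mult flip: frag_of_append)
    ultimately show ?case
      by (auto simp: b)
  }
qed

lemma tensor_carrier_diff:
  "tensor_class M u \<in> tensor_carrier M n \<Longrightarrow> tensor_class M v \<in> tensor_carrier M n \<Longrightarrow>
   tensor_class M (u - v) \<in> tensor_carrier M n"
proof -
  assume "tensor_class M u \<in> tensor_carrier M n" "tensor_class M v \<in> tensor_carrier M n"
  then obtain u' v' where uv: "u' \<in> group_closure {frag_of (Inl a # map Inr xs) | a xs. length xs = n}"
    "v' \<in> group_closure {frag_of (Inl a # map Inr xs) | a xs. length xs = n}"
    "u - u' \<in> tensor_ideal M" "v - v' \<in> tensor_ideal M"
    unfolding tensor_carrier_def image_iff tensor_class_eq_iff by blast
  have "(u - v) - (u' - v') = (u - u') - (v - v')"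
    by simp
  then have "tensor_class M (u - v) = tensor_class M (u' - v')"
    using tensor_ideal_diff [OF uv(3,4)] by (simp only: tensor_class_eq_iff)
  then show ?thesis
    unfolding tensor_carrier_def using group_closure.diff [OF uv(1,2)] by blast
qed

lemma word_span_carrier: "u \<in> word_span 1 \<Longrightarrow> tensor_class M u \<in> tensor_carrier M 1"
  unfolding word_span_def
proof (induction rule: group_closure.induct)
  case (base u)
  then consider "u \<in> tensor_ideal M" | w where "u = frag_of w" "letters w = 1"
    by auto
  then show ?case
  proof cases
    case 1
    then have "tensor_class M u = tensor_class M 0"
      by (simp add: tensor_class_eq_iff)
    then show ?thesis
      by (simp add: tensor_carrier_zero)
  next
    case 2
    then show ?thesis
      using word_class(2) [of w] tensor_of_mod_carrier by auto
  qed
next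
  case (diff u v)
  then show ?case
    by (intro tensor_carrier_diff)
qed

lemma word_eval_word_span:
  "list_all2 (\<lambda>h k. \<forall>x. h x \<in> word_span k) hs ks \<Longrightarrow> W.word_eval w hs \<in> word_span (sum_list ks)"
proof (induction w arbitrary: hs ks rule: letters.induct)
  case 1
  have "1 \<in> word_span 0"
    using word_span_word [of "[]" 0] by (simp add: one_words)
  with 1 show ?case
    by auto
next
  case (2 a w)
  from word_span_mult [OF word_span_word "2.IH" [OF "2.prems"], of "[Inl a]" 0] show ?case
    by simp
next
  case (3 x w)
  show ?case
  proof (cases hs)
    case (Cons h hs')
    then obtain k ks' where "ks = k # ks'" "h x \<in> word_span k" "list_all2 (\<lambda>h k. \<forall>x. h x \<in> word_span k) hs' ks'"
      using 3 by (auto simp: list_all2_Cons1)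
    with Cons 3 show ?thesis
      by (simp add: word_span_mult)
  qed simp
qed

text \<open>
  Both summands have exactly one letter from the bimodule left and hence represent elements of it, which
  the square-zero extension recovers.
\<close>

lemma commutator_eq:
  assumes f: "graded_map l M regular_bimodule f" and D: "graded_map e M (tensor_power M 2) D"
  shows "tensor_commutator M D l f x = tensor_of_mod M
    (snd (eval [alg_slot f, mod_slot (\<lambda>x. x)] (D x)) + snd (eval [mod_slot (inv_pow l), alg_slot f] (D x)))"
proof -
  let ?F = "tensor_of_alg M \<circ> f"
  have F: "bimodule_valued ?F" "?F x \<in> tensor_carrier M 0" for x
    using f by (simp_all add: bimodule_valued_tensor_of_alg tensor_of_alg_carrier)
  have U: "D x \<in> tensor_carrier M (Suc (Suc 0))"
    using graded_map_carrier [OF D] by (simp add: numeral_2_eq_2)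
  have P: "C.slot (Pair 0)"
    using slot_mod_slot [OF graded_map_id] by (simp add: mod_slot_def [abs_def])
  have car: "tensor_map M fs (D x) \<in> tensor_carrier M 1"
    if "list_all2 (\<lambda>f k. bimodule_valued (fst f) \<and> (\<forall>x. fst f x \<in> tensor_carrier M k)) fs ks"
      "sum_list ks = 1" "length fs = 2" for fs ks
  proof -
    have bv: "\<forall>f\<in>fst ` set fs. bimodule_valued f"
      using that(1) by (induction rule: list_all2_induct) auto
    have "list_all2 (\<lambda>h k. \<forall>x. h x \<in> word_span k) (reps (twist fs)) ks"
      using that(1)
    proof (induction rule: list_all2_induct)
      case (Cons f fs k ks)
      then show ?case
        by (cases f) (auto intro: representative_word_span)
    qed simp
    from word_eval_word_span [OF this] that(2) have w: "W.word_eval w (reps (twist fs)) \<in> word_span 1" for w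
      by simp
    have "W.contract (reps (twist fs)) u \<in> word_span 1" for u
      by (induction u rule: frag_induction [OF subset_UNIV]) (simp_all add: w [simplified] W.contract_diff word_span_diff)
    then have "tensor_class M (W.contract (reps (twist fs)) (representative M (D x))) \<in> tensor_carrier M 1"
      by (intro word_span_carrier)
    moreover have "fs \<noteq> []" "D x \<in> tensor_carrier M (length fs)"
      using that(3) graded_map_carrier [OF D] by auto
    ultimately show ?thesis
      using tensor_map_eq [OF _ bv] by simp
  qed
  have 1: "tensor_map M [(?F, l), (tensor_of_mod M, 0)] (D x) \<in> tensor_carrier M 1"
    using F by (intro car [of _ "[0, 1]"]) (simp_all add: bimodule_valued_tensor_of_mod tensor_of_mod_carrier [simplified])
  have 2: "tensor_map M [(tensor_of_mod M, 0), (?F, l)] (D x) \<in> tensor_carrier M 1"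
    using F by (intro car [of _ "[1, 0]"]) (simp_all add: bimodule_valued_tensor_of_mod tensor_of_mod_carrier [simplified])
  have slot1: "(\<lambda>x. eval [] (?F x)) = alg_slot f"
    by (auto simp: eval_tensor_of_alg alg_slot_def)
  have "eval [Pair 0] (tensor_map M [(?F, l), (tensor_of_mod M, 0)] (D x)) =
      eval [alg_slot f, mod_slot (\<lambda>x. x)] (D x)"
    using eval_tensor_insert [where ?gs1.0 = "[]" and ?gs2.0 = "[]" and ?gs3.0 = "[Pair 0]" and f = ?F and l = l, of "D x"]
      F P U slot1 by (simp add: tensor_insert_def mod_slot_def [abs_def])
  moreover have "eval [Pair 0] (tensor_map M [(tensor_of_mod M, 0), (?F, l)] (D x)) =
      eval [mod_slot (inv_pow l), alg_slot f] (D x)"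
    using eval_tensor_insert [where ?gs1.0 = "[Pair 0]" and ?gs2.0 = "[]" and ?gs3.0 = "[]" and f = ?F and l = l, of "D x"]
      F P U slot1 by (simp add: tensor_insert_def mod_slot_def [abs_def])
  moreover have "eval [Pair 0] (tensor_commutator M D l f x) =
      eval [Pair 0] (tensor_map M [(?F, l), (tensor_of_mod M, 0)] (D x)) +
      eval [Pair 0] (tensor_map M [(tensor_of_mod M, 0), (?F, l)] (D x))"
    unfolding tensor_commutator_def using 1 2 P by (intro eval_add) (auto intro: tensor_carrier_range)
  moreover have "tensor_commutator M D l f x \<in> tensor_carrier M 1"
    unfolding tensor_commutator_def using 1 2 by (rule tensor_carrier_add)
  ultimately show ?thesis
    using tensor_of_mod_eval [of "tensor_commutator M D l f x"] by simp
qed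

end

section \<open>The homotopy calculus of a weakly counital resolution\<close>

context graded_bimod
begin

lemma eval_zero_slots:
  "eval [\<lambda>_. 0] U = 0" "eval [\<lambda>_. 0, g] U = 0" "eval [g, \<lambda>_. 0] U = 0"
  "eval [\<lambda>_. 0, g, h] U = 0" "eval [g, \<lambda>_. 0, h] U = 0" "eval [g, h, \<lambda>_. 0] U = 0"
  using eval_slot_zero [of "[]"] eval_slot_zero [of "[g]"] eval_slot_zero [of "[g, h]"] by auto

lemma eval_signed_slots:
  "eval [\<lambda>x. signed k (g x), h] U = signed k (eval [g, h] U)"
  "eval [g, \<lambda>x. signed k (h x)] U = signed k (eval [g, h] U)"
  "eval [\<lambda>x. signed k (g x), h, h'] U = signed k (eval [g, h, h'] U)"
  "eval [g, \<lambda>x. signed k (h x), h'] U = signed k (eval [g, h, h'] U)"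
  "eval [g, h, \<lambda>x. signed k (h' x)] U = signed k (eval [g, h, h'] U)"
  using eval_slot_signed [of "[]" k g "[h]"] eval_slot_signed [of "[g]" k h "[]"]
    eval_slot_signed [of "[]" k g "[h, h']"] eval_slot_signed [of "[g]" k h "[h']"]
    eval_slot_signed [of "[g, h]" k h' "[]"] by simp_all

lemma alg_slot_inv_pow:
  "graded_map l M regular_bimodule f \<Longrightarrow>
   (\<lambda>x. alg_slot f (inv_pow k x)) = (\<lambda>x. signed (k * l) (alg_slot f x))"
  by (rule ext) (simp add: alg_slot_def inv_pow_to_algebra signed_def)

lemma alg_slot_signed: "alg_slot (\<lambda>x. signed k (f x)) = (\<lambda>x. signed k (alg_slot f x))"
  by (rule ext) (simp add: alg_slot_def signed_def)

lemma signed_pair: "signed k (a, x) = (signed k a, signed k (x :: 'm))" for a :: 'a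
  by (simp add: signed_def)

end

locale counital_resolution = bimodule_resolution s M d \<mu>
  for s :: "'k::field \<Rightarrow> 'a::{ring,monoid_mult} \<Rightarrow> 'a" and M :: "('a, 'm::ab_group_add) gbimodule"
    and d :: "'m \<Rightarrow> 'm" and \<mu> :: "'m \<Rightarrow> 'a" +
  fixes \<delta> :: "nat \<Rightarrow> 'm \<Rightarrow> ('a, 'm) words set"
  assumes coalgebra: "A_infinity_coalgebra s M \<delta>"
    and delta_1: "\<delta> 1 = tensor_of_mod M \<circ> d"
    and counit: "weak_counit M \<delta> \<mu>"
begin

lemma delta_0: "\<delta> 0 x = tensor_class M 0"
  and delta_graded: "n \<ge> 1 \<Longrightarrow> graded_map 1 M (tensor_power M n) (\<delta> n)"
  using coalgebra by (simp_all add: A_infinity_coalgebra_def)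

lemma delta_carrier: "\<delta> n x \<in> tensor_carrier M n"
  using graded_map_carrier [OF delta_graded, of n x] tensor_carrier_zero
  by (cases n) (simp_all add: delta_0)

lemma delta_bimodule_valued: "bimodule_valued (\<delta> n)"
proof (cases n)
  case 0
  then have "\<delta> n = (\<lambda>_. tensor_class M 0)"
    by (simp add: delta_0 fun_eq_iff)
  then show ?thesis
    by (simp add: bimodule_valued_zero)
next
  case (Suc k)
  then show ?thesis
    using bimodule_valued_graded_map [OF delta_graded, of n] by simp
qed

lemma insertion_delta: "\<forall>g\<in>set gs. C.slot g \<Longrightarrow> insertion 1 \<delta> \<delta> gs x = 0"
proof -
  assume gs: "\<forall>g\<in>set gs. C.slot g"
  have "(\<Sum>(r, k, t)\<in>{(r, k, t). r + k + t = length gs}.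
      tensor_insert M r 1 (\<delta> k) t (\<delta> (length gs - k + 1) x)) = tensor_class M 0"
    using coalgebra unfolding A_infinity_coalgebra_def by blast
  then show ?thesis
    using eval_insertion(1) [of \<delta> \<delta> x gs "length gs" 1] gs
    by (simp add: delta_bimodule_valued delta_carrier eval_zero)
qed

lemma eval_delta_0: "(\<lambda>y. eval [] (\<delta> 0 y)) = (\<lambda>_. 0)"
  by (simp add: delta_0 eval_zero)

lemma eval_delta_1: "C.slot g \<Longrightarrow> eval [g] (\<delta> (Suc 0) y) = g (d y)"
  using delta_1 by (simp add: eval_tensor_of_mod)

lemma alg_slot_d: "graded_map l M regular_bimodule f \<Longrightarrow> (\<And>x. f (d x) = 0) \<Longrightarrow>
    (\<lambda>y. alg_slot f (d y)) = (\<lambda>_. 0)"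
  by (simp add: alg_slot_def fun_eq_iff prod_eq_iff)

lemmas slot_\<mu> = slot_alg_slot [OF \<mu>_graded]
lemmas hom_\<mu> = homogeneous_alg_slot [OF \<mu>_graded]
lemmas slot_id = slot_mod_slot [OF graded_map_id]

lemma \<mu>_slot_inv_pow: "(\<lambda>x. alg_slot \<mu> (inv_pow k x)) = (\<lambda>x. signed k (alg_slot \<mu> x))"
  by (simp add: alg_slot_inv_pow [OF \<mu>_graded]) (simp add: signed_def)

lemma \<mu>_inv_pow: "\<mu> (inv_pow k x) = signed k (\<mu> x)"
  by (simp add: inv_pow_to_algebra [OF \<mu>_graded]) (simp add: signed_def)

lemma \<mu>_slot_d: "(\<lambda>y. alg_slot \<mu> (d y)) = (\<lambda>_. 0)"
  by (rule alg_slot_d [OF \<mu>_graded]) simp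

text \<open>The sign is the Koszul sign of \<open>\<mu> \<otimes> \<mu>\<close>, since \<open>\<mu>\<close> only sees letters of degree \<open>1\<close>.\<close>

lemma eval_counit: "eval [alg_slot \<mu>, alg_slot \<mu>] (\<delta> 2 x) = (- \<mu> x, 0)"
proof -
  let ?f = "tensor_of_alg M \<circ> \<mu>"
  have f: "contractible ?f []"
    by (simp add: contractible_def bimodule_valued_tensor_of_alg [OF \<mu>_graded] tensor_of_alg_carrier)
  have e: "eval [] (?f y) = alg_slot \<mu> y" for y
    by (simp add: eval_tensor_of_alg alg_slot_def)
  have "(\<mu> x, 0) = eval (concat [[], []]) (tensor_map M [(?f, -1), (?f, -1)] (\<delta> 2 x))"
    using counit by (simp add: weak_counit_def numeral_2_eq_2 eval_tensor_of_alg)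
  also have "\<dots> = eval [\<lambda>x. alg_slot \<mu> (inv_pow (- 1) x), \<lambda>x. alg_slot \<mu> (inv_pow 0 x)] (\<delta> 2 x)"
    using delta_carrier [of 2 x] f by (subst eval_tensor_map) (simp_all add: numeral_2_eq_2 e [unfolded comp_def])
  also have "\<dots> = - eval [alg_slot \<mu>, alg_slot \<mu>] (\<delta> 2 x)"
    by (simp add: \<mu>_slot_inv_pow eval_signed_slots) (simp add: signed_def)
  finally show ?thesis
    by (simp add: prod_eq_iff)
qed

text \<open>
  The maps \<open>(\<mu> \<otimes> 1) \<delta>\<^sub>2\<close> and \<open>(1 \<otimes> \<mu>) \<delta>\<^sub>2\<close>, where \<open>\<mu>\<close> has odd degree and acts with a sign on the letter
  that it passes.
\<close>

definition left :: "'m \<Rightarrow> 'm" where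
  "left x = snd (eval [alg_slot \<mu>, mod_slot (\<lambda>x. x)] (\<delta> 2 x))"

definition right :: "'m \<Rightarrow> 'm" where
  "right x = snd (eval [mod_slot (inv_pow 1), alg_slot \<mu>] (\<delta> 2 x))"

text \<open>
  Up to sign these are \<open>\<mu> \<otimes> \<mu> \<otimes> 1\<close>, \<open>\<mu> \<otimes> 1 \<otimes> \<mu>\<close> and \<open>1 \<otimes> \<mu> \<otimes> \<mu>\<close> after \<open>\<delta>\<^sub>3\<close>. They measure how far \<open>L\<close>
  and \<open>R\<close> are from \<open>L\<^sup>2 = - L\<close>, \<open>L R = R L\<close> and \<open>R\<^sup>2 = R\<close>.
\<close>

definition "X\<^sub>1 x = snd (eval [alg_slot \<mu>, alg_slot \<mu>, mod_slot (\<lambda>x. x)] (\<delta> 3 x))"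
definition "X\<^sub>2 x = snd (eval [alg_slot \<mu>, mod_slot (inv_pow 1), alg_slot \<mu>] (\<delta> 3 x))"
definition "X\<^sub>3 x = snd (eval [mod_slot (\<lambda>x. x), alg_slot \<mu>, alg_slot \<mu>] (\<delta> 3 x))"

lemma left_graded: "graded_map 0 M M left"
  unfolding left_def
  by (rule graded_map_snd_eval [where ls = "[-1, 0]" and e = 1 and n = 2])
     (simp_all add: hom_\<mu> homogeneous_mod_slot graded_map_id delta_graded)

lemma right_graded: "graded_map 0 M M right"
  unfolding right_def
  by (rule graded_map_snd_eval [where ls = "[0, -1]" and e = 1 and n = 2])
     (simp_all add: hom_\<mu> homogeneous_mod_slot inv_pow_graded_map delta_graded)

lemma X_graded: "graded_map (- 1) M M X\<^sub>1" "graded_map (- 1) M M X\<^sub>2" "graded_map (- 1) M M X\<^sub>3"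
  unfolding X\<^sub>1_def X\<^sub>2_def X\<^sub>3_def
  by (rule graded_map_snd_eval [where ls = "[-1, -1, 0]" and e = 1 and n = 3]
        graded_map_snd_eval [where ls = "[-1, 0, -1]" and e = 1 and n = 3]
        graded_map_snd_eval [where ls = "[0, -1, -1]" and e = 1 and n = 3],
      simp_all add: hom_\<mu> homogeneous_mod_slot graded_map_id inv_pow_graded_map delta_graded)+

context
  fixes H :: "'m \<Rightarrow> 'm" and l :: int
  assumes H: "graded_map l M M H"
begin

lemma eval_mod_slots:
  "eval [alg_slot \<mu>, mod_slot H] (\<delta> 2 x) = (0, H (left x))"
  "eval [mod_slot (\<lambda>x. H (inv_pow 1 x)), alg_slot \<mu>] (\<delta> 2 x) = (0, H (right x))"
  "eval [alg_slot \<mu>, alg_slot \<mu>, mod_slot H] (\<delta> 3 x) = (0, H (X\<^sub>1 x))"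
  "eval [alg_slot \<mu>, mod_slot (\<lambda>x. H (inv_pow 1 x)), alg_slot \<mu>] (\<delta> 3 x) = (0, H (X\<^sub>2 x))"
  "eval [mod_slot H, alg_slot \<mu>, alg_slot \<mu>] (\<delta> 3 x) = (0, H (X\<^sub>3 x))"
  using eval_post_mod [OF H, of "[alg_slot \<mu>]" "[]" "\<lambda>x. x"]
    eval_post_mod [OF H, of "[]" "[alg_slot \<mu>]" "inv_pow 1"]
    eval_post_mod [OF H, of "[alg_slot \<mu>, alg_slot \<mu>]" "[]" "\<lambda>x. x"]
    eval_post_mod [OF H, of "[alg_slot \<mu>]" "[alg_slot \<mu>]" "inv_pow 1"]
    eval_post_mod [OF H, of "[]" "[alg_slot \<mu>, alg_slot \<mu>]" "\<lambda>x. x"]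
  by (auto simp: left_def right_def X\<^sub>1_def X\<^sub>2_def X\<^sub>3_def)

end

lemma eval_alg_slots:
  assumes f: "graded_map l M regular_bimodule f"
  shows "eval [alg_slot \<mu>, alg_slot f] (\<delta> 2 x) = (f (left x), 0)"
    and "eval [alg_slot f, alg_slot \<mu>] (\<delta> 2 x) = (signed l (f (right x)), 0)"
    and "eval [alg_slot \<mu>, alg_slot \<mu>, alg_slot f] (\<delta> 3 x) = (f (X\<^sub>1 x), 0)"
    and "eval [alg_slot \<mu>, alg_slot f, alg_slot \<mu>] (\<delta> 3 x) = (signed l (f (X\<^sub>2 x)), 0)"
    and "eval [alg_slot f, alg_slot \<mu>, alg_slot \<mu>] (\<delta> 3 x) = (f (X\<^sub>3 x), 0)"
proof -
  \<comment> \<open>The involution is inserted because the middle and right contractions are defined with it.\<close>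
  have sw: "alg_slot f = (\<lambda>x. signed l (alg_slot (\<lambda>x. f (inv_pow 1 x)) x))"
    by (simp add: fun_eq_iff inv_pow_to_algebra [OF f] alg_slot_signed)
       (simp add: signed_def)
  show "eval [alg_slot \<mu>, alg_slot f] (\<delta> 2 x) = (f (left x), 0)"
    "eval [alg_slot \<mu>, alg_slot \<mu>, alg_slot f] (\<delta> 3 x) = (f (X\<^sub>1 x), 0)"
    "eval [alg_slot f, alg_slot \<mu>, alg_slot \<mu>] (\<delta> 3 x) = (f (X\<^sub>3 x), 0)"
    using eval_post_alg [OF f, of "[alg_slot \<mu>]" "[]" "\<lambda>x. x"]
      eval_post_alg [OF f, of "[alg_slot \<mu>, alg_slot \<mu>]" "[]" "\<lambda>x. x"]
      eval_post_alg [OF f, of "[]" "[alg_slot \<mu>, alg_slot \<mu>]" "\<lambda>x. x"]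
    by (auto simp: left_def X\<^sub>1_def X\<^sub>3_def)
  show "eval [alg_slot f, alg_slot \<mu>] (\<delta> 2 x) = (signed l (f (right x)), 0)"
    using eval_post_alg [OF f, of "[]" "[alg_slot \<mu>]" "inv_pow 1" "\<delta> 2 x"]
    by (subst sw) (simp add: eval_signed_slots right_def signed_pair)
  show "eval [alg_slot \<mu>, alg_slot f, alg_slot \<mu>] (\<delta> 3 x) = (signed l (f (X\<^sub>2 x)), 0)"
    using eval_post_alg [OF f, of "[alg_slot \<mu>]" "[alg_slot \<mu>]" "inv_pow 1" "\<delta> 3 x"]
    by (subst sw) (simp add: eval_signed_slots X\<^sub>2_def signed_pair)
qed

lemma \<mu>_left: "\<mu> (left x) = - \<mu> x" and \<mu>_right: "\<mu> (right x) = \<mu> x"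
proof -
  have "(\<mu> (left x), 0 :: 'm) = (- \<mu> x, 0)" "(signed (- 1) (\<mu> (right x)), 0 :: 'm) = (- \<mu> x, 0)"
    using eval_alg_slots(1,2) [OF \<mu>_graded, of x] by (simp_all only: eval_counit)
  then show "\<mu> (left x) = - \<mu> x" "\<mu> (right x) = \<mu> x"
    by (simp_all add: signed_def)
qed

lemma eval_12: "(\<lambda>y. eval [alg_slot \<mu>, mod_slot (\<lambda>x. x)] (\<delta> 2 y)) = mod_slot left"
  using eval_mod_slots(1) [OF graded_map_id] by (simp add: mod_slot_def fun_eq_iff)

lemma eval_21: "(\<lambda>y. eval [mod_slot (inv_pow 1), alg_slot \<mu>] (\<delta> 2 y)) = mod_slot right"
  using eval_mod_slots(2) [OF graded_map_id] by (simp add: mod_slot_def fun_eq_iff)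

lemma eval_12': "(\<lambda>y. eval [alg_slot \<mu>, mod_slot (inv_pow 1)] (\<delta> 2 y)) = mod_slot (\<lambda>x. left (inv_pow 1 x))"
  using eval_mod_slots(1) [OF inv_pow_graded_map] inv_pow_graded [OF left_graded]
  by (simp add: mod_slot_def fun_eq_iff signed_def)

lemma eval_21': "(\<lambda>y. eval [mod_slot (\<lambda>x. x), alg_slot \<mu>] (\<delta> 2 y)) = mod_slot (\<lambda>x. right (inv_pow 1 x))"
  using eval_mod_slots(2) [OF inv_pow_graded_map [of 1]] inv_pow_graded [OF right_graded]
  by (simp add: mod_slot_def fun_eq_iff signed_def inv_pow_inv_pow inv_pow_even)

lemma eval_11: "(\<lambda>y. eval [alg_slot \<mu>, alg_slot \<mu>] (\<delta> 2 y)) = (\<lambda>x. signed 1 (alg_slot \<mu> x))"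
  by (simp add: eval_counit alg_slot_def fun_eq_iff signed_def)

lemma mod_slot_comp:
  "(\<lambda>y. mod_slot f (d y)) = mod_slot (\<lambda>y. f (d y))"
  "(\<lambda>y. mod_slot f (inv_pow k y)) = mod_slot (\<lambda>y. f (inv_pow k y))"
  by (simp_all add: mod_slot_def fun_eq_iff)

lemma mod_slot_minus: "mod_slot (\<lambda>x. - f x) = (\<lambda>x. signed 1 (mod_slot f x))"
  by (simp add: mod_slot_def fun_eq_iff signed_def)

lemma inv_pow_d: "inv_pow 1 (d y) = - d (inv_pow 1 y)"
  using inv_pow_graded [OF d_graded, of 1 y] by (simp add: signed_def)

text \<open>
  The relation for \<open>N = 2\<close> says that \<open>\<delta>\<^sub>2\<close> anticommutes with the differentials; as \<open>\<mu>\<close> kills boundaries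
  and is odd, the contractions \<open>L\<close> and \<open>R\<close> commute with \<open>d\<close>.
\<close>

lemma left_d: "left (d x) = d (left x)"
proof -
  have "insertion 1 \<delta> \<delta> [alg_slot \<mu>, mod_slot (\<lambda>x. x)] x = 0"
    by (rule insertion_delta) (simp add: slot_\<mu> slot_id)
  then show ?thesis
    by (simp add: insertion_2 eval_delta_0 eval_zero_slots eval_delta_1 slot_\<mu> slot_id \<mu>_slot_d
        \<mu>_slot_inv_pow mod_slot_comp eval_12 slot_mod_slot [OF left_graded] eval_signed_slots
        eval_mod_slots(1) [OF d_graded])
       (simp add: mod_slot_def signed_def prod_eq_iff)
qed

lemma right_d: "right (d x) = d (right x)"
proof -
  have "insertion 1 \<delta> \<delta> [mod_slot (inv_pow 1), alg_slot \<mu>] x = 0"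
    by (rule insertion_delta) (simp add: slot_\<mu> slot_mod_slot [OF inv_pow_graded_map])
  then show ?thesis
    by (simp add: insertion_2 eval_delta_0 eval_zero_slots eval_delta_1 slot_\<mu>
        slot_mod_slot [OF inv_pow_graded_map] \<mu>_slot_d mod_slot_comp eval_21
        slot_mod_slot [OF right_graded] inv_pow_d mod_slot_minus eval_signed_slots
        eval_mod_slots(2) [OF d_graded])
       (simp add: mod_slot_def signed_def prod_eq_iff)
qed

text \<open>
  In the relation for \<open>N = 3\<close> the terms with \<open>\<delta>\<^sub>1\<close> contribute the boundary of \<open>X\<^sub>i\<close>, and the two
  composites of \<open>\<delta>\<^sub>2\<close> with itself contribute products of \<open>L\<close>, \<open>R\<close> and \<open>(\<mu> \<otimes> \<mu>) \<delta>\<^sub>2 = \<mu>\<close>.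
\<close>

lemma d_X\<^sub>1: "d (X\<^sub>1 x) + X\<^sub>1 (d x) = left (left x) + left x"
proof -
  have X: "(\<lambda>y. eval [alg_slot \<mu>, alg_slot \<mu>, mod_slot (\<lambda>x. x)] (\<delta> 3 y)) = mod_slot X\<^sub>1"
    using eval_mod_slots(3) [OF graded_map_id] by (simp add: mod_slot_def fun_eq_iff)
  have "insertion 1 \<delta> \<delta> [alg_slot \<mu>, alg_slot \<mu>, mod_slot (\<lambda>x. x)] x = 0"
    by (rule insertion_delta) (simp add: slot_\<mu> slot_id)
  then show ?thesis
    by (simp add: insertion_3 delta_0 eval_zero eval_zero_slots eval_delta_1 slot_\<mu> slot_id \<mu>_slot_d
        \<mu>_slot_inv_pow mod_slot_comp X eval_11 eval_12 slot_mod_slot [OF X_graded(1)] eval_signed_slots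
        eval_mod_slots(3) [OF d_graded] eval_mod_slots(1) [OF left_graded])
       (simp add: eval_mod_slots(1) [OF graded_map_id], simp add: mod_slot_def signed_def prod_eq_iff algebra_simps)
qed

lemma d_X\<^sub>2: "d (X\<^sub>2 x) + X\<^sub>2 (d x) = right (left x) - left (right x)"
proof -
  have X: "(\<lambda>y. eval [alg_slot \<mu>, mod_slot (inv_pow 1), alg_slot \<mu>] (\<delta> 3 y)) = mod_slot X\<^sub>2"
    using eval_mod_slots(4) [OF graded_map_id] by (simp add: mod_slot_def fun_eq_iff)
  have "insertion 1 \<delta> \<delta> [alg_slot \<mu>, mod_slot (inv_pow 1), alg_slot \<mu>] x = 0"
    by (rule insertion_delta) (simp add: slot_\<mu> slot_mod_slot [OF inv_pow_graded_map])
  then show ?thesis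
    by (simp add: insertion_3 delta_0 eval_zero eval_zero_slots eval_delta_1 slot_\<mu>
        slot_mod_slot [OF inv_pow_graded_map] \<mu>_slot_d
        \<mu>_slot_inv_pow mod_slot_comp X eval_12' eval_21 slot_mod_slot [OF X_graded(2)] eval_signed_slots
        inv_pow_d mod_slot_minus eval_mod_slots(4) [OF d_graded] eval_mod_slots(1) [OF right_graded]
        eval_mod_slots(2) [OF left_graded])
       (simp add: mod_slot_def signed_def prod_eq_iff algebra_simps)
qed

lemma d_X\<^sub>3: "d (X\<^sub>3 x) + X\<^sub>3 (d x) = right x - right (right x)"
proof -
  have X: "(\<lambda>y. eval [mod_slot (\<lambda>x. x), alg_slot \<mu>, alg_slot \<mu>] (\<delta> 3 y)) = mod_slot X\<^sub>3"
    using eval_mod_slots(5) [OF graded_map_id] by (simp add: mod_slot_def fun_eq_iff)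
  have "insertion 1 \<delta> \<delta> [mod_slot (\<lambda>x. x), alg_slot \<mu>, alg_slot \<mu>] x = 0"
    by (rule insertion_delta) (simp add: slot_\<mu> slot_id)
  then show ?thesis
    by (simp add: insertion_3 delta_0 eval_zero eval_zero_slots eval_delta_1 slot_\<mu> slot_id \<mu>_slot_d
        \<mu>_slot_inv_pow mod_slot_comp X eval_21' eval_11 slot_mod_slot [OF X_graded(3)] eval_signed_slots
        eval_mod_slots(5) [OF d_graded] eval_mod_slots(2) [OF right_graded]
        eval_mod_slots(2) [OF graded_map_id])
       (simp add: mod_slot_def signed_def prod_eq_iff algebra_simps)
qed

lemmas left_add = graded_map_add_eq [OF left_graded] graded_map_diff_eq [OF left_graded]
lemmas right_add = graded_map_add_eq [OF right_graded] graded_map_diff_eq [OF right_graded]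
lemmas \<mu>_add = graded_map_add_eq [OF \<mu>_graded] graded_map_diff_eq [OF \<mu>_graded]

text \<open>
  The map \<open>T = R - L - 1\<close>. As \<open>R\<close> is homotopic to \<open>1\<close> and \<open>L\<close> to \<open>-1\<close>, it is homotopic to the identity.
\<close>

definition near_id :: "'m \<Rightarrow> 'm" where
  "near_id x = right x - left x - x"

lemma near_id_graded: "graded_map 0 M M near_id"
  unfolding near_id_def
  by (intro graded_map_diff additive_actions_M right_graded left_graded graded_map_id)

lemma near_id_homotopic_id:
  obtains \<kappa> where "graded_map (- 1) M M \<kappa>" "\<And>x. near_id x = x + d (\<kappa> x) + \<kappa> (d x)"
proof -
  have g: "graded_map 0 M M (\<lambda>x. near_id x - x)"
    by (intro graded_map_diff additive_actions_M near_id_graded graded_map_id)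
  obtain \<kappa> where \<kappa>: "graded_map (0 - 1) M M \<kappa>" "\<And>x. near_id x - x = d (\<kappa> x) + signed 0 (\<kappa> (d x))"
    by (rule null_homotopic [OF g])
       (auto simp: near_id_def signed_def d_diff left_d right_d \<mu>_add \<mu>_left \<mu>_right)
  have "near_id x = x + d (\<kappa> x) + \<kappa> (d x)" for x
    using \<kappa>(2) [of x] by (simp add: signed_def algebra_simps)
  with \<kappa>(1) that show thesis
    by simp
qed

lemma counit_homotopy:
  obtains \<phi> where "graded_map (- 1) M M \<phi>" "\<And>x. left x + right x = d (\<phi> x) + \<phi> (d x)"
proof -
  have g: "graded_map 0 M M (\<lambda>x. left x + right x)"
    by (intro graded_map_add additive_actions_M left_graded right_graded)
  obtain \<phi> where \<phi>: "graded_map (0 - 1) M M \<phi>" "\<And>x. left x + right x = d (\<phi> x) + signed 0 (\<phi> (d x))"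
    by (rule null_homotopic [OF g])
       (auto simp: signed_def d_add left_d right_d \<mu>_add \<mu>_left \<mu>_right)
  then show thesis
    using that by (simp add: signed_def)
qed

text \<open>
  The boundary of \<open>\<phi> T\<close> is \<open>(L + R)(R - L - 1)\<close>. The sum of the boundaries of the \<open>X\<^sub>i\<close> is
  \<open>L\<^sup>2 + L + R L - L R + R - R\<^sup>2\<close>, which is its negative.
\<close>

lemma coassociativity_homotopy:
  assumes \<phi>: "graded_map (- 1) M M \<phi>" "\<And>x. left x + right x = d (\<phi> x) + \<phi> (d x)"
  obtains h where "graded_map (- 2) M M h"
    "\<And>x. \<phi> (near_id x) + X\<^sub>1 x + X\<^sub>2 x + X\<^sub>3 x = d (h x) - h (d x)"
proof -
  let ?W = "\<lambda>x. \<phi> (near_id x) + X\<^sub>1 x + X\<^sub>2 x + X\<^sub>3 x"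
  have g: "graded_map (- 1) M M ?W"
    by (intro graded_map_add additive_actions_M X_graded graded_map_comp [OF near_id_graded \<phi>(1)]) simp
  have chain: "d (?W x) = signed (- 1) (?W (d x))" for x
  proof -
    have "near_id (d x) = d (near_id x)"
      by (simp add: near_id_def d_diff left_d right_d)
    then have "d (\<phi> (near_id x)) + \<phi> (near_id (d x)) = left (near_id x) + right (near_id x)"
      using \<phi>(2) [of "near_id x"] by simp
    note phi_near_id = this
    have "d (?W x) + ?W (d x) = (d (\<phi> (near_id x)) + \<phi> (near_id (d x))) +
        (d (X\<^sub>1 x) + X\<^sub>1 (d x)) + (d (X\<^sub>2 x) + X\<^sub>2 (d x)) + (d (X\<^sub>3 x) + X\<^sub>3 (d x))"
      by (simp add: d_add algebra_simps)
    also have "\<dots> = 0"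
      unfolding phi_near_id d_X\<^sub>1 d_X\<^sub>2 d_X\<^sub>3 by (simp add: near_id_def left_add right_add)
    finally show ?thesis
      by (simp add: signed_def add_eq_0_iff2)
  qed
  obtain h where h: "graded_map (- 1 - 1) M M h" "\<And>x. ?W x = d (h x) + signed (- 1) (h (d x))"
    by (rule null_homotopic [OF g _ chain]) auto
  then show thesis
    using that [of h] by (simp add: signed_def)
qed

end

section \<open>Coderivations give homotopy liftings\<close>

lemma signed_eq_0_iff [simp]: "signed k x = 0 \<longleftrightarrow> x = (0 :: 'g::ab_group_add)"
  by (simp add: signed_def)

lemma signed_solve:
  assumes "- b = signed k (z + signed (k - 1) r + c + signed k (signed k y) + signed k l
      + signed k (signed k x))"
  shows "r - l - b = signed k (x + y + z + c :: 'g::ab_group_add)"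
proof -
  have "b = - signed k (z + signed (k - 1) r + c + signed k (signed k y) + signed k l
      + signed k (signed k x))"
    using assms by (metis minus_minus)
  then show ?thesis
    by (cases "even k") (simp_all add: signed_def algebra_simps)
qed

locale resolution_coderivation = counital_resolution s M d \<mu> \<delta>
  for s :: "'k::field \<Rightarrow> 'a::{ring,monoid_mult} \<Rightarrow> 'a" and M :: "('a, 'm::ab_group_add) gbimodule"
    and d :: "'m \<Rightarrow> 'm" and \<mu> :: "'m \<Rightarrow> 'a" and \<delta> :: "nat \<Rightarrow> 'm \<Rightarrow> ('a, 'm) words set" +
  fixes n :: int and \<alpha> :: "nat \<Rightarrow> 'm \<Rightarrow> ('a, 'm) words set"
  assumes coderivation: "A_infinity_coderivation M \<delta> n \<alpha>"
begin

lemma alpha_graded: "graded_map n M (tensor_power M k) (\<alpha> k)"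
  using coderivation by (simp add: A_infinity_coderivation_def)

lemmas alpha_carrier = graded_map_carrier [OF alpha_graded]
lemmas alpha_bimodule_valued = bimodule_valued_graded_map [OF alpha_graded]

lemma insertion_alpha:
  assumes gs: "\<forall>g\<in>set gs. C.slot g"
  shows "insertion 1 \<delta> \<alpha> gs x = signed n (insertion n \<alpha> \<delta> gs x)"
proof -
  have eq: "(\<Sum>(r, k, t)\<in>{(r, k, t). r + k + t = length gs}.
      tensor_insert M r 1 (\<delta> k) t (\<alpha> (length gs - k + 1) x)) =
    tensor_signed n (\<Sum>(r, k, t)\<in>{(r, k, t). r + k + t = length gs}.
      tensor_insert M r n (\<alpha> k) t (\<delta> (length gs - k + 1) x))"
    using coderivation unfolding A_infinity_coderivation_def by blast
  have 1: "insertion 1 \<delta> \<alpha> gs x = eval gs (\<Sum>(r, k, t)\<in>{(r, k, t). r + k + t = length gs}.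
      tensor_insert M r 1 (\<delta> k) t (\<alpha> (length gs - k + 1) x))"
    by (rule eval_insertion(1) [symmetric])
       (simp_all add: delta_bimodule_valued delta_carrier alpha_carrier gs)
  show ?thesis
    unfolding 1 eq using eval_insertion [of \<alpha> \<delta> x gs "length gs" n] gs
    by (simp add: eval_signed delta_carrier alpha_carrier alpha_bimodule_valued)
qed

definition "\<alpha>\<^sub>0 x = fst (eval [] (\<alpha> 0 x))"
definition "\<alpha>\<^sub>1 x = snd (eval [mod_slot (\<lambda>x. x)] (\<alpha> 1 x))"

lemma alpha_0: "\<alpha> 0 x = tensor_of_alg M (\<alpha>\<^sub>0 x)"
  by (simp add: \<alpha>\<^sub>0_def tensor_of_alg_eval alpha_carrier)

lemma alpha_1: "\<alpha> 1 x = tensor_of_mod M (\<alpha>\<^sub>1 x)"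
proof -
  have "mod_slot (\<lambda>x. x) = Pair 0"
    by (simp add: mod_slot_def fun_eq_iff)
  then show ?thesis
    using tensor_of_mod_eval [OF alpha_carrier] by (simp add: \<alpha>\<^sub>1_def)
qed

lemma alpha_0_graded: "graded_map n M regular_bimodule \<alpha>\<^sub>0"
  unfolding \<alpha>\<^sub>0_def by (rule graded_map_fst_eval [where ls = "[]" and e = n and n = 0]) (simp_all add: alpha_graded)

lemma alpha_1_graded: "graded_map n M M \<alpha>\<^sub>1"
  unfolding \<alpha>\<^sub>1_def
  by (rule graded_map_snd_eval [where ls = "[0]" and e = n and n = 1])
     (simp_all add: alpha_graded homogeneous_mod_slot graded_map_id)

lemma eval_alpha_0: "(\<lambda>y. eval [] (\<alpha> 0 y)) = alg_slot \<alpha>\<^sub>0"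
  by (simp add: alpha_0 eval_tensor_of_alg alg_slot_def fun_eq_iff)

lemma eval_alpha_1: "C.slot g \<Longrightarrow> eval [g] (\<alpha> (Suc 0) x) = g (\<alpha>\<^sub>1 x)"
  using alpha_1 [of x] by (simp add: eval_tensor_of_mod)

lemmas slot_\<alpha>\<^sub>0 = slot_alg_slot [OF alpha_0_graded]

text \<open>The case \<open>N = 0\<close> of the coderivation identity.\<close>

lemma alpha_0_d: "\<alpha>\<^sub>0 (d x) = 0"
proof -
  have "insertion 1 \<delta> \<alpha> [] x = signed n (insertion n \<alpha> \<delta> [] x)"
    by (rule insertion_alpha) simp
  then show ?thesis
    by (simp add: insertion_0 eval_delta_0 eval_zero_slots eval_alpha_0 eval_delta_1 slot_\<alpha>\<^sub>0)
       (simp add: alg_slot_def signed_def prod_eq_iff split: if_splits)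
qed

definition "commutator x = snd (eval [alg_slot \<alpha>\<^sub>0, mod_slot (\<lambda>x. x)] (\<delta> 2 x))
  + snd (eval [mod_slot (inv_pow n), alg_slot \<alpha>\<^sub>0] (\<delta> 2 x))"

text \<open>The case \<open>N = 1\<close> of the coderivation identity.\<close>

lemma d_alpha_1: "d (\<alpha>\<^sub>1 x) = signed n (\<alpha>\<^sub>1 (d x) + commutator x)"
proof -
  have "insertion 1 \<delta> \<alpha> [mod_slot (\<lambda>x. x)] x = signed n (insertion n \<alpha> \<delta> [mod_slot (\<lambda>x. x)] x)"
    by (rule insertion_alpha) (simp add: slot_id)
  then have "snd (insertion 1 \<delta> \<alpha> [mod_slot (\<lambda>x. x)] x) =
      signed n (snd (insertion n \<alpha> \<delta> [mod_slot (\<lambda>x. x)] x))"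
    by (simp add: signed_def split: if_splits)
  moreover have "(\<lambda>x. mod_slot (\<lambda>x. x) (\<alpha>\<^sub>1 x)) = mod_slot \<alpha>\<^sub>1"
    by (simp add: mod_slot_def fun_eq_iff)
  ultimately show ?thesis
    by (simp add: insertion_1 eval_delta_0 eval_alpha_0 eval_zero_slots eval_delta_1 eval_alpha_1
        slot_id slot_mod_slot [OF d_graded] slot_mod_slot [OF alpha_1_graded] mod_slot_comp
        commutator_def)
       (simp add: mod_slot_def algebra_simps)
qed

lemma \<mu>_commutator: "\<mu> (commutator x) = signed n (\<alpha>\<^sub>0 (left x + right x))"
proof -
  have 1: "eval [alg_slot \<alpha>\<^sub>0, alg_slot \<mu>] (\<delta> 2 x) =
      (\<mu> (snd (eval [alg_slot \<alpha>\<^sub>0, mod_slot (\<lambda>x. x)] (\<delta> 2 x))), 0)"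
    using eval_post_alg [OF \<mu>_graded, of "[alg_slot \<alpha>\<^sub>0]" "[]" "\<lambda>x. x"] by simp
  have "eval [alg_slot (\<lambda>x. \<mu> (inv_pow n x)), alg_slot \<alpha>\<^sub>0] (\<delta> 2 x) =
      (\<mu> (snd (eval [mod_slot (inv_pow n), alg_slot \<alpha>\<^sub>0] (\<delta> 2 x))), 0)"
    using eval_post_alg [OF \<mu>_graded, of "[]" "[alg_slot \<alpha>\<^sub>0]" "inv_pow n"] by simp
  then have 2: "(\<mu> (snd (eval [mod_slot (inv_pow n), alg_slot \<alpha>\<^sub>0] (\<delta> 2 x))), 0) =
      signed n (eval [alg_slot \<mu>, alg_slot \<alpha>\<^sub>0] (\<delta> 2 x))"
    by (simp add: \<mu>_inv_pow alg_slot_signed eval_signed_slots)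
  from 1 2 show ?thesis
    by (simp add: commutator_def \<mu>_add eval_alg_slots [OF alpha_0_graded] signed_pair
        graded_map_add_eq [OF alpha_0_graded] signed_add algebra_simps)
qed

lemma \<mu>_alpha_1_d: "\<mu> (\<alpha>\<^sub>1 (d x)) = - signed n (\<alpha>\<^sub>0 (left x + right x))"
proof -
  have "\<mu> (d (\<alpha>\<^sub>1 x)) = signed n (\<mu> (\<alpha>\<^sub>1 (d x)) + \<mu> (commutator x))"
    by (simp add: d_alpha_1 graded_map_signed_eq [OF \<mu>_graded] \<mu>_add)
  then have "signed n (\<mu> (\<alpha>\<^sub>1 (d x)) + \<mu> (commutator x)) = 0"
    by simp
  then have "\<mu> (\<alpha>\<^sub>1 (d x)) + \<mu> (commutator x) = 0"
    by (simp only: signed_eq_0_iff)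
  then show ?thesis
    by (simp add: \<mu>_commutator add_eq_0_iff2)
qed

lemma \<mu>_alpha_1_graded: "graded_map (n - 1) M regular_bimodule (\<lambda>x. \<mu> (\<alpha>\<^sub>1 x))"
  by (rule graded_map_comp [OF alpha_1_graded \<mu>_graded]) simp

text \<open>Not the component of the coderivation in arity \<open>2\<close> itself, but its contraction with \<open>\<mu>\<close> in both places.\<close>

definition "\<alpha>\<^sub>2 x = fst (eval [alg_slot \<mu>, alg_slot \<mu>] (\<alpha> 2 x))"

lemma alpha_2_graded: "graded_map (n - 2) M regular_bimodule \<alpha>\<^sub>2"
  unfolding \<alpha>\<^sub>2_def
  by (rule graded_map_fst_eval [where ls = "[-1, -1]" and e = n and n = 2])
     (simp_all add: alpha_graded hom_\<mu>)

text \<open>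
  The case \<open>N = 2\<close> of the coderivation identity, contracted with \<open>\<mu>\<close> twice. The composites of \<open>\<delta>\<^sub>2\<close>
  with \<open>\<alpha>\<^sub>1\<close> in either order give \<open>\<mu> \<alpha>\<^sub>1\<close>, \<open>\<mu> \<alpha>\<^sub>1 R\<close> and \<open>\<mu> \<alpha>\<^sub>1 L\<close>, which combine to \<open>\<mu> \<alpha>\<^sub>1 T\<close>; the insertions
  of \<open>\<alpha>\<^sub>0\<close> into \<open>\<delta>\<^sub>3\<close> give \<open>\<alpha>\<^sub>0 X\<^sub>i\<close>.
\<close>

lemma \<mu>_alpha_1_near_id:
  "\<mu> (\<alpha>\<^sub>1 (near_id x)) = signed n (\<alpha>\<^sub>0 (X\<^sub>1 x + X\<^sub>2 x + X\<^sub>3 x) + \<alpha>\<^sub>2 (d x))"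
proof -
  have a1: "(\<lambda>y. alg_slot \<mu> (\<alpha>\<^sub>1 y)) = alg_slot (\<lambda>x. \<mu> (\<alpha>\<^sub>1 x))"
    by (simp add: alg_slot_def fun_eq_iff)
  have sl: "C.slot (\<lambda>y. eval [alg_slot \<mu>, alg_slot \<mu>] (\<alpha> 2 y))"
    by (rule slot_eval [OF alpha_bimodule_valued]) (simp add: slot_\<mu>)
  have sl': "C.slot (\<lambda>x. signed 1 (alg_slot \<mu> x))"
    using slot_alg_slot [OF graded_map_signed [OF additive_actions_regular \<mu>_graded, of 1]]
    by (simp add: alg_slot_signed)
  have "insertion 1 \<delta> \<alpha> [alg_slot \<mu>, alg_slot \<mu>] x = signed n (insertion n \<alpha> \<delta> [alg_slot \<mu>, alg_slot \<mu>] x)"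
    by (rule insertion_alpha) (simp add: slot_\<mu>)
  then have "fst (insertion 1 \<delta> \<alpha> [alg_slot \<mu>, alg_slot \<mu>] x) =
      signed n (fst (insertion n \<alpha> \<delta> [alg_slot \<mu>, alg_slot \<mu>] x))"
    by (simp add: signed_def split: if_splits)
  then have "- \<mu> (\<alpha>\<^sub>1 x) = signed n (\<alpha>\<^sub>0 (X\<^sub>3 x) + signed (n - 1) (\<mu> (\<alpha>\<^sub>1 (right x))) + \<alpha>\<^sub>2 (d x)
      + signed n (signed n (\<alpha>\<^sub>0 (X\<^sub>2 x))) + signed n (\<mu> (\<alpha>\<^sub>1 (left x)))
      + signed n (signed n (\<alpha>\<^sub>0 (X\<^sub>1 x))))"
    by (simp add: insertion_2 eval_delta_0 eval_alpha_0 eval_zero_slots eval_delta_1 eval_alpha_1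
        slot_\<mu> \<mu>_slot_d \<mu>_slot_inv_pow eval_signed_slots a1 sl sl' eval_11 signed_pair
        eval_alg_slots [OF alpha_0_graded] eval_alg_slots [OF \<mu>_alpha_1_graded])
       (simp add: \<alpha>\<^sub>2_def alg_slot_def signed_def)
  from signed_solve [OF this] show ?thesis
    by (simp add: near_id_def graded_map_diff_eq [OF \<mu>_alpha_1_graded] graded_map_add_eq [OF alpha_0_graded])
qed

text \<open>
  The map \<open>g\<close> below is the cocycle \<open>(-1)\<^sup>n \<mu> \<alpha>\<^sub>1 + \<alpha>\<^sub>0 \<phi>\<close>. Up to the coboundary of a multiple of \<open>\<alpha>\<^sub>2\<close>, its
  composite with \<open>T\<close> is \<open>\<alpha>\<^sub>0\<close> applied to a null-homotopic map; replacing \<open>T\<close> by the homotopic map \<open>1\<close>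
  exhibits \<open>g\<close> as the coboundary of \<open>e\<close>.
\<close>

lemma homotopy_lifting_alpha:
  "homotopy_lifting M d \<mu> (\<delta> 2) n \<alpha>\<^sub>0 (\<lambda>x. signed n (\<alpha>\<^sub>1 x))"
proof -
  obtain \<phi> where \<phi>: "graded_map (- 1) M M \<phi>" "\<And>x. left x + right x = d (\<phi> x) + \<phi> (d x)"
    using counit_homotopy by blast
  obtain h where h: "graded_map (- 2) M M h"
    "\<And>x. \<phi> (near_id x) + X\<^sub>1 x + X\<^sub>2 x + X\<^sub>3 x = d (h x) - h (d x)"
    using coassociativity_homotopy [OF \<phi>] by blast
  obtain \<kappa> where \<kappa>: "graded_map (- 1) M M \<kappa>" "\<And>x. near_id x = x + d (\<kappa> x) + \<kappa> (d x)"
    using near_id_homotopic_id by blast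
  define g where "g x = \<mu> (signed n (\<alpha>\<^sub>1 x)) + \<alpha>\<^sub>0 (\<phi> x)" for x
  note a_add = graded_map_add_eq [OF alpha_0_graded] graded_map_diff_eq [OF alpha_0_graded]
  have lift: "graded_map n M M (\<lambda>x. signed n (\<alpha>\<^sub>1 x))"
    by (rule graded_map_signed [OF additive_actions_M alpha_1_graded])
  have g_graded: "graded_map (n - 1) M regular_bimodule g"
    unfolding g_def
    by (intro graded_map_add additive_actions_regular graded_map_comp [OF lift \<mu>_graded]
        graded_map_comp [OF \<phi>(1) alpha_0_graded]) simp_all
  note g_add = graded_map_add_eq [OF g_graded]
  have g_d: "g (d x) = 0" for x
  proof -
    have "\<phi> (d x) = left x + right x - d (\<phi> x)"
      by (simp add: \<phi>(2))
    then show ?thesis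
      by (simp add: g_def graded_map_signed_eq [OF \<mu>_graded] \<mu>_alpha_1_d a_add alpha_0_d)
         (simp add: signed_def)
  qed
  have g_near_id: "g (near_id x) = \<alpha>\<^sub>2 (d x) - \<alpha>\<^sub>0 (h (d x))" for x
  proof -
    have "\<phi> (near_id x) = d (h x) - h (d x) - (X\<^sub>1 x + X\<^sub>2 x + X\<^sub>3 x)"
      using h(2) [of x] by (simp add: algebra_simps)
    then have "\<alpha>\<^sub>0 (\<phi> (near_id x)) = - \<alpha>\<^sub>0 (h (d x)) - \<alpha>\<^sub>0 (X\<^sub>1 x + X\<^sub>2 x + X\<^sub>3 x)"
      by (simp only: a_add alpha_0_d) simp
    then show ?thesis
      by (simp add: g_def graded_map_signed_eq [OF \<mu>_graded] \<mu>_alpha_1_near_id)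
         (simp add: signed_def)
  qed
  define e where "e x = - signed n (\<alpha>\<^sub>2 x - \<alpha>\<^sub>0 (h x) - g (\<kappa> x))" for x
  have g_exact: "g x = signed n (- e (d x))" for x
  proof -
    have "g (near_id x) = g x + g (\<kappa> (d x))"
      by (subst \<kappa>(2)) (simp add: g_add g_d)
    then have "g x = \<alpha>\<^sub>2 (d x) - \<alpha>\<^sub>0 (h (d x)) - g (\<kappa> (d x))"
      by (simp add: g_near_id algebra_simps)
    then show ?thesis
      by (simp add: e_def) (simp add: signed_def)
  qed
  have "graded_map (n - 1 - 1) M regular_bimodule e"
    unfolding e_def using alpha_2_graded
    by (intro graded_map_minus graded_map_signed graded_map_diff additive_actions_regular
        graded_map_comp [OF h(1) alpha_0_graded] graded_map_comp [OF \<kappa>(1) g_graded]) simp_all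
  moreover have "(\<lambda>x. g x - 0) = hom_diff d (\<lambda>_. 0) (n - 1 - 1) e"
    by (simp add: fun_eq_iff hom_diff_def g_exact) (simp add: signed_def)
  ultimately have "homotopic M d regular_bimodule (\<lambda>_. 0) (n - 1) g (\<lambda>_. 0)"
    by (auto simp: homotopic_def)
  moreover have "tensor_of_mod M (hom_diff d d (- 1) \<phi> x) = tensor_commutator M (\<delta> 2) (- 1) \<mu> x" for x
  proof -
    have "mod_slot (inv_pow (- 1)) = mod_slot (inv_pow 1)"
      by (simp add: mod_slot_def fun_eq_iff inv_pow_cong [of "- 1" 1])
    then have "tensor_commutator M (\<delta> 2) (- 1) \<mu> x = tensor_of_mod M (left x + right x)"
      by (simp add: commutator_eq [OF \<mu>_graded delta_graded] left_def right_def)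
    moreover have "hom_diff d d (- 1) \<phi> x = left x + right x"
      by (simp add: hom_diff_def signed_def \<phi>(2))
    ultimately show ?thesis
      by simp
  qed
  moreover have "tensor_of_mod M (hom_diff d d n (\<lambda>x. signed n (\<alpha>\<^sub>1 x)) x) =
      tensor_commutator M (\<delta> 2) n \<alpha>\<^sub>0 x" for x
  proof -
    have "hom_diff d d n (\<lambda>x. signed n (\<alpha>\<^sub>1 x)) x = commutator x"
      by (simp add: hom_diff_def d_signed d_alpha_1 signed_add) (simp add: signed_def)
    then show ?thesis
      by (simp add: commutator_eq [OF alpha_0_graded delta_graded] commutator_def)
  qed
  moreover have "hom_diff d (\<lambda>_. 0) n \<alpha>\<^sub>0 = (\<lambda>_. 0)"
    by (simp add: hom_diff_def alpha_0_d)
  ultimately show ?thesis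
    unfolding homotopy_lifting_def using alpha_0_graded lift \<phi>(1)
    by (auto simp: g_def [abs_def])
qed

end

theorem lemma4p5p4:
  fixes s :: "'k::field \<Rightarrow> 'a::{ring,monoid_mult} \<Rightarrow> 'a"
    and P :: "('a, 'p::ab_group_add) gbimodule"
    and d :: "'p \<Rightarrow> 'p" and \<mu> :: "'p \<Rightarrow> 'a"
    and \<delta> \<alpha> :: "nat \<Rightarrow> 'p \<Rightarrow> ('a, 'p) words set"
    and n :: int
  assumes "unital_algebra s"
    and "shifted_projective_resolution s P d \<mu>"
    and "A_infinity_coalgebra s P \<delta>"
    and "\<delta> 1 = tensor_of_mod P \<circ> d"
    and "weak_counit P \<delta> \<mu>"
    and "A_infinity_coderivation P \<delta> n \<alpha>"
  shows "homotopy_lifting P d \<mu> (\<delta> 2) n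
           (inv (tensor_of_alg P) \<circ> \<alpha> 0)
           (\<lambda>x. signed n ((inv (tensor_of_mod P) \<circ> \<alpha> 1) x))"
proof -
  obtain P' where P': "projective_resolution s P' d \<mu>" and P: "P = shift P'"
    using assms(2) by (auto simp: shifted_projective_resolution_def)
  have shift: "component P i = component P' (i - 1)" "lact P = lact P'" "ract P = ract P'" for i
    by (simp_all add: P shift_def)
  interpret bimodule_resolution s P d \<mu>
  proof
    show "graded_bimodule s P"
      using assms(3) by (simp add: A_infinity_coalgebra_def)
    show "unital_algebra s"
      by (rule assms(1))
    show "component P i = {0}" if "i > 1" for i
      using P' that by (simp add: shift projective_resolution_def)
    show "projective_bimodule s P (component P i)" for i
      using P' by (simp add: shift projective_resolution_def projective_bimodule_def bimodule_hom_def)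
    show "graded_map 1 P P d"
    proof -
      have d: "graded_map 1 P' P' d"
        using P' by (simp add: projective_resolution_def)
      then have "d ` component P' (i - 1) \<subseteq> component P' (i - 1 + 1)" for i
        unfolding graded_map_def by (elim conjE allE)
      with d show ?thesis
        by (simp add: graded_map_def bimodule_hom_def shift)
    qed
    show "d (d x) = 0" "\<mu> (d x) = 0" for x
      using P' by (simp_all add: projective_resolution_def)
    show "graded_map (- 1) P regular_bimodule \<mu>"
      using P' unfolding projective_resolution_def graded_map_def bimodule_hom_def shift by simp
    have "x \<in> d ` component P' (j - 1)" if "j < 0" "x \<in> component P' j" "d x = 0" for j x
      using P' that by (simp add: projective_resolution_def)
    from this [of "i - 1" x for i x]
    show "x \<in> d ` component P (i - 1)" if "i < 1" "x \<in> component P i" "d x = 0" for i x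
      using that by (simp add: shift)
    show "x \<in> d ` component P 0" if "x \<in> component P 1" "\<mu> x = 0" for x
      using P' that unfolding projective_resolution_def shift by simp
  qed
  interpret resolution_coderivation s P d \<mu> \<delta> n \<alpha>
    by unfold_locales (use assms in simp_all)
  have "inv (tensor_of_alg P) \<circ> \<alpha> 0 = \<alpha>\<^sub>0"
    by (simp add: fun_eq_iff alpha_0 inj_tensor_of_alg)
  moreover have "inv (tensor_of_mod P) \<circ> \<alpha> 1 = \<alpha>\<^sub>1"
    using alpha_1 by (simp add: fun_eq_iff inj_tensor_of_mod)
  ultimately show ?thesis
    using homotopy_lifting_alpha by simp
qed

end
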